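(* Let $p>1$, $q=\frac p{p-1}$, and let $f$ be a non-zero real smooth function on $\mathbb R^n$ with compact support. Then \[ \operatorname{vol}(K_f)^{-\frac pn}\int_{\mathbb R^n}C_f^*(\nabla f(x))\,dx\le a_2\,Z_p(f)^p,\qquad a_2=\frac{\ell_q\,n^{\frac{n+p}{n}}}{a_1(n+p)}. \] Moreover, if equality holds, then there exists an invertible matrix $M$ with $\det M>0$ such that \[ \mathcal E_p(f)^p=\det(M)^{\frac{p-n}{n}}\int_{\mathbb R^n}|\nabla g|^p\,dx,\qquad g(x)=f(M^{-1}x). \]
   Context: $\omega_k=\pi^{k/2}/\Gamma(\frac k2+1)$. For $\xi\in\mathbb R^n$, $\nabla_\xi f=\nabla f\cdot\xi$ and $\|\nabla_\xi f\|_p$ is its $L^p(\mathbb R^n)$ norm; $d\xi$ is surface measure on $\mathbb S^{n-1}$. Define $C_f^*(x)=\int_{\mathbb S^{n-1}}\|\nabla_\xi f\|_p^{-n-p}|\langle x,\xi\rangle|^p\,d\xi$, $C_f$ its Legendre transform $C_f(y)=\sup_x\{\langle x,y\rangle-C_f^*(x)\}$, $K_f=\{x:C_f(x)\le1\}$, $\ell_q=q^{-p/q}p^{-1}$, $a_1=\frac{\omega_{n+p}}{\omega_2\omega_n\omega_{p-1}}$, \[ Z_p(f)=\Big(\int_{\mathbb S^{n-1}}\|\nabla_\xi f\|_p^{-n}d\xi\Big)^{-\frac1n},\quad \mathcal E_p(f)=c_{n,p}Z_p(f),\quad c_{n,p}=(n\omega_n)^{\frac1n}\Big(\frac{n\omega_n\omega_{p-1}}{2\omega_{n+p-2}}\Big)^{\frac1p}.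 \] *)

theory Defs
  imports "HOL-Analysis.Analysis"
begin

text \<open>C^k and C^infinity regularity (as in the AFP entry Smooth_Manifolds).\<close>
fun higher_differentiable_on :: "'a::real_normed_vector set \<Rightarrow> ('a \<Rightarrow> 'b::real_normed_vector) \<Rightarrow> nat \<Rightarrow> bool" where
  "higher_differentiable_on S f 0 \<longleftrightarrow> continuous_on S f"
| "higher_differentiable_on S f (Suc n) \<longleftrightarrow>
     (\<forall>x\<in>S. f differentiable (at x)) \<and>
     (\<forall>v. higher_differentiable_on S (\<lambda>x. frechet_derivative f (at x) v) n)"

definition smooth :: "('a::real_normed_vector \<Rightarrow> 'b::real_normed_vector) \<Rightarrow> bool" where
  "smooth f \<longleftrightarrow> (\<forall>k. higher_differentiable_on UNIV f k)"

definition grad :: "(real^'n \<Rightarrow> real) \<Rightarrow> real^'n \<Rightarrow> real^'n" where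
  "grad f x = (THE D. GDERIV f x :> D)"

text \<open>Volume of the unit ball in dimension k (k real).\<close>
definition omega :: "real \<Rightarrow> real" where
  "omega k = pi powr (k / 2) / Gamma (k / 2 + 1)"

text \<open>Integral over the unit sphere S^{n-1} w.r.t. surface measure, via the
  cone-measure identity  int_S g = n * int_{B} g(x/|x|) dx.\<close>
definition sphere_integral :: "(real^'n \<Rightarrow> real) \<Rightarrow> real" where
  "sphere_integral g = real CARD('n) * (LINT x : ball 0 1 | lborel. g (x /\<^sub>R norm x))"

definition dir_grad_norm :: "real \<Rightarrow> (real^'n \<Rightarrow> real) \<Rightarrow> real^'n \<Rightarrow> real" where
  "dir_grad_norm p f \<xi> = (LINT x | lborel. \<bar>grad f x \<bullet> \<xi>\<bar> powr p) powr (1 / p)"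

definition Cstar :: "real \<Rightarrow> (real^'n \<Rightarrow> real) \<Rightarrow> real^'n \<Rightarrow> real" where
  "Cstar p f x = sphere_integral (\<lambda>\<xi>. dir_grad_norm p f \<xi> powr (- real CARD('n) - p) * \<bar>x \<bullet> \<xi>\<bar> powr p)"

definition Cf :: "real \<Rightarrow> (real^'n \<Rightarrow> real) \<Rightarrow> real^'n \<Rightarrow> ereal" where
  "Cf p f y = (SUP x. ereal (x \<bullet> y - Cstar p f x))"

definition Kf :: "real \<Rightarrow> (real^'n \<Rightarrow> real) \<Rightarrow> (real^'n) set" where
  "Kf p f = {x. Cf p f x \<le> 1}"

definition Zp :: "real \<Rightarrow> (real^'n \<Rightarrow> real) \<Rightarrow> real" where
  "Zp p f = (sphere_integral (\<lambda>\<xi>. dir_grad_norm p f \<xi> powr (- real CARD('n)))) powr (- 1 / real CARD('n))"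

definition ell :: "real \<Rightarrow> real \<Rightarrow> real" where
  "ell p q = q powr (- p / q) * inverse p"

definition a1 :: "real \<Rightarrow> real \<Rightarrow> real" where
  "a1 n p = omega (n + p) / (omega 2 * omega n * omega (p - 1))"

definition cnp :: "real \<Rightarrow> real \<Rightarrow> real" where
  "cnp n p = (n * omega n) powr (1 / n) *
     (n * omega n * omega (p - 1) / (2 * omega (n + p - 2))) powr (1 / p)"

definition Ep :: "real \<Rightarrow> (real^'n \<Rightarrow> real) \<Rightarrow> real" where
  "Ep p f = cnp (real CARD('n)) p * Zp p f"

end

(* Put N = dir_grad_norm p f, a norm on R^n with unit ball L, and let h be the support function of the L^p
   centroid body of L, h(x)^p = int_L |x.y|^p dy.  By Fubini and polar coordinates the integral of Cstar(grad f)
   is n vol(L) = Zp^(-n), Cstar is a multiple of h^p, and K_f is a dilate of the body H with support function h.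
   The inequality thus is the L^p Busemann-Petty centroid inequality: vol(H) / vol(L)^((n+p)/p) is least for
   ellipsoids, and only for them.

   This ratio is invariant under linear maps.  It attains its minimum, by compactness after moving norms to
   Auerbach position.  Steiner symmetrisation of L preserves vol(L) and, by the convexity of t |-> |t|^p on lines
   parallel to u, does not increase vol(H); if it does not decrease vol(H) either, then the midpoints of the
   chords of L parallel to u lie on a hyperplane, i.e. L is invariant under a skew reflection along u.  If L is
   moreover in isotropic position, that reflection is orthogonal.  Hence an isotropic minimiser is invariant under
   all reflections, so it is a ball. *)

theory Submission
  imports Defs "HOL-Complex_Analysis.Great_Picard"
begin

section \<open>Fubini along a line and linear substitution\<close>

text \<open>The equality case shapes the argument. Repeated symmetrisation converging to a ball
  would give the inequality but lose equality in the limit. A minimiser needs only one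
  symmetrisation per direction, and any norm attaining the bound is itself a minimiser, so one
  rigidity statement settles both claims. The volume of H does not increase because the centroid
  body of the symmetrised L lies inside the Steiner symmetral of H. Equal volumes make these two
  bodies equal; comparing them in the direction u produces a functional whose integral over L is no
  larger than that of u over the symmetrised L, and this forces sharpness on almost every line.
  Bodies are represented by norms, so that statements up to null sets become identities by openness
  of unit balls. Constants: \<open>a1\<close> is the mean of the p-th power of an absolute
  coordinate over the Euclidean unit ball; \<open>ell\<close> comes from Young's inequality, through
  the factor by which K_f dilates H. In the equality case M is the inverse of a matrix C that turns
  N into the Euclidean norm; the energy of f composed with C is found by averaging over
  directions.\<close>

lemma nn_integral_lborel_translate:
  fixes a :: "'a::euclidean_space"
  assumes [measurable]: "f \<in> borel_measurable borel"
  shows "(\<integral>\<^sup>+x. f (x + a) \<partial>lborel) = (\<integral>\<^sup>+x. f x \<partial>lborel)"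
proof -
  have "(\<integral>\<^sup>+x. f x \<partial>lborel) = (\<integral>\<^sup>+x. f x \<partial>distr lborel borel ((+) a))"
    by (simp add: lborel_distr_plus)
  also have "\<dots> = (\<integral>\<^sup>+x. f (x + a) \<partial>lborel)"
    by (subst nn_integral_distr) (auto simp: add.commute)
  finally show ?thesis by simp
qed

definition slab :: "'a::euclidean_space \<Rightarrow> 'a \<Rightarrow> ennreal" where
  "slab u x = indicator {x. 0 \<le> x \<bullet> u \<and> x \<bullet> u < 1} x"

lemma slab_measurable [measurable]: "slab u \<in> borel_measurable borel"
proof -
  have "{x. 0 \<le> x \<bullet> u \<and> x \<bullet> u < 1} \<in> sets borel" by measurable
  then show ?thesis unfolding slab_def[abs_def] by measurable
qed

text \<open>Fubini in the direction \<open>u\<close> without splitting coordinates: averaging over the slab meets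
  every line parallel to \<open>u\<close> in a segment of length 1.\<close>

lemma nn_integral_slices:
  fixes u :: "'a::euclidean_space"
  assumes [measurable]: "f \<in> borel_measurable borel" and u: "norm u = 1"
  shows "(\<integral>\<^sup>+x. f x \<partial>lborel) = (\<integral>\<^sup>+x. slab u x * (\<integral>\<^sup>+t. f (x + t *\<^sub>R u) \<partial>lborel) \<partial>lborel)"
proof -
  have uu: "u \<bullet> u = 1" using u by (simp add: dot_square_norm)
  have "(\<integral>\<^sup>+x. slab u x * (\<integral>\<^sup>+t. f (x + t *\<^sub>R u) \<partial>lborel) \<partial>lborel)
      = (\<integral>\<^sup>+x. \<integral>\<^sup>+t. slab u x * f (x + t *\<^sub>R u) \<partial>lborel \<partial>lborel)"
    by (intro nn_integral_cong nn_integral_cmult[symmetric]) auto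
  also have "\<dots> = (\<integral>\<^sup>+t. \<integral>\<^sup>+x. slab u x * f (x + t *\<^sub>R u) \<partial>lborel \<partial>lborel)"
    by (rule lborel_pair.Fubini') measurable
  also have "\<dots> = (\<integral>\<^sup>+t. \<integral>\<^sup>+x. slab u (x - t *\<^sub>R u) * f x \<partial>lborel \<partial>lborel)"
    by (intro nn_integral_cong nn_integral_lborel_translate[of "\<lambda>x. slab u (x - t *\<^sub>R u) * f x" "t *\<^sub>R u" for t, simplified])
       measurable
  also have "\<dots> = (\<integral>\<^sup>+x. \<integral>\<^sup>+t. slab u (x - t *\<^sub>R u) * f x \<partial>lborel \<partial>lborel)"
    by (rule lborel_pair.Fubini'[symmetric]) measurable
  also have "\<dots> = (\<integral>\<^sup>+x. f x \<partial>lborel)"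
  proof (intro nn_integral_cong)
    fix x :: 'a
    have "(\<integral>\<^sup>+t. slab u (x - t *\<^sub>R u) * f x \<partial>lborel) = (\<integral>\<^sup>+t. f x * indicator {x \<bullet> u - 1 <.. x \<bullet> u} t \<partial>lborel)"
      by (intro nn_integral_cong) (auto simp: slab_def indicator_def inner_diff_left uu)
    also have "\<dots> = f x"
      by (subst nn_integral_cmult_indicator) auto
    finally show "(\<integral>\<^sup>+t. slab u (x - t *\<^sub>R u) * f x \<partial>lborel) = f x" .
  qed
  finally show ?thesis by simp
qed

text \<open>On a line parallel to \<open>axis m 1\<close> the coordinate \<open>n\<close> is
  constant, so the shear acts there as a translation.\<close>

lemma nn_integral_shear:
  fixes f :: "real^'n \<Rightarrow> ennreal"
  assumes [measurable]: "f \<in> borel_measurable borel" and mn: "m \<noteq> n"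
  shows "(\<integral>\<^sup>+x. f (x + (c * x $ n) *\<^sub>R axis m 1) \<partial>lborel) = (\<integral>\<^sup>+x. f x \<partial>lborel)"
proof -
  let ?e = "axis m 1 :: real^'n"
  have m: "(\<lambda>x. f (x + (c * x $ n) *\<^sub>R ?e)) \<in> borel_measurable borel"
    by measurable
  have "(\<integral>\<^sup>+x. f (x + (c * x $ n) *\<^sub>R ?e) \<partial>lborel)
     = (\<integral>\<^sup>+x. slab ?e x * (\<integral>\<^sup>+t. f (x + t *\<^sub>R ?e + (c * (x + t *\<^sub>R ?e) $ n) *\<^sub>R ?e) \<partial>lborel) \<partial>lborel)"
    by (rule nn_integral_slices[OF m]) auto
  also have "\<dots> = (\<integral>\<^sup>+x. slab ?e x * (\<integral>\<^sup>+t. f (x + t *\<^sub>R ?e) \<partial>lborel) \<partial>lborel)"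
  proof (rule nn_integral_cong, rule arg_cong2[of _ _ _ _ "(*)"], rule refl)
    fix x :: "real^'n"
    have "(\<integral>\<^sup>+t. f (x + t *\<^sub>R ?e + (c * (x + t *\<^sub>R ?e) $ n) *\<^sub>R ?e) \<partial>lborel)
        = (\<integral>\<^sup>+t. f (x + (t + c * x $ n) *\<^sub>R ?e) \<partial>lborel)"
      using mn by (intro nn_integral_cong) (simp add: axis_def algebra_simps)
    also have "\<dots> = (\<integral>\<^sup>+t. f (x + t *\<^sub>R ?e) \<partial>lborel)"
      by (rule nn_integral_lborel_translate[of "\<lambda>t. f (x + t *\<^sub>R ?e)"]) measurable
    finally show "(\<integral>\<^sup>+t. f (x + t *\<^sub>R ?e + (c * (x + t *\<^sub>R ?e) $ n) *\<^sub>R ?e) \<partial>lborel) = (\<integral>\<^sup>+t. f (x + t *\<^sub>R ?e) \<partial>lborel)" .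
  qed
  also have "\<dots> = (\<integral>\<^sup>+x. f x \<partial>lborel)"
    by (rule nn_integral_slices[symmetric]) auto
  finally show ?thesis .
qed

text \<open>A swap maps boxes to boxes with the same side lengths in another order, and boxes
  determine Lebesgue measure.\<close>

lemma nn_integral_swap_coordinates:
  fixes f :: "real^'n \<Rightarrow> ennreal"
  assumes [measurable]: "f \<in> borel_measurable borel"
  shows "(\<integral>\<^sup>+x. f (\<chi> i. x $ Transposition.transpose m n i) \<partial>lborel) = (\<integral>\<^sup>+x. f x \<partial>lborel)"
proof -
  let ?h = "\<lambda>v::real^'n. \<chi> i. v $ Transposition.transpose m n i"
  have lin: "linear ?h"
    by (rule linearI) (simp_all add: plus_vec_def scaleR_vec_def)
  have [measurable]: "?h \<in> borel \<rightarrow>\<^sub>M borel"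
    using lin by (intro borel_measurable_continuous_onI linear_continuous_on) (simp add: linear_conv_bounded_linear)
  have "lborel = distr lborel borel ?h"
  proof (rule lborel_eqI)
    fix l u :: "real^'n" assume le: "\<And>b. b \<in> Basis \<Longrightarrow> l \<bullet> b \<le> u \<bullet> b"
    have le': "l $ i \<le> u $ i" for i
      using le[of "axis i 1"] by (auto simp: inner_axis Basis_vec_def)
    have pre: "?h -` box l u = box (?h l) (?h u)"
    proof (intro set_eqI iffI)
      fix x assume "x \<in> ?h -` box l u"
      then have "l $ i < x $ Transposition.transpose m n i" "x $ Transposition.transpose m n i < u $ i" for i
        by (auto simp: mem_box_cart)
      from this[of "Transposition.transpose m n i" for i] show "x \<in> box (?h l) (?h u)"
        by (auto simp: mem_box_cart)
    next
      fix x assume "x \<in> box (?h l) (?h u)"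
      then have "l $ Transposition.transpose m n i < x $ i" "x $ i < u $ Transposition.transpose m n i" for i
        by (auto simp: mem_box_cart)
      from this[of "Transposition.transpose m n i" for i] show "x \<in> ?h -` box l u"
        by (auto simp: mem_box_cart)
    qed
    have prodB: "(\<Prod>b\<in>Basis. v \<bullet> b) = (\<Prod>i\<in>UNIV. v $ i)" for v :: "real^'n"
    proof -
      have B: "Basis = (\<lambda>i. axis i (1::real)) ` (UNIV::'n set)"
        by (auto simp: Basis_vec_def)
      show ?thesis unfolding B
        by (subst prod.reindex) (auto simp: inj_on_def axis_eq_axis inner_axis)
    qed
    have "emeasure (distr lborel borel ?h) (box l u) = emeasure lborel (box (?h l) (?h u))"
      by (simp add: emeasure_distr pre)
    also have "\<dots> = ennreal (\<Prod>b\<in>Basis. (?h u - ?h l) \<bullet> b)"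
      using le' by (subst emeasure_lborel_box) (auto simp: Basis_vec_def inner_axis)
    also have "(\<Prod>b\<in>Basis. (?h u - ?h l) \<bullet> b) = (\<Prod>b\<in>Basis. (u - l) \<bullet> b)"
      unfolding prodB
      using prod.permute[OF permutes_swap_id, where S=UNIV and g="\<lambda>i. (u - l)$i", of m n]
      by (simp add: o_def)
    finally show "emeasure (distr lborel borel ?h) (box l u) = ennreal (\<Prod>b\<in>Basis. (u - l) \<bullet> b)" .
  qed simp
  then have "(\<integral>\<^sup>+x. f x \<partial>lborel) = (\<integral>\<^sup>+x. f x \<partial>distr lborel borel ?h)" by simp
  also have "\<dots> = (\<integral>\<^sup>+x. f (?h x) \<partial>lborel)"
    by (subst nn_integral_distr) auto
  finally show ?thesis by simp
qed

lemma measurable_matrix_vector_mult [measurable]: "(*v) (A::real^'n^'m) \<in> borel \<rightarrow>\<^sub>M borel"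
  by (intro borel_measurable_continuous_onI linear_continuous_on) (simp add: matrix_vector_mul_bounded_linear)

text \<open>The library's change of variables needs a well-ordered index type.\<close>

lemma nn_integral_matrix:
  fixes A :: "real^'n^'n"
  assumes "det A \<noteq> 0" and "f \<in> borel_measurable borel"
  shows "ennreal \<bar>det A\<bar> * (\<integral>\<^sup>+x. f (A *v x) \<partial>lborel) = (\<integral>\<^sup>+x. f x \<partial>lborel)"
proof -
  have "det A \<noteq> 0 \<longrightarrow> (\<forall>f\<in>borel_measurable borel.
      ennreal \<bar>det A\<bar> * (\<integral>\<^sup>+x. f (A *v x) \<partial>lborel) = (\<integral>\<^sup>+x. f x \<partial>lborel))" (is "?P A")
  \<comment> \<open>The hypothesis on the determinant is part of the induction predicate: it makes
    the case of a zero row vacuous and passes to both factors of a product.\<close>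
  proof (rule induct_matrix_elementary[where P="?P"])
    fix A B :: "real^'n^'n" assume A: "?P A" and B: "?P B"
    show "?P (A ** B)"
    proof (intro impI ballI)
      fix f :: "real^'n \<Rightarrow> ennreal" assume [measurable]: "f \<in> borel_measurable borel"
      assume "det (A ** B) \<noteq> 0"
      then have d: "det A \<noteq> 0" "det B \<noteq> 0" by (auto simp: det_mul)
      have "ennreal \<bar>det (A ** B)\<bar> * (\<integral>\<^sup>+x. f ((A ** B) *v x) \<partial>lborel)
          = ennreal \<bar>det A\<bar> * (ennreal \<bar>det B\<bar> * (\<integral>\<^sup>+x. f (A *v (B *v x)) \<partial>lborel))"
        by (simp add: det_mul abs_mult ennreal_mult' matrix_vector_mul_assoc mult.assoc)
      also have "ennreal \<bar>det B\<bar> * (\<integral>\<^sup>+x. f (A *v (B *v x)) \<partial>lborel) = (\<integral>\<^sup>+x. f (A *v x) \<partial>lborel)"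
      proof -
        have "(\<lambda>x. f (A *v x)) \<in> borel_measurable borel" by measurable
        then show ?thesis using B[THEN mp, THEN bspec, of "\<lambda>x. f (A *v x)"] d by simp
      qed
      also have "ennreal \<bar>det A\<bar> * \<dots> = (\<integral>\<^sup>+x. f x \<partial>lborel)"
        using A d by auto
      finally show "ennreal \<bar>det (A ** B)\<bar> * (\<integral>\<^sup>+x. f ((A ** B) *v x) \<partial>lborel) = (\<integral>\<^sup>+x. f x \<partial>lborel)" .
    qed
  next
    fix A :: "real^'n^'n" and i assume "row i A = 0"
    then show "?P A" by (simp add: det_zero_row)
  next
    fix A :: "real^'n^'n" assume diag: "\<And>i j. i \<noteq> j \<Longrightarrow> A $ i $ j = 0"
    show "?P A"
    proof (intro impI ballI)
      fix f :: "real^'n \<Rightarrow> ennreal" assume [measurable]: "f \<in> borel_measurable borel"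
      assume d: "det A \<noteq> 0"
      have detA: "det A = (\<Prod>i\<in>UNIV. A $ i $ i)" by (rule det_diagonal) (rule diag)
      define c where "c = (\<lambda>b::real^'n. b \<bullet> (A *v b))"
      have B: "Basis = (\<lambda>i. axis i (1::real)) ` (UNIV::'n set)"
        by (auto simp: Basis_vec_def)
      have cax: "c (axis i 1) = A $ i $ i" for i
        by (simp add: c_def matrix_vector_mult_basis inner_axis' column_def)
      have c0: "c j \<noteq> 0" if "j \<in> Basis" for j
        using that d by (auto simp: B cax detA)
      have T: "0 + (\<Sum>j\<in>Basis. (c j * (x \<bullet> j)) *\<^sub>R j) = A *v x" for x
      proof -
        have "(\<Sum>j\<in>Basis. (c j * (x \<bullet> j)) *\<^sub>R j) = (\<Sum>i\<in>UNIV. (A $ i $ i * x $ i) *\<^sub>R axis i 1)"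
          unfolding B by (subst sum.reindex) (auto simp: inj_on_def axis_eq_axis cax inner_axis)
        moreover have "(A *v x) $ k = (\<Sum>i\<in>UNIV. (A $ i $ i * x $ i) *\<^sub>R axis i 1) $ k" for k
        proof -
          have "(A *v x) $ k = (\<Sum>j\<in>UNIV. A $ k $ j * x $ j)" by (simp add: matrix_vector_mult_def)
          also have "\<dots> = (\<Sum>j\<in>UNIV. if j = k then A $ k $ k * x $ k else 0)"
            using diag by (intro sum.cong) auto
          also have "\<dots> = A $ k $ k * x $ k" by simp
          finally show ?thesis by (simp add: axis_def if_distrib cong: if_cong)
        qed
        ultimately show ?thesis by (simp add: vec_eq_iff)
      qed
      have pc: "(\<Prod>j\<in>Basis. \<bar>c j\<bar>) = \<bar>det A\<bar>"
        unfolding B detA by (subst prod.reindex) (auto simp: inj_on_def axis_eq_axis cax abs_prod)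
      have "lborel = density (distr lborel borel (\<lambda>x. A *v x)) (\<lambda>_. ennreal \<bar>det A\<bar>)"
        using lborel_affine_euclidean[of c 0, OF c0] unfolding T pc .
      then have "(\<integral>\<^sup>+x. f x \<partial>lborel) = (\<integral>\<^sup>+x. f x \<partial>density (distr lborel borel (\<lambda>x. A *v x)) (\<lambda>_. ennreal \<bar>det A\<bar>))"
        by simp
      also have "\<dots> = ennreal \<bar>det A\<bar> * (\<integral>\<^sup>+x. f (A *v x) \<partial>lborel)"
        by (simp add: nn_integral_density nn_integral_distr nn_integral_cmult)
      finally show "ennreal \<bar>det A\<bar> * (\<integral>\<^sup>+x. f (A *v x) \<partial>lborel) = (\<integral>\<^sup>+x. f x \<partial>lborel)" by simp
    qed
  next
    fix m n :: 'n assume "m \<noteq> n"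
    let ?A = "(\<chi> i j. mat 1 $ i $ Transposition.transpose m n j) :: real^'n^'n"
    have 1: "\<bar>det ?A\<bar> = 1"
      by (simp add: det_permute_columns permutes_swap_id sign_swap_id abs_mult)
    have 2: "?A *v x = (\<chi> i. x $ Transposition.transpose m n i)" for x :: "real^'n"
    proof -
      have "(?A *v x) $ i = x $ Transposition.transpose m n i" for i
      proof -
        have "(?A *v x) $ i = (\<Sum>j\<in>UNIV. if j = Transposition.transpose m n i then x $ j else 0)"
        proof -
          have "(i = Transposition.transpose m n j) = (j = Transposition.transpose m n i)" for j
            by (metis transpose_involutory)
          then show ?thesis
            by (simp add: matrix_vector_mult_def mat_def if_distrib[of "\<lambda>z. z * _"] cong: if_cong)
        qed
        then show ?thesis by simp
      qed
      then show ?thesis by (simp add: vec_eq_iff)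
    qed
    show "?P ?A" unfolding 1 2 by (auto simp: nn_integral_swap_coordinates)
  next
    fix m n :: 'n and c assume mn: "m \<noteq> n"
    let ?A = "(\<chi> i j. if i = m \<and> j = n then c else of_bool (i = j)) :: real^'n^'n"
    have "?A = (\<chi> k. if k = m then row m (mat 1) + c *s row n (mat 1) else row k (mat 1))"
      using mn by (auto simp: vec_eq_iff row_def mat_def)
    then have 1: "det ?A = 1" using det_row_operation[OF mn, of "mat 1" c] by (simp only: det_I)
    have 2: "?A *v x = x + (c * x $ n) *\<^sub>R axis m 1" for x :: "real^'n"
    proof -
      have "(?A *v x) $ i = (x + (c * x $ n) *\<^sub>R axis m 1) $ i" for i
      proof -
        have "(?A *v x) $ i = (\<Sum>j\<in>UNIV. (if j = i then x $ j else 0) + (if j = n then (if i = m then c * x $ n else 0) else 0))"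
          using mn by (auto simp: matrix_vector_mult_def intro!: sum.cong)
        also have "\<dots> = x $ i + (if i = m then c * x $ n else 0)"
          by (subst sum.distrib) simp
        finally show ?thesis by (simp add: axis_def)
      qed
      then show ?thesis by (simp add: vec_eq_iff)
    qed
    show "?P ?A" unfolding 1 2 using mn by (auto simp: nn_integral_shear)
  qed
  then show ?thesis using assms by blast
qed

section \<open>Norms on a Euclidean space\<close>

text \<open>A predicate, since many norms on one space are compared. It encodes origin-symmetric
  convex bodies by their gauges.\<close>

definition is_norm :: "('a::euclidean_space \<Rightarrow> real) \<Rightarrow> bool" where
  "is_norm N \<longleftrightarrow> (\<forall>x y. N (x + y) \<le> N x + N y) \<and> (\<forall>t x. N (t *\<^sub>R x) = \<bar>t\<bar> * N x) \<and> (\<forall>x. x \<noteq> 0 \<longrightarrow> 0 < N x)"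

lemma is_normI:
  assumes "\<And>x y. N (x + y) \<le> N x + N y" "\<And>t x. N (t *\<^sub>R x) = \<bar>t\<bar> * N x" "\<And>x. x \<noteq> 0 \<Longrightarrow> 0 < N x"
  shows "is_norm N"
  using assms by (auto simp: is_norm_def)

lemma is_norm_norm: "is_norm norm"
  by (rule is_normI) (auto intro: norm_triangle_ineq)

context
  fixes N :: "'a::euclidean_space \<Rightarrow> real"
  assumes N: "is_norm N"
begin

lemma is_norm_triangle: "N (x + y) \<le> N x + N y"
  using N by (auto simp: is_norm_def)

lemma is_norm_scale: "N (t *\<^sub>R x) = \<bar>t\<bar> * N x"
  using N by (auto simp: is_norm_def)

lemma is_norm_pos: "x \<noteq> 0 \<Longrightarrow> 0 < N x"
  using N by (auto simp: is_norm_def)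

lemma is_norm_zero: "N 0 = 0"
  using is_norm_scale[of 0 0] by simp

lemma is_norm_nonneg: "0 \<le> N x"
  using is_norm_pos[of x] is_norm_zero by (cases "x = 0") auto

lemma is_norm_minus: "N (- x) = N x"
  using is_norm_scale[of "-1" x] by simp

lemma is_norm_minus_commute: "N (x - y) = N (y - x)"
  using is_norm_minus[of "x - y"] by simp

lemma is_norm_diff: "\<bar>N x - N y\<bar> \<le> N (x - y)"
  using is_norm_triangle[of "x - y" y] is_norm_triangle[of "y - x" x] is_norm_minus_commute[of x y] by auto

lemma is_norm_sum: "finite S \<Longrightarrow> N (\<Sum>i\<in>S. g i) \<le> (\<Sum>i\<in>S. N (g i))"
  by (induction S rule: finite_induct) (auto simp: is_norm_zero intro: order_trans[OF is_norm_triangle])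

lemma is_norm_upper: "\<exists>C>0. \<forall>x. N x \<le> C * norm x"
proof (intro exI conjI allI)
  show "0 < (\<Sum>b\<in>Basis. N b) + 1"
    using sum_nonneg[of Basis N] is_norm_nonneg by (auto intro: add_nonneg_pos)
  fix x :: 'a
  have "N x = N (\<Sum>b\<in>Basis. (x \<bullet> b) *\<^sub>R b)" by (simp add: euclidean_representation)
  also have "\<dots> \<le> (\<Sum>b\<in>Basis. N ((x \<bullet> b) *\<^sub>R b))" by (rule is_norm_sum) simp
  also have "\<dots> \<le> (\<Sum>b\<in>Basis. norm x * N b)"
    by (intro sum_mono) (auto simp: is_norm_scale is_norm_nonneg Basis_le_norm intro: mult_right_mono)
  also have "\<dots> = norm x * (\<Sum>b\<in>Basis. N b)" by (simp add: sum_distrib_left)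
  also have "\<dots> \<le> ((\<Sum>b\<in>Basis. N b) + 1) * norm x" by (simp add: algebra_simps)
  finally show "N x \<le> \<dots>" .
qed

lemma is_norm_continuous: "continuous_on UNIV N"
proof -
  obtain C where C: "C > 0" "\<And>x. N x \<le> C * norm x" using is_norm_upper by auto
  have "dist (N x) (N y) \<le> C * dist x y" for x y
    using is_norm_diff[of x y] C(2)[of "x - y"] by (simp add: dist_norm dist_real_def)
  then have "C-lipschitz_on UNIV N"
    using C by (intro lipschitz_onI) auto
  then show ?thesis by (rule lipschitz_on_continuous_on)
qed

lemma is_norm_measurable: "N \<in> borel_measurable borel"
  using is_norm_continuous by (rule borel_measurable_continuous_onI)

lemma is_norm_lower: "\<exists>c>0. \<forall>x. c * norm x \<le> N x"
proof -
  have "compact (sphere (0::'a) 1)" "sphere (0::'a) 1 \<noteq> {}" by auto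
  moreover have "continuous_on (sphere 0 1) N" using is_norm_continuous continuous_on_subset by blast
  ultimately obtain x0 where x0: "x0 \<in> sphere 0 1" "\<And>y. y \<in> sphere 0 1 \<Longrightarrow> N x0 \<le> N y"
    using continuous_attains_inf by metis
  have "x0 \<noteq> 0" using x0(1) by auto
  have "N x0 * norm x \<le> N x" for x
  proof (cases "x = 0")
    case True then show ?thesis by (simp add: is_norm_zero)
  next
    case False
    then have "N x0 \<le> N (inverse (norm x) *\<^sub>R x)" by (intro x0(2)) simp
    also have "\<dots> = N x / norm x" by (simp add: is_norm_scale divide_inverse mult.commute)
    finally show ?thesis using False by (simp add: field_simps)
  qed
  then show ?thesis using is_norm_pos[OF \<open>x0 \<noteq> 0\<close>] by blast
qed

lemma is_norm_open_less: "open {x. N x < r}"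
  by (rule open_Collect_less) (use is_norm_continuous in auto)

lemma is_norm_open_greater: "open {x. r < N x}"
  by (rule open_Collect_less) (use is_norm_continuous in auto)

lemma is_norm_ball_measurable [measurable]: "{x. N x < r} \<in> sets borel"
  using is_norm_open_less by auto

lemma is_norm_cball_compact: "compact {x. N x \<le> r}"
proof -
  obtain c where c: "c > 0" "\<And>x. c * norm x \<le> N x" using is_norm_lower by auto
  have "closed {x. N x \<le> r}" by (rule closed_Collect_le) (use is_norm_continuous in auto)
  moreover have "bounded {x. N x \<le> r}"
  proof (rule boundedI)
    fix x assume "x \<in> {x. N x \<le> r}"
    then have "c * norm x \<le> r" using c(2)[of x] by auto
    then show "norm x \<le> r / c" using c(1) by (simp add: field_simps)
  qed
  ultimately show ?thesis by (simp add: compact_eq_bounded_closed)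
qed

lemma is_norm_ball_finite: "emeasure lborel {x. N x < r} < \<infinity>"
proof -
  have "bounded {x. N x < r}"
    by (rule bounded_subset[OF compact_imp_bounded[OF is_norm_cball_compact[of r]]]) auto
  then show ?thesis by (rule emeasure_bounded_finite)
qed

lemma is_norm_ball_pos: "0 < measure lborel {x. N x < 1}"
proof -
  have "emeasure lborel {x. N x < 1} \<noteq> 0"
  proof
    assume "emeasure lborel {x. N x < 1} = 0"
    moreover have "0 \<in> {x. N x < 1}" by (simp add: is_norm_zero)
    ultimately show False
      using open_not_negligible[OF is_norm_open_less[of 1]]
      by (auto simp: negligible_iff_emeasure0 emeasure_completion)
  qed
  then show ?thesis
    using is_norm_ball_finite[of 1] by (simp add: measure_def enn2real_positive_iff zero_less_iff_neq_zero)
qed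

end

lemma open_null_empty:
  fixes U :: "'a::euclidean_space set"
  assumes "open U" "emeasure lborel U = 0"
  shows "U = {}"
  using open_not_negligible[OF assms(1)] assms by (auto simp: negligible_iff_emeasure0 emeasure_completion)

text \<open>A violation of the inequality at \<open>z\<close> makes the open set where
  \<open>N\<close> is below 1 and \<open>M\<close> above 1 nonempty, hence of positive measure. This
  is how almost-everywhere information from Fubini becomes pointwise.\<close>

lemma is_norm_le_of_null:
  fixes N M :: "'a::euclidean_space \<Rightarrow> real"
  assumes N: "is_norm N" and M: "is_norm M"
    and null: "emeasure lborel {x. N x < 1 \<and> \<not> M x < 1} = 0"
  shows "M z \<le> N z"
proof (rule ccontr)
  assume "\<not> M z \<le> N z"
  then have less: "N z < M z" by simp
  \<comment> \<open>The reciprocal of the mean of \<open>N z\<close> and \<open>M z\<close>, which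
    puts 1 strictly between the two norms of \<open>t *\<^sub>R z\<close>.\<close>
  define t where "t = 2 / (N z + M z)"
  have pos: "0 < N z + M z" using less is_norm_nonneg[OF N, of z] by linarith
  let ?U = "{x. N x < 1} \<inter> {x. 1 < M x}"
  have "emeasure lborel ?U \<le> emeasure lborel {x. N x < 1 \<and> \<not> M x < 1}"
    using is_norm_measurable[OF N] is_norm_measurable[OF M]
    by (intro emeasure_mono) auto
  then have "?U = {}"
    using null by (intro open_null_empty open_Int is_norm_open_less is_norm_open_greater N M) auto
  moreover have "t *\<^sub>R z \<in> ?U"
    using less pos by (auto simp: is_norm_scale[OF N] is_norm_scale[OF M] t_def field_simps)
  ultimately show False by auto
qed

text \<open>Nested unit balls of the same finite volume differ by a null set. This extracts rigidity
  from equality of volumes.\<close>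

lemma is_norm_eq_of_measure_le:
  fixes N M :: "'a::euclidean_space \<Rightarrow> real"
  assumes N: "is_norm N" and M: "is_norm M" and le: "\<And>x. M x \<le> N x"
    and vol: "measure lborel {x. M x < 1} \<le> measure lborel {x. N x < 1}"
  shows "M z = N z"
proof (rule antisym[OF le])
  have sub: "{x. N x < 1} \<subseteq> {x. M x < 1}" using le by (auto intro: le_less_trans)
  have m: "{x. N x < 1} \<in> sets lborel" "{x. M x < 1} \<in> sets lborel"
    using is_norm_ball_measurable[OF N] is_norm_ball_measurable[OF M] by auto
  have fin: "emeasure lborel {x. M x < 1} \<noteq> \<infinity>" using is_norm_ball_finite[OF M, of 1] by simp
  have "measure lborel ({x. M x < 1} - {x. N x < 1}) = measure lborel {x. M x < 1} - measure lborel {x. N x < 1}"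
    by (rule measure_Diff[OF fin m(2) m(1) sub])
  then have "measure lborel ({x. M x < 1} - {x. N x < 1}) = 0"
    using vol measure_nonneg[of lborel "{x. M x < 1} - {x. N x < 1}"] by linarith
  moreover have "emeasure lborel ({x. M x < 1} - {x. N x < 1}) \<noteq> \<infinity>"
    using fin emeasure_mono[of "{x. M x < 1} - {x. N x < 1}" "{x. M x < 1}" lborel] m by (auto simp: top_unique)
  ultimately have "emeasure lborel ({x. M x < 1} - {x. N x < 1}) = 0"
    by (metis emeasure_eq_ennreal_measure ennreal_0 infinity_ennreal_def)
  moreover have "{x. M x < 1} - {x. N x < 1} = {x. M x < 1 \<and> \<not> N x < 1}" by auto
  ultimately show "N z \<le> M z" using is_norm_le_of_null[OF M N] by simp
qed

lemma det_nonzero_mult_eq_0: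
  fixes A :: "real^'n^'n"
  assumes "det A \<noteq> 0" shows "A *v x = 0 \<longleftrightarrow> x = 0"
  using assms by (metis invertible_det_nz invertible_def matrix_vector_mul_assoc matrix_vector_mul_lid matrix_vector_mult_0_right)

lemma is_norm_matrix:
  fixes A :: "real^'n^'n"
  assumes N: "is_norm N" and A: "det A \<noteq> 0"
  shows "is_norm (\<lambda>x. N (A *v x))"
  by (rule is_normI)
     (simp_all add: matrix_vector_right_distrib is_norm_triangle[OF N] matrix_vector_mult_scaleR
        is_norm_scale[OF N] is_norm_pos[OF N] det_nonzero_mult_eq_0[OF A])

lemma is_norm_cmult:
  assumes N: "is_norm N" and r: "0 < r"
  shows "is_norm (\<lambda>x. r * N x)"
  using r by (intro is_normI) (auto simp: is_norm_scale[OF N] is_norm_pos[OF N] is_norm_triangle[OF N] simp flip: distrib_left)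

section \<open>\<open>L\<^sup>p\<close> norms of linear functionals\<close>

lemma convex_on_powr_nonneg:
  fixes p :: real
  assumes p: "1 \<le> p"
  shows "convex_on {0..} (\<lambda>x. x powr p)"
proof (rule convex_onI)
  fix t x y :: real assume t: "0 < t" "t < 1" and xy: "x \<in> {0..}" "y \<in> {0..}"
  \<comment> \<open>Covers an endpoint equal to 0, where convexity reduces to s^p being at most s on
    the unit interval.\<close>
  have *: "(s * z) powr p \<le> s * z powr p" if "0 < s" "s < 1" "0 \<le> z" for s z :: real
  proof -
    have "s powr p \<le> s powr 1" using that p by (intro powr_mono') auto
    then show ?thesis using that by (simp add: powr_mult mult_right_mono)
  qed
  show "((1 - t) *\<^sub>R x + t *\<^sub>R y) powr p \<le> (1 - t) * x powr p + t * y powr p"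
  proof (cases "x = 0 \<or> y = 0")
    case True
    then show ?thesis using *[of t y] *[of "1 - t" x] t xy p by auto
  next
    case False
    then show ?thesis using convex_onD[OF powr_convex[OF p], of t x y] t xy by auto
  qed
qed auto

text \<open>Convexity with weights a/(a+b) and b/(a+b) at the points |A|/a and |B|/b. If
  \<open>a\<close> and \<open>b\<close> are the p-norms of A and B, the right side integrates to
  exactly (a+b)^p; this gives Minkowski's inequality and also the symmetrisation estimate for
  centroid norms.\<close>

lemma convex_powr_abs_scaled:
  fixes A B a b p :: real
  assumes p: "1 \<le> p" and a: "0 < a" and b: "0 < b"
  shows "\<bar>A + B\<bar> powr p \<le> (a + b) powr (p - 1) * (a powr (1 - p) * \<bar>A\<bar> powr p + b powr (1 - p) * \<bar>B\<bar> powr p)"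
proof -
  define s where "s = a + b"
  have s: "0 < s" using a b by (simp add: s_def)
  have conv: "convex_on {0..} (\<lambda>x::real. x powr p)"
    using p by (rule convex_on_powr_nonneg)
  have "\<bar>A + B\<bar> \<le> \<bar>A\<bar> + \<bar>B\<bar>" by simp
  also have "\<dots> = s * ((a / s) * (\<bar>A\<bar> / a) + (b / s) * (\<bar>B\<bar> / b))"
    using a b s by (simp add: field_simps)
  finally have "\<bar>A + B\<bar> powr p \<le> (s * ((a / s) * (\<bar>A\<bar> / a) + (b / s) * (\<bar>B\<bar> / b))) powr p"
    using p by (intro powr_mono2) auto
  also have "\<dots> = s powr p * ((a / s) * (\<bar>A\<bar> / a) + (b / s) * (\<bar>B\<bar> / b)) powr p"
    using a b s by (subst powr_mult) auto
  also have "((a / s) * (\<bar>A\<bar> / a) + (b / s) * (\<bar>B\<bar> / b)) powr p \<le> (a / s) * (\<bar>A\<bar> / a) powr p + (b / s) * (\<bar>B\<bar> / b) powr p"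
    using convex_onD[OF conv, of "b / s" "\<bar>A\<bar> / a" "\<bar>B\<bar> / b"] a b s
    by (simp add: s_def field_simps)
  also have "s powr p * \<dots> = s powr (p - 1) * (a powr (1 - p) * \<bar>A\<bar> powr p + b powr (1 - p) * \<bar>B\<bar> powr p)"
    using a b s by (simp add: powr_divide powr_diff field_simps)
  finally show ?thesis using s by (simp add: s_def mult_left_mono)
qed

text \<open>Common form of two norms used below: \<open>M\<close> uniform on a unit ball with
  \<open>Y\<close> the identity gives the centroid norm, and Lebesgue measure with
  \<open>Y = grad f\<close> gives \<open>dir_grad_norm\<close>.\<close>

definition lp_functional :: "'b measure \<Rightarrow> ('b \<Rightarrow> 'a::euclidean_space) \<Rightarrow> real \<Rightarrow> 'a \<Rightarrow> real" where
  "lp_functional M Y p x = (\<integral>\<omega>. \<bar>Y \<omega> \<bullet> x\<bar> powr p \<partial>M) powr (1 / p)"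

lemma lp_functional_powr:
  assumes "0 < p"
  shows "lp_functional M Y p x powr p = (\<integral>\<omega>. \<bar>Y \<omega> \<bullet> x\<bar> powr p \<partial>M)"
  using assms by (simp add: lp_functional_def powr_powr)

text \<open>Minkowski's inequality, from \<open>convex_powr_abs_scaled\<close> with the norms of
  \<open>x\<close> and \<open>y\<close> as weights.\<close>

lemma is_norm_lp_functional:
  fixes Y :: "'b \<Rightarrow> 'a::euclidean_space"
  assumes p: "1 \<le> p"
    and int: "\<And>x. integrable M (\<lambda>\<omega>. \<bar>Y \<omega> \<bullet> x\<bar> powr p)"
    and pos: "\<And>x. x \<noteq> 0 \<Longrightarrow> (\<integral>\<omega>. \<bar>Y \<omega> \<bullet> x\<bar> powr p \<partial>M) \<noteq> 0"
  shows "is_norm (lp_functional M Y p)"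
proof (rule is_normI)
  let ?I = "\<lambda>x. (\<integral>\<omega>. \<bar>Y \<omega> \<bullet> x\<bar> powr p \<partial>M)"
  let ?N = "lp_functional M Y p"
  have p0: "0 < p" using p by simp
  have I0: "0 \<le> ?I x" for x by (rule integral_nonneg_AE) simp
  show P: "0 < ?N x" if "x \<noteq> 0" for x
    using pos[OF that] I0[of x] by (simp add: lp_functional_def)
  show S: "?N (t *\<^sub>R x) = \<bar>t\<bar> * ?N x" for t x
  proof -
    have "?I (t *\<^sub>R x) = (\<integral>\<omega>. \<bar>t\<bar> powr p * \<bar>Y \<omega> \<bullet> x\<bar> powr p \<partial>M)"
      by (intro Bochner_Integration.integral_cong) (auto simp: abs_mult powr_mult)
    also have "\<dots> = \<bar>t\<bar> powr p * ?I x" by simp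
    finally show ?thesis using p0 I0[of x] by (simp add: lp_functional_def powr_mult powr_powr)
  qed
  fix x y :: 'a
  have zero: "?N 0 = 0" using S[of 0 0] by simp
  show "?N (x + y) \<le> ?N x + ?N y"
  proof (cases "x = 0 \<or> y = 0")
    case True then show ?thesis using zero by auto
  next
    case False
    define a b where "a = ?N x" and "b = ?N y"
    have a: "0 < a" and b: "0 < b" using P False by (auto simp: a_def b_def)
    have "?I (x + y) \<le> (\<integral>\<omega>. (a + b) powr (p - 1) * (a powr (1 - p) * \<bar>Y \<omega> \<bullet> x\<bar> powr p + b powr (1 - p) * \<bar>Y \<omega> \<bullet> y\<bar> powr p) \<partial>M)"
      unfolding inner_add_right
      by (intro integral_mono) (use int[of "x + y"] int[of x] int[of y] convex_powr_abs_scaled[OF p a b] in \<open>auto simp: inner_add_right\<close>)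
    also have "\<dots> = (a + b) powr (p - 1) * (a powr (1 - p) * ?I x + b powr (1 - p) * ?I y)"
      using int by simp
    also have "\<dots> = (a + b) powr (p - 1) * (a powr (1 - p) * a powr p + b powr (1 - p) * b powr p)"
      by (simp add: a_def b_def lp_functional_powr[OF p0])
    also have "\<dots> = (a + b) powr p"
      using a b by (simp add: powr_diff)
    finally have "?I (x + y) powr (1 / p) \<le> ((a + b) powr p) powr (1 / p)"
      using I0 p0 by (intro powr_mono2) auto
    then show ?thesis using a b p0 by (simp add: powr_powr lp_functional_def[of M Y p "x + y"] a_def b_def)
  qed
qed

section \<open>Unit balls and centroid bodies\<close>

definition ubvol :: "('a::euclidean_space \<Rightarrow> real) \<Rightarrow> real" where
  "ubvol N = measure lborel {x. N x < 1}"

text \<open>For a norm \<open>h\<close> the closed unit ball of \<open>dual_norm h\<close> consists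
  of the z with x.z at most h x for all x. It is thus the convex body with support function
  \<open>h\<close>, which is why \<open>centroid_vol\<close> measures it.\<close>

definition dual_norm :: "('a::euclidean_space \<Rightarrow> real) \<Rightarrow> 'a \<Rightarrow> real" where
  "dual_norm h z = Sup ((\<lambda>x. x \<bullet> z) ` {x. h x \<le> 1})"

text \<open>The support function of the (unnormalised) \<open>L\<^sup>p\<close> centroid body of the unit ball of \<open>N\<close>.\<close>

definition centroid_norm :: "real \<Rightarrow> ('a::euclidean_space \<Rightarrow> real) \<Rightarrow> 'a \<Rightarrow> real" where
  "centroid_norm p N = lp_functional (density lborel (indicator {x. N x < 1})) (\<lambda>y. y) p"

definition centroid_vol :: "real \<Rightarrow> ('a::euclidean_space \<Rightarrow> real) \<Rightarrow> real" where
  "centroid_vol p N = ubvol (dual_norm (centroid_norm p N))"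

text \<open>The exponent is forced by linear invariance: replacing N by N composed with A multiplies
  \<open>centroid_vol\<close> by |det A|^(-(n+p)/p) and \<open>ubvol\<close> by 1/|det A|.\<close>

definition centroid_ratio :: "real \<Rightarrow> ('a::euclidean_space \<Rightarrow> real) \<Rightarrow> real" where
  "centroid_ratio p N = centroid_vol p N * ubvol N powr (- (real DIM('a) + p) / p)"

lemma ubvol_pos: "is_norm N \<Longrightarrow> 0 < ubvol N"
  by (simp add: ubvol_def is_norm_ball_pos)

lemma ubvol_emeasure: "is_norm N \<Longrightarrow> emeasure lborel {x. N x < 1} = ennreal (ubvol N)"
  using is_norm_ball_finite[of N 1] by (simp add: ubvol_def emeasure_eq_ennreal_measure)

lemma ubvol_antimono:
  assumes "is_norm N" "is_norm M" "\<And>x. N x \<le> M x"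
  shows "ubvol M \<le> ubvol N"
proof -
  have "emeasure lborel {x. M x < 1} \<le> emeasure lborel {x. N x < 1}"
    using is_norm_ball_measurable[OF assms(1)] assms(3) by (intro emeasure_mono) (auto intro: le_less_trans)
  then show ?thesis
    by (simp add: ubvol_emeasure[OF assms(1)] ubvol_emeasure[OF assms(2)] ennreal_le_iff ubvol_pos[OF assms(1)] less_imp_le)
qed

lemma ubvol_matrix:
  fixes A :: "real^'n^'n"
  assumes N: "is_norm N" and A: "det A \<noteq> 0"
  shows "ubvol (\<lambda>x. N (A *v x)) = ubvol N / \<bar>det A\<bar>"
proof -
  have [measurable]: "{x. N x < 1} \<in> sets borel" by (rule is_norm_ball_measurable[OF N])
  have "ennreal (\<bar>det A\<bar> * ubvol (\<lambda>x. N (A *v x))) = ennreal \<bar>det A\<bar> * (\<integral>\<^sup>+x. indicator {x. N x < 1} (A *v x) \<partial>lborel)"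
    using is_norm_ball_measurable[OF is_norm_matrix[OF N A], of 1]
    by (simp add: ennreal_mult' ubvol_emeasure[OF is_norm_matrix[OF N A], symmetric] nn_integral_indicator[symmetric]
          del: nn_integral_indicator) (simp add: indicator_def)
  also have "\<dots> = (\<integral>\<^sup>+x. indicator {x. N x < 1} x \<partial>lborel)"
    by (rule nn_integral_matrix[OF A]) measurable
  also have "\<dots> = ennreal (ubvol N)"
    using ubvol_emeasure[OF N] by simp
  finally show ?thesis
    using A ubvol_pos[OF N] ubvol_pos[OF is_norm_matrix[OF N A]] by (simp add: field_simps)
qed

lemma matrix_scaleR_mult: "matrix ((*\<^sub>R) s) *v (x::real^'n) = s *\<^sub>R x"
  by (simp add: matrix_works linear_scaleR)

lemma ubvol_cmult:
  fixes N :: "real^'n \<Rightarrow> real"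
  assumes N: "is_norm N" and s: "0 < s"
  shows "ubvol (\<lambda>x. s * N x) = ubvol N / s ^ CARD('n)"
proof -
  have "det (matrix ((*\<^sub>R) s) :: real^'n^'n) = s ^ CARD('n)" by (rule det_matrix_scaleR)
  then show ?thesis
    using ubvol_matrix[OF N, of "matrix ((*\<^sub>R) s)"] s by (simp add: matrix_scaleR_mult is_norm_scale[OF N])
qed

subsection \<open>Dual norms\<close>

context
  fixes h :: "'a::euclidean_space \<Rightarrow> real"
  assumes h: "is_norm h"
begin

lemma dual_norm_attained: "\<exists>x. h x \<le> 1 \<and> x \<bullet> z = dual_norm h z \<and> (\<forall>y. h y \<le> 1 \<longrightarrow> y \<bullet> z \<le> dual_norm h z)"
proof -
  have ne: "{x. h x \<le> 1} \<noteq> {}" using is_norm_zero[OF h] by (auto intro!: exI[of _ 0])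
  have "continuous_on {x. h x \<le> 1} (\<lambda>x. x \<bullet> z)" by (intro continuous_intros)
  then obtain x where x: "x \<in> {x. h x \<le> 1}" "\<And>y. y \<in> {x. h x \<le> 1} \<Longrightarrow> y \<bullet> z \<le> x \<bullet> z"
    using continuous_attains_sup[OF is_norm_cball_compact[OF h, of 1] ne, of "\<lambda>x. x \<bullet> z"] by blast
  have "dual_norm h z = x \<bullet> z"
    unfolding dual_norm_def by (rule cSup_eq_maximum) (use x in auto)
  then show ?thesis using x by auto
qed

lemma dual_norm_upper: "h x \<le> 1 \<Longrightarrow> x \<bullet> z \<le> dual_norm h z"
  using dual_norm_attained[of z] by auto

lemma dual_norm_nonneg: "0 \<le> dual_norm h z"
  using dual_norm_upper[of 0 z] is_norm_zero[OF h] by simp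

lemma inner_le_dual_norm: "x \<bullet> z \<le> h x * dual_norm h z"
proof (cases "x = 0")
  case True then show ?thesis by (simp add: is_norm_zero[OF h])
next
  case False
  then have "0 < h x" by (rule is_norm_pos[OF h])
  then have "(inverse (h x) *\<^sub>R x) \<bullet> z \<le> dual_norm h z"
    by (intro dual_norm_upper) (simp add: is_norm_scale[OF h])
  with \<open>0 < h x\<close> show ?thesis by (simp add: field_simps)
qed

text \<open>The half-space description of the balls of the dual norm; later comparisons of dual
  norms go through it instead of through the supremum.\<close>

lemma dual_norm_le_iff:
  assumes "0 \<le> r"
  shows "dual_norm h z \<le> r \<longleftrightarrow> (\<forall>x. x \<bullet> z \<le> r * h x)"
proof safe
  fix x assume "dual_norm h z \<le> r"
  then have "h x * dual_norm h z \<le> h x * r" using is_norm_nonneg[OF h] by (rule mult_left_mono)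
  then show "x \<bullet> z \<le> r * h x" using inner_le_dual_norm[of x z] by (simp add: mult.commute)
next
  assume *: "\<forall>x. x \<bullet> z \<le> r * h x"
  obtain x where x: "h x \<le> 1" "x \<bullet> z = dual_norm h z" using dual_norm_attained by blast
  have "x \<bullet> z \<le> r * h x" using * by blast
  also have "\<dots> \<le> r" using x(1) assms is_norm_nonneg[OF h, of x] by (simp add: mult_left_le)
  finally show "dual_norm h z \<le> r" using x by simp
qed

lemma is_norm_dual_norm: "is_norm (dual_norm h)"
proof (rule is_normI)
  show "dual_norm h (x + y) \<le> dual_norm h x + dual_norm h y" for x y
  proof -
    have "w \<bullet> (x + y) \<le> (dual_norm h x + dual_norm h y) * h w" for w
      using inner_le_dual_norm[of w x] inner_le_dual_norm[of w y] by (simp add: inner_add_right algebra_simps)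
    then show ?thesis by (subst dual_norm_le_iff) (auto simp: dual_norm_nonneg)
  qed
  have le: "dual_norm h (t *\<^sub>R x) \<le> \<bar>t\<bar> * dual_norm h x" for t x
  proof (subst dual_norm_le_iff)
    show "\<forall>w. w \<bullet> (t *\<^sub>R x) \<le> \<bar>t\<bar> * dual_norm h x * h w"
    proof
      fix w
      have "(sgn t *\<^sub>R w) \<bullet> x \<le> dual_norm h x * h w"
        using inner_le_dual_norm[of "sgn t *\<^sub>R w" x] dual_norm_nonneg[of x] is_norm_nonneg[OF h, of w]
        by (cases "t = 0") (auto simp: is_norm_scale[OF h] mult.commute abs_sgn_eq)
      then have "\<bar>t\<bar> * ((sgn t *\<^sub>R w) \<bullet> x) \<le> \<bar>t\<bar> * (dual_norm h x * h w)"
        by (rule mult_left_mono) simp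
      moreover have "\<bar>t\<bar> * ((sgn t *\<^sub>R w) \<bullet> x) = w \<bullet> (t *\<^sub>R x)"
        by (auto simp: sgn_if abs_if)
      ultimately show "w \<bullet> (t *\<^sub>R x) \<le> \<bar>t\<bar> * dual_norm h x * h w" by (simp only: mult.assoc)
    qed
  qed (simp add: dual_norm_nonneg)
  show "dual_norm h (t *\<^sub>R x) = \<bar>t\<bar> * dual_norm h x" for t x
  proof (cases "t = 0")
    case True
    then show ?thesis using le[of 0 x] dual_norm_nonneg[of 0] by simp
  next
    case False
    have "dual_norm h (inverse t *\<^sub>R (t *\<^sub>R x)) \<le> \<bar>inverse t\<bar> * dual_norm h (t *\<^sub>R x)" by (rule le)
    then have "\<bar>t\<bar> * dual_norm h x \<le> dual_norm h (t *\<^sub>R x)" using False by (simp add: field_simps)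
    then show ?thesis using le[of t x] by simp
  qed
  show "0 < dual_norm h x" if "x \<noteq> 0" for x
  proof -
    have "0 < x \<bullet> x" using that by simp
    also have "\<dots> \<le> h x * dual_norm h x" by (rule inner_le_dual_norm)
    finally show ?thesis using is_norm_nonneg[OF h, of x] dual_norm_nonneg[of x] by (simp add: zero_less_mult_iff)
  qed
qed

end

lemma dual_norm_antimono:
  assumes h: "is_norm h" and k: "is_norm k" and le: "\<And>x. h x \<le> k x"
  shows "dual_norm k z \<le> dual_norm h z"
proof -
  have "x \<bullet> z \<le> dual_norm h z * k x" for x
  proof -
    have "x \<bullet> z \<le> h x * dual_norm h z" by (rule inner_le_dual_norm[OF h])
    also have "\<dots> \<le> k x * dual_norm h z" by (intro mult_right_mono le dual_norm_nonneg[OF h])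
    finally show ?thesis by (simp add: mult.commute)
  qed
  then show ?thesis by (subst dual_norm_le_iff[OF k]) (auto simp: dual_norm_nonneg[OF h])
qed

subsection \<open>Centroid norms\<close>

context
  fixes N :: "'a::euclidean_space \<Rightarrow> real" and p :: real
  assumes N: "is_norm N" and p: "1 \<le> p"
begin

lemma centroid_integrable:
  "integrable (density lborel (indicator {y. N y < 1})) (\<lambda>y. \<bar>y \<bullet> x\<bar> powr p)"
proof -
  have [measurable]: "{x. N x < 1} \<in> sets borel" by (rule is_norm_ball_measurable[OF N])
  obtain c where c: "c > 0" "\<And>x. c * norm x \<le> N x" using is_norm_lower[OF N] by auto
  have "finite_measure (density lborel (indicator {y. N y < 1}))"
    using is_norm_ball_finite[OF N, of 1] by (intro finite_measureI) (auto simp: emeasure_density)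
  moreover have "AE y in density lborel (indicator {y. N y < 1}). norm (\<bar>y \<bullet> x\<bar> powr p) \<le> (1 / c * norm x) powr p"
  proof (subst AE_density)
    show "AE y in lborel. 0 < (indicator {y. N y < 1} y :: ennreal) \<longrightarrow> norm (\<bar>y \<bullet> x\<bar> powr p) \<le> (1 / c * norm x) powr p"
    proof (intro AE_I2 impI)
      fix y assume "0 < (indicator {y. N y < 1} y :: ennreal)"
      then have "N y < 1" by (cases "N y < 1") auto
      then have "norm y \<le> 1 / c" using c(2)[of y] c(1) by (simp add: field_simps)
      then have "\<bar>y \<bullet> x\<bar> \<le> 1 / c * norm x"
        using Cauchy_Schwarz_ineq2[of y x] mult_right_mono[of "norm y" "1 / c" "norm x"] by auto
      then show "norm (\<bar>y \<bullet> x\<bar> powr p) \<le> (1 / c * norm x) powr p"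
        using p by (auto intro: powr_mono2)
    qed
  qed measurable
  ultimately show ?thesis
    by (intro finite_measure.integrable_const_bound) auto
qed

text \<open>The working form of the definition: for nonnegative integrals, Fubini, substitution and
  monotonicity need no integrability conditions.\<close>

lemma centroid_norm_ennreal:
  "ennreal (centroid_norm p N x powr p) = (\<integral>\<^sup>+y. indicator {y. N y < 1} y * ennreal (\<bar>y \<bullet> x\<bar> powr p) \<partial>lborel)"
proof -
  have [measurable]: "{x. N x < 1} \<in> sets borel" by (rule is_norm_ball_measurable[OF N])
  have "ennreal (centroid_norm p N x powr p) = ennreal (\<integral>y. \<bar>y \<bullet> x\<bar> powr p \<partial>density lborel (indicator {y. N y < 1}))"
    using p by (simp add: centroid_norm_def lp_functional_powr)
  also have "\<dots> = (\<integral>\<^sup>+y. ennreal (\<bar>y \<bullet> x\<bar> powr p) \<partial>density lborel (indicator {y. N y < 1}))"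
    using centroid_integrable by (intro nn_integral_eq_integral[symmetric]) auto
  also have "\<dots> = (\<integral>\<^sup>+y. indicator {y. N y < 1} y * ennreal (\<bar>y \<bullet> x\<bar> powr p) \<partial>lborel)"
    by (subst nn_integral_density) measurable
  finally show ?thesis .
qed

text \<open>Definiteness holds because the part of the unit ball where y.x is positive is open and
  nonempty, hence not null.\<close>

lemma is_norm_centroid_norm: "is_norm (centroid_norm p N)"
  unfolding centroid_norm_def
proof (rule is_norm_lp_functional[OF p centroid_integrable])
  fix x :: 'a assume x: "x \<noteq> 0"
  show "(\<integral>y. \<bar>y \<bullet> x\<bar> powr p \<partial>density lborel (indicator {y. N y < 1})) \<noteq> 0"
  proof
    assume 0: "(\<integral>y. \<bar>y \<bullet> x\<bar> powr p \<partial>density lborel (indicator {y. N y < 1})) = 0"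
    have [measurable]: "{x. N x < 1} \<in> sets borel" by (rule is_norm_ball_measurable[OF N])
    have "centroid_norm p N x powr p = 0" using 0 p by (simp add: centroid_norm_def lp_functional_powr)
    then have "(\<integral>\<^sup>+y. indicator {y. N y < 1} y * ennreal (\<bar>y \<bullet> x\<bar> powr p) \<partial>lborel) = 0"
      using centroid_norm_ennreal[of x] by simp
    then have "AE y in lborel. indicator {y. N y < 1} y * ennreal (\<bar>y \<bullet> x\<bar> powr p) = 0"
      by (subst (asm) nn_integral_0_iff_AE) auto
    then have ae: "AE y in lborel. \<not> (N y < 1 \<and> 0 < y \<bullet> x)"
      by eventually_elim (auto simp: indicator_def)
    let ?U = "{y. N y < 1} \<inter> {y. 0 < y \<bullet> x}"
    have o: "open ?U" by (intro open_Int is_norm_open_less[OF N] open_Collect_less continuous_intros)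
    have "emeasure lborel ?U = 0"
      using ae o by (subst (asm) AE_iff_measurable[of ?U]) auto
    then have "?U = {}" by (rule open_null_empty[OF o])
    moreover have "(1 / (N x + 1)) *\<^sub>R x \<in> ?U"
      using x is_norm_pos[OF N x] by (simp add: is_norm_scale[OF N])
    ultimately show False by auto
  qed
qed

end

lemma centroid_norm_antimono:
  assumes N: "is_norm N" and M: "is_norm M" and p: "1 \<le> p" and le: "\<And>x. N x \<le> M x"
  shows "centroid_norm p M x \<le> centroid_norm p N x"
proof -
  have "ennreal (centroid_norm p M x powr p) \<le> ennreal (centroid_norm p N x powr p)"
    unfolding centroid_norm_ennreal[OF N p] centroid_norm_ennreal[OF M p]
    using le by (intro nn_integral_mono) (auto simp: indicator_def intro: le_less_trans)
  then have "centroid_norm p M x powr p \<le> centroid_norm p N x powr p" by simp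
  then show ?thesis
    using p is_norm_nonneg[OF is_norm_centroid_norm[OF N p], of x] is_norm_nonneg[OF is_norm_centroid_norm[OF M p], of x]
    using powr_less_mono2[of p "centroid_norm p N x" "centroid_norm p M x"] by fastforce
qed

lemma centroid_vol_pos:
  assumes N: "is_norm N" and p: "1 \<le> p"
  shows "0 < centroid_vol p N"
  unfolding centroid_vol_def by (intro ubvol_pos is_norm_dual_norm is_norm_centroid_norm N p)

lemma centroid_vol_antimono:
  assumes N: "is_norm N" and M: "is_norm M" and p: "1 \<le> p" and le: "\<And>x. N x \<le> M x"
  shows "centroid_vol p M \<le> centroid_vol p N"
  unfolding centroid_vol_def
  by (intro ubvol_antimono dual_norm_antimono is_norm_dual_norm is_norm_centroid_norm N M p centroid_norm_antimono le)

text \<open>Substituting A y for y gives the Jacobian factor, whose p-th root appears, and moves A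
  from the vector to the functional as its transpose.\<close>

lemma centroid_norm_matrix:
  fixes A :: "real^'n^'n"
  assumes N: "is_norm N" and A: "det A \<noteq> 0" and p: "1 \<le> p"
  shows "centroid_norm p (\<lambda>x. N (A *v x)) (transpose A *v x) = \<bar>det A\<bar> powr (- 1 / p) * centroid_norm p N x"
proof -
  let ?M = "\<lambda>x. N (A *v x)"
  have M: "is_norm ?M" by (rule is_norm_matrix[OF N A])
  have [measurable]: "{x. N x < 1} \<in> sets borel" by (rule is_norm_ball_measurable[OF N])
  have adj: "y \<bullet> (x v* A) = (A *v y) \<bullet> x" for y
    by (metis dot_lmul_matrix inner_commute)
  have nn: "0 \<le> centroid_norm p N x" "0 \<le> centroid_norm p ?M (transpose A *v x)"
    using is_norm_nonneg is_norm_centroid_norm N M p by blast+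
  have "ennreal \<bar>det A\<bar> * ennreal (centroid_norm p ?M (transpose A *v x) powr p)
      = ennreal \<bar>det A\<bar> * (\<integral>\<^sup>+y. indicator {y. N y < 1} (A *v y) * ennreal (\<bar>(A *v y) \<bullet> x\<bar> powr p) \<partial>lborel)"
    unfolding centroid_norm_ennreal[OF M p]
    by (simp add: adj indicator_def)
  also have "\<dots> = (\<integral>\<^sup>+y. indicator {y. N y < 1} y * ennreal (\<bar>y \<bullet> x\<bar> powr p) \<partial>lborel)"
    by (rule nn_integral_matrix[OF A]) measurable
  also have "\<dots> = ennreal (centroid_norm p N x powr p)" by (rule centroid_norm_ennreal[OF N p, symmetric])
  finally have "\<bar>det A\<bar> * centroid_norm p ?M (transpose A *v x) powr p = centroid_norm p N x powr p"
    by (simp flip: ennreal_mult')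
  then have "centroid_norm p ?M (transpose A *v x) powr p = \<bar>det A\<bar> powr (-1) * centroid_norm p N x powr p"
    using A by (simp add: powr_minus field_simps)
  then have "(centroid_norm p ?M (transpose A *v x) powr p) powr (1 / p) = (\<bar>det A\<bar> powr (-1) * centroid_norm p N x powr p) powr (1 / p)"
    by simp
  then show ?thesis using nn p by (simp add: powr_powr powr_mult powr_divide powr_minus_divide)
qed

lemma det_nonzero_surj:
  fixes A :: "real^'n^'n"
  assumes "det A \<noteq> 0" obtains x where "y = A *v x"
  using assms by (metis invertible_det_nz invertible_def matrix_vector_mul_assoc matrix_vector_mul_lid)

text \<open>Transposing back inside the half-space description shows that the dual norm becomes the
  old one composed with A, up to the factor |det A|^(1/p). The determinant enters the volume once
  through A and once through this factor.\<close>

lemma centroid_vol_matrix: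
  fixes A :: "real^'n^'n"
  assumes N: "is_norm N" and A: "det A \<noteq> 0" and p: "1 \<le> p"
  shows "centroid_vol p (\<lambda>x. N (A *v x)) = \<bar>det A\<bar> powr (- (real CARD('n) + p) / p) * centroid_vol p N"
proof -
  let ?M = "\<lambda>x. N (A *v x)"
  let ?h = "centroid_norm p N" and ?k = "centroid_norm p ?M"
  define d where "d = \<bar>det A\<bar> powr (- 1 / p)"
  have d: "0 < d" using A by (simp add: d_def)
  have M: "is_norm ?M" by (rule is_norm_matrix[OF N A])
  have h: "is_norm ?h" and k: "is_norm ?k" using is_norm_centroid_norm N M p by blast+
  have At: "det (transpose A) \<noteq> 0" using A by (simp add: det_transpose)
  have iff: "dual_norm ?k z \<le> r \<longleftrightarrow> 1 / d * dual_norm ?h (A *v z) \<le> r" if r: "0 \<le> r" for r z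
  proof -
    have "dual_norm ?k z \<le> r \<longleftrightarrow> (\<forall>w. w \<bullet> z \<le> r * ?k w)" by (rule dual_norm_le_iff[OF k r])
    also have "\<dots> \<longleftrightarrow> (\<forall>x. (transpose A *v x) \<bullet> z \<le> r * ?k (transpose A *v x))"
      by (metis det_nonzero_surj[OF At])
    also have "\<dots> \<longleftrightarrow> (\<forall>x. x \<bullet> (A *v z) \<le> (r * d) * ?h x)"
      unfolding centroid_norm_matrix[OF N A p] d_def[symmetric]
      by (simp add: dot_lmul_matrix transpose_matrix_vector mult.assoc)
    also have "\<dots> \<longleftrightarrow> dual_norm ?h (A *v z) \<le> r * d"
      using r d by (intro dual_norm_le_iff[OF h, symmetric]) auto
    finally show ?thesis using d by (simp add: field_simps)
  qed
  have eq: "dual_norm ?k z = 1 / d * dual_norm ?h (A *v z)" for z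
    using iff[of "dual_norm ?k z" z] iff[of "1 / d * dual_norm ?h (A *v z)" z] d
      dual_norm_nonneg[OF k, of z] dual_norm_nonneg[OF h, of "A *v z"] by auto
  have H: "is_norm (dual_norm ?h)" by (rule is_norm_dual_norm[OF h])
  have "centroid_vol p ?M = ubvol (\<lambda>z. 1 / d * dual_norm ?h (A *v z))"
    unfolding centroid_vol_def using eq by (intro arg_cong[of _ _ ubvol]) auto
  also have "\<dots> = centroid_vol p N / \<bar>det A\<bar> * d ^ CARD('n)"
    using d by (subst ubvol_cmult[OF is_norm_matrix[OF H A]])
      (auto simp: ubvol_matrix[OF H A] centroid_vol_def power_divide)
  also have "d ^ CARD('n) / \<bar>det A\<bar> = \<bar>det A\<bar> powr (- (real CARD('n) + p) / p)"
  proof -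
    have "d ^ CARD('n) = \<bar>det A\<bar> powr (- 1 / p * real CARD('n))"
      using A by (simp add: d_def powr_powr flip: powr_realpow)
    then have "d ^ CARD('n) / \<bar>det A\<bar> = \<bar>det A\<bar> powr (- 1 / p * real CARD('n)) * \<bar>det A\<bar> powr (- 1)"
      using A by (simp add: powr_minus divide_inverse)
    also have "\<dots> = \<bar>det A\<bar> powr (- 1 / p * real CARD('n) + - 1)" by (rule powr_add[symmetric])
    also have "- 1 / p * real CARD('n) + - 1 = - (real CARD('n) + p) / p" using p by (simp add: field_simps)
    finally show ?thesis .
  qed
  then have "centroid_vol p N / \<bar>det A\<bar> * d ^ CARD('n) = \<bar>det A\<bar> powr (- (real CARD('n) + p) / p) * centroid_vol p N"
    by (metis mult.commute times_divide_eq_left times_divide_eq_right)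
  finally show ?thesis .
qed

lemma centroid_ratio_matrix:
  fixes A :: "real^'n^'n"
  assumes N: "is_norm N" and A: "det A \<noteq> 0" and p: "1 \<le> p"
  shows "centroid_ratio p (\<lambda>x. N (A *v x)) = centroid_ratio p N"
  using A ubvol_pos[OF N]
  by (simp add: centroid_ratio_def centroid_vol_matrix[OF assms] ubvol_matrix[OF N A] powr_divide)

lemma centroid_ratio_nonneg: "is_norm N \<Longrightarrow> 1 \<le> p \<Longrightarrow> 0 \<le> centroid_ratio p N"
  using centroid_vol_pos[of N p] by (simp add: centroid_ratio_def)

text \<open>Both volumes are monotone in the norm and the ratio is invariant under scaling, so
  relative closeness of two norms costs only a power of s/r. This is the semicontinuity needed to
  pass to the limit of a minimising sequence.\<close>

lemma centroid_ratio_sandwich: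
  fixes N M :: "real^'n \<Rightarrow> real"
  assumes N: "is_norm N" and M: "is_norm M" and p: "1 \<le> p" and r: "0 < r" and s: "0 < s"
    and lo: "\<And>x. r * N x \<le> M x" and up: "\<And>x. M x \<le> s * N x"
  shows "centroid_ratio p N \<le> (s / r) powr (real CARD('n) * (real CARD('n) + p) / p) * centroid_ratio p M"
proof -
  define e where "e = (real CARD('n) + p) / p"
  have e: "0 < e" using p by (simp add: e_def add_pos_pos)
  have rN: "is_norm (\<lambda>x. r * N x)" and sN: "is_norm (\<lambda>x. s * N x)"
    using is_norm_cmult N r s by blast+
  have V: "ubvol M \<le> ubvol N / r ^ CARD('n)"
    using ubvol_antimono[OF rN M lo] by (simp add: ubvol_cmult[OF N r])
  have W: "centroid_vol p (\<lambda>x. s * N x) \<le> centroid_vol p M"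
    by (rule centroid_vol_antimono[OF M sN p up])
  have ds: "det (matrix ((*\<^sub>R) s) :: real^'n^'n) = s ^ CARD('n)" by (rule det_matrix_scaleR)
  have "centroid_ratio p (\<lambda>x. s * N x) = centroid_ratio p N"
    using centroid_ratio_matrix[OF N _ p, of "matrix ((*\<^sub>R) s)"] s ds
    by (simp add: matrix_scaleR_mult is_norm_scale[OF N])
  then have "centroid_ratio p N = centroid_vol p (\<lambda>x. s * N x) * ubvol (\<lambda>x. s * N x) powr (- e)"
    by (simp add: centroid_ratio_def e_def minus_divide_left)
  also have "\<dots> \<le> centroid_vol p M * ubvol (\<lambda>x. s * N x) powr (- e)"
    using W by (rule mult_right_mono) simp
  also have "\<dots> \<le> centroid_vol p M * (ubvol M powr (- e) * (s / r) powr (real CARD('n) * e))"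
  proof (rule mult_left_mono)
    have "ubvol (\<lambda>x. s * N x) = (ubvol N / r ^ CARD('n)) * (r / s) ^ CARD('n)"
      using r s by (simp add: ubvol_cmult[OF N s] power_divide)
    then have "ubvol (\<lambda>x. s * N x) powr (- e) = (ubvol N / r ^ CARD('n)) powr (- e) * ((r / s) ^ CARD('n)) powr (- e)"
      by (simp only: powr_mult)
    also have "((r / s) ^ CARD('n)) powr (- e) = (r / s) powr (- (real CARD('n) * e))"
      using r s by (simp add: powr_powr flip: powr_realpow)
    also have "\<dots> = (s / r) powr (real CARD('n) * e)"
      using r s by (simp add: powr_minus powr_divide)
    also have "(ubvol N / r ^ CARD('n)) powr (- e) * (s / r) powr (real CARD('n) * e) \<le> ubvol M powr (- e) * (s / r) powr (real CARD('n) * e)"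
      using V ubvol_pos[OF M] e by (intro mult_right_mono powr_mono2') auto
    finally show "ubvol (\<lambda>x. s * N x) powr (- e) \<le> ubvol M powr (- e) * (s / r) powr (real CARD('n) * e)" .
    show "0 \<le> centroid_vol p M" using centroid_vol_pos[OF M p] by simp
  qed
  also have "\<dots> = (s / r) powr (real CARD('n) * e) * (centroid_vol p M * ubvol M powr (- e))"
    by (simp only: mult_ac)
  also have "real CARD('n) * e = real CARD('n) * (real CARD('n) + p) / p" by (simp add: e_def)
  also have "centroid_vol p M * ubvol M powr (- e) = centroid_ratio p M"
    by (simp add: centroid_ratio_def e_def minus_divide_left)
  finally show ?thesis .
qed

section \<open>Existence of a minimiser\<close>

text \<open>Columns of maximal determinant in the unit ball (an Auerbach basis); the lower bound is Cramer's rule.\<close>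

lemma auerbach_position:
  fixes N :: "real^'n \<Rightarrow> real"
  assumes N: "is_norm N"
  obtains A :: "real^'n^'n" where "det A \<noteq> 0"
    "\<And>x. norm x \<le> real CARD('n) * N (A *v x)" "\<And>x. N (A *v x) \<le> real CARD('n) * norm x"
proof -
  define K where "K = {A::real^'n^'n. \<forall>i. N (column i A) \<le> 1}"
  obtain c where c: "c > 0" "\<And>x. c * norm x \<le> N x" using is_norm_lower[OF N] by auto
  obtain C where C: "C > 0" "\<And>x. N x \<le> C * norm x" using is_norm_upper[OF N] by auto
  have contcol: "continuous_on UNIV (\<lambda>A::real^'n^'n. column i A)" for i
    unfolding column_def by (intro continuous_intros)
  have "closed K"
  proof -
    have "K = (\<Inter>i. {A. N (column i A) \<le> 1})" by (auto simp: K_def)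
    moreover have "closed {A::real^'n^'n. N (column i A) \<le> 1}" for i
      by (intro closed_Collect_le continuous_on_compose2[OF is_norm_continuous[OF N] contcol] continuous_intros) auto
    ultimately show ?thesis by auto
  qed
  moreover have "bounded K"
  proof (rule boundedI)
    fix A assume A: "A \<in> K"
    have "\<bar>A $ i $ j\<bar> \<le> 1 / c" for i j
    proof -
      have "\<bar>A $ i $ j\<bar> = \<bar>column j A $ i\<bar>" by (simp add: column_def)
      also have "\<dots> \<le> norm (column j A)" by (rule component_le_norm_cart)
      also have "\<dots> \<le> 1 / c"
        using c(2)[of "column j A"] A c(1) by (simp add: K_def field_simps) (meson order_trans)
      finally show ?thesis .
    qed
    then have "norm (A $ i) \<le> (\<Sum>j\<in>(UNIV::'n set). 1 / c)" for i
      using norm_le_l1_cart[of "A $ i"] by (meson order_trans sum_mono)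
    moreover have "norm A \<le> (\<Sum>i\<in>UNIV. norm (A $ i))" unfolding norm_vec_def by (rule L2_set_le_sum) auto
    ultimately show "norm A \<le> (\<Sum>i\<in>(UNIV::'n set). \<Sum>j\<in>(UNIV::'n set). 1 / c)"
      by (meson order_trans sum_mono)
  qed
  ultimately have K: "compact K" by (simp add: compact_eq_bounded_closed)
  have cdet: "continuous_on K (\<lambda>A. \<bar>det A\<bar>)"
    unfolding det_def by (intro continuous_intros)
  \<comment> \<open>A small multiple of the identity is admissible, so the maximal determinant is
    not zero.\<close>
  define t where "t = 1 / C"
  have t: "t > 0" using C by (simp add: t_def)
  have tK: "matrix ((*\<^sub>R) t) \<in> K"
  proof -
    have "N (column i (matrix ((*\<^sub>R) t) :: real^'n^'n)) \<le> 1" for i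
    proof -
      have "column i (matrix ((*\<^sub>R) t) :: real^'n^'n) = t *\<^sub>R axis i 1"
        unfolding matrix_vector_mult_basis[symmetric] by (rule matrix_scaleR_mult)
      then show ?thesis using C(2)[of "t *\<^sub>R axis i 1"] C(1) by (simp add: t_def)
    qed
    then show ?thesis by (simp add: K_def)
  qed
  then have "K \<noteq> {}" by auto
  then obtain A where A: "A \<in> K" "\<And>B. B \<in> K \<Longrightarrow> \<bar>det B\<bar> \<le> \<bar>det A\<bar>"
    using continuous_attains_sup[OF K _ cdet] by blast
  have "0 < t ^ CARD('n)" using t by simp
  also have "\<dots> = \<bar>det (matrix ((*\<^sub>R) t) :: real^'n^'n)\<bar>" using t by simp
  also have "\<dots> \<le> \<bar>det A\<bar>" by (rule A(2)[OF tK])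
  finally have d: "det A \<noteq> 0" by auto
  have up: "N (A *v x) \<le> real CARD('n) * norm x" for x
  proof -
    have "N (A *v x) = N (\<Sum>i\<in>UNIV. (x $ i) *\<^sub>R column i A)"
      by (simp add: matrix_mult_sum scalar_mult_eq_scaleR)
    also have "\<dots> \<le> (\<Sum>i\<in>UNIV. N ((x $ i) *\<^sub>R column i A))" by (rule is_norm_sum[OF N]) simp
    also have "\<dots> \<le> (\<Sum>i\<in>(UNIV::'n set). norm x)"
    proof (rule sum_mono)
      fix i
      have "N ((x $ i) *\<^sub>R column i A) = \<bar>x $ i\<bar> * N (column i A)" by (rule is_norm_scale[OF N])
      also have "\<dots> \<le> norm x * 1"
        using A(1) by (intro mult_mono component_le_norm_cart) (auto simp: K_def is_norm_nonneg[OF N])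
      finally show "N ((x $ i) *\<^sub>R column i A) \<le> norm x" by simp
    qed
    finally show ?thesis by simp
  qed
  have comp1: "\<bar>x $ k\<bar> \<le> 1" if "N (A *v x) \<le> 1" for x k
  proof -
    let ?B = "(\<chi> i j. if j = k then (A *v x) $ i else A $ i $ j) :: real^'n^'n"
    have "column j ?B = (if j = k then A *v x else column j A)" for j
      by (auto simp: column_def vec_eq_iff)
    then have "?B \<in> K" using that A(1) by (simp add: K_def)
    then have "\<bar>det ?B\<bar> \<le> \<bar>det A\<bar>" by (rule A(2))
    moreover have "det ?B = x $ k * det A" by (rule cramer_lemma)
    ultimately show ?thesis using d by (simp add: abs_mult)
  qed
  have comp: "\<bar>x $ k\<bar> \<le> N (A *v x)" for x k
  proof (cases "x = 0")
    case True then show ?thesis by (simp add: is_norm_zero[OF N])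
  next
    case False
    then have pos: "0 < N (A *v x)" using is_norm_pos[OF is_norm_matrix[OF N d]] by blast
    have "N (A *v (inverse (N (A *v x)) *\<^sub>R x)) = \<bar>inverse (N (A *v x))\<bar> * N (A *v x)"
      by (simp only: matrix_vector_mult_scaleR is_norm_scale[OF N])
    also have "\<dots> = 1" using pos by simp
    finally have "\<bar>(inverse (N (A *v x)) *\<^sub>R x) $ k\<bar> \<le> 1" by (intro comp1) simp
    then show ?thesis using pos by (simp add: abs_mult field_simps)
  qed
  have "norm x \<le> real CARD('n) * N (A *v x)" for x
  proof -
    have "norm x \<le> (\<Sum>k\<in>UNIV. \<bar>x $ k\<bar>)" by (rule norm_le_l1_cart)
    also have "\<dots> \<le> (\<Sum>k\<in>(UNIV::'n set). N (A *v x))" by (intro sum_mono comp)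
    finally show ?thesis by simp
  qed
  then show thesis using that d up by blast
qed

text \<open>Norms bounded by C times the Euclidean one are C-Lipschitz, so Arzela-Ascoli applies on
  the sphere and homogeneity extends the limit. The lower bound keeps the limit definite and lets
  the error be measured relative to the limit norm, as \<open>centroid_ratio_sandwich\<close>
  requires.\<close>

lemma norm_limit:
  fixes F :: "nat \<Rightarrow> 'a::euclidean_space \<Rightarrow> real"
  assumes F: "\<And>k. is_norm (F k)" and C: "0 < C"
    and lo: "\<And>k x. norm x \<le> C * F k x" and up: "\<And>k x. F k x \<le> C * norm x"
  obtains N k where "is_norm N" "strict_mono (k :: nat \<Rightarrow> nat)"
    "\<And>e. 0 < e \<Longrightarrow> \<exists>J. \<forall>j\<ge>J. \<forall>x. \<bar>F (k j) x - N x\<bar> \<le> e * N x"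
proof -
  have bnd: "norm (F n x) \<le> C" if "x \<in> sphere 0 1" for n x
    using that up[of n x] is_norm_nonneg[OF F, of n x] by simp
  have equi: "\<exists>d. 0 < d \<and> (\<forall>n y. y \<in> sphere 0 1 \<and> norm (x - y) < d \<longrightarrow> norm (F n x - F n y) < e)"
    if "0 < e" for x e
  proof (intro exI conjI allI impI)
    show "0 < e / C" using that C by simp
    fix n y assume y: "y \<in> sphere 0 1 \<and> norm (x - y) < e / C"
    have "norm (F n x - F n y) \<le> F n (x - y)" using is_norm_diff[OF F] by simp
    also have "\<dots> \<le> C * norm (x - y)" by (rule up)
    also have "\<dots> < e" using y C by (simp add: field_simps)
    finally show "norm (F n x - F n y) < e" .
  qed
  obtain g k where g: "continuous_on (sphere 0 1) g" and k: "strict_mono (k :: nat \<Rightarrow> nat)"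
    and conv: "\<And>e. 0 < e \<Longrightarrow> \<exists>N. \<forall>n x. n \<ge> N \<and> x \<in> sphere (0::'a) 1 \<longrightarrow> norm (F (k n) x - g x) < e"
    using Arzela_Ascoli[of "sphere (0::'a) 1" F C, OF compact_sphere bnd equi] by blast
  define N where "N x = norm x * g (x /\<^sub>R norm x)" for x
  have Fs: "F n x = norm x * F n (x /\<^sub>R norm x)" for n x
    using is_norm_scale[OF F, of n "norm x" "x /\<^sub>R norm x"] is_norm_zero[OF F] by (cases "x = 0") auto
  have near: "\<exists>J. \<forall>j\<ge>J. \<forall>x. \<bar>F (k j) x - N x\<bar> \<le> e * norm x" if e0: "0 < e" for e
  proof -
    obtain J where J: "\<And>n x. n \<ge> J \<Longrightarrow> x \<in> sphere (0::'a) 1 \<Longrightarrow> \<bar>F (k n) x - g x\<bar> < e"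
      using conv[OF e0] unfolding real_norm_def by blast
    have "\<bar>F (k j) x - N x\<bar> \<le> e * norm x" if "j \<ge> J" for j x
    proof (cases "x = 0")
      case True then show ?thesis by (simp add: N_def is_norm_zero[OF F])
    next
      case False
      have "\<bar>F (k j) x - N x\<bar> = norm x * \<bar>F (k j) (x /\<^sub>R norm x) - g (x /\<^sub>R norm x)\<bar>"
        by (subst Fs) (simp add: N_def abs_mult flip: right_diff_distrib)
      also have "\<dots> \<le> norm x * e"
        using J[OF that, of "x /\<^sub>R norm x"] False by (intro mult_left_mono) auto
      finally show ?thesis by (simp add: mult.commute)
    qed
    then show ?thesis by blast
  qed
  have lim: "(\<lambda>j. F (k j) x) \<longlonglongrightarrow> N x" for x
  proof (rule LIMSEQ_I)
    fix r :: real assume r: "0 < r"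
    obtain J where J: "\<And>j. j \<ge> J \<Longrightarrow> \<bar>F (k j) x - N x\<bar> \<le> r / (norm x + 1) * norm x"
      using near[of "r / (norm x + 1)"] r by (auto simp: add_nonneg_pos)
    have "r / (norm x + 1) * norm x < r / (norm x + 1) * (norm x + 1)"
      using r by (intro mult_strict_left_mono) (auto simp: add_nonneg_pos)
    also have "\<dots> = r" using add_nonneg_pos[OF norm_ge_zero[of x] zero_less_one] by simp
    finally have "r / (norm x + 1) * norm x < r" .
    then show "\<exists>no. \<forall>n\<ge>no. norm (F (k n) x - N x) < r"
      using J by (intro exI[of _ J]) (auto intro: le_less_trans)
  qed
  have Nlo: "norm x \<le> C * N x" for x
    by (rule LIMSEQ_le_const[OF tendsto_mult_left[OF lim]]) (use lo in auto)
  have N: "is_norm N"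
  proof (rule is_normI)
    show "N (x + y) \<le> N x + N y" for x y
      by (rule LIMSEQ_le[OF lim tendsto_add[OF lim lim]]) (use is_norm_triangle[OF F] in auto)
    show "N (t *\<^sub>R x) = \<bar>t\<bar> * N x" for t x
      by (rule LIMSEQ_unique[OF lim]) (use tendsto_mult_left[OF lim, of "\<bar>t\<bar>" x] in \<open>simp add: is_norm_scale[OF F]\<close>)
    show "0 < N x" if "x \<noteq> 0" for x
    proof -
      have "0 < C * N x" using that by (intro less_le_trans[OF _ Nlo]) simp
      then show ?thesis using C by (simp add: zero_less_mult_iff)
    qed
  qed
  have "\<exists>J. \<forall>j\<ge>J. \<forall>x. \<bar>F (k j) x - N x\<bar> \<le> e * N x" if e0: "0 < e" for e
  proof -
    obtain J where J: "\<And>j x. j \<ge> J \<Longrightarrow> \<bar>F (k j) x - N x\<bar> \<le> e / C * norm x"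
      using near[of "e / C"] e0 C by auto
    have "e / C * norm x \<le> e * N x" for x
      using mult_left_mono[OF Nlo[of x], of "e / C"] e0 C by simp
    then show ?thesis using J by (meson order_trans)
  qed
  then show thesis using that N k by blast
qed

lemma centroid_ratio_minimiser:
  assumes p: "1 \<le> p"
  obtains N :: "real^'n \<Rightarrow> real" where "is_norm N" "\<And>M :: real^'n \<Rightarrow> real. is_norm M \<Longrightarrow> centroid_ratio p N \<le> centroid_ratio p M"
proof -
  define n where "n = real CARD('n)"
  have n: "n > 0" by (simp add: n_def)
  define R where "R = centroid_ratio p ` {N :: real^'n \<Rightarrow> real. is_norm N}"
  have bdd: "bdd_below R" using centroid_ratio_nonneg p by (auto simp: R_def bdd_below_def)
  have ne: "R \<noteq> {}" using is_norm_norm by (auto simp: R_def)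
  define I where "I = Inf R"
  have "\<exists>N :: real^'n \<Rightarrow> real. is_norm N \<and> centroid_ratio p N < I + 1 / real (Suc j)" for j
  proof -
    have "Inf R < I + 1 / real (Suc j)" by (simp add: I_def)
    then show ?thesis using cInf_lessD[OF ne] unfolding R_def by blast
  qed
  then obtain G :: "nat \<Rightarrow> real^'n \<Rightarrow> real"
    where G: "\<And>j. is_norm (G j)" "\<And>j. centroid_ratio p (G j) < I + 1 / real (Suc j)" by metis
  have "\<exists>A :: real^'n^'n. det A \<noteq> 0 \<and> (\<forall>x. norm x \<le> n * G j (A *v x)) \<and> (\<forall>x. G j (A *v x) \<le> n * norm x)" for j
    using auerbach_position[OF G(1)[of j]] unfolding n_def by metis
  then obtain A :: "nat \<Rightarrow> real^'n^'n" where A: "\<And>j. det (A j) \<noteq> 0" "\<And>j x. norm x \<le> n * G j (A j *v x)"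
    "\<And>j x. G j (A j *v x) \<le> n * norm x" by metis
  define F where "F j x = G j (A j *v x)" for j x
  have F: "is_norm (F j)" for j unfolding F_def[abs_def] by (rule is_norm_matrix[OF G(1) A(1)])
  have FR: "centroid_ratio p (F j) < I + 1 / real (Suc j)" for j
    using G(2) unfolding F_def[abs_def] by (simp add: centroid_ratio_matrix[OF G(1) A(1) p])
  obtain N k where N: "is_norm N" and k: "strict_mono (k :: nat \<Rightarrow> nat)"
    and near: "\<And>e. 0 < e \<Longrightarrow> \<exists>J. \<forall>j\<ge>J. \<forall>x. \<bar>F (k j) x - N x\<bar> \<le> e * N x"
    using norm_limit[of F n, OF F n] A(2,3)[folded F_def] by blast
  define E where "E = n * (n + p) / p"
  \<comment> \<open>Two limits are taken in turn: first along the sequence with the relative error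
    \<open>e\<close> fixed, then \<open>e\<close> to 0.\<close>
  have step: "centroid_ratio p N \<le> ((1 + e) / (1 - e)) powr E * I" if e: "0 < e" "e < 1" for e
  proof -
    obtain J where J: "\<And>j x. j \<ge> J \<Longrightarrow> \<bar>F (k j) x - N x\<bar> \<le> e * N x" using near[OF e(1)] by blast
    let ?c = "((1 + e) / (1 - e)) powr E"
    have "centroid_ratio p N \<le> ?c * (I + 1 / real (Suc j))" if "j \<ge> J" for j
    proof -
      have "centroid_ratio p N \<le> ?c * centroid_ratio p (F (k j))"
        unfolding E_def n_def
      proof (rule centroid_ratio_sandwich[OF N F p])
        fix x
        show "(1 - e) * N x \<le> F (k j) x" "F (k j) x \<le> (1 + e) * N x"
          using J[OF that, of x] by (auto simp: algebra_simps)
      qed (use e in auto)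
      also have "centroid_ratio p (F (k j)) \<le> I + 1 / real (Suc (k j))" using FR by (rule less_imp_le)
      also have "1 / real (Suc (k j)) \<le> 1 / real (Suc j)"
        using seq_suble[OF k, of j] by (simp add: field_simps)
      finally show ?thesis by (simp add: mult_left_mono)
    qed
    moreover have "(\<lambda>j. ?c * (I + 1 / real (Suc j))) \<longlonglongrightarrow> ?c * (I + 0)"
      by (intro tendsto_intros LIMSEQ_Suc[OF lim_1_over_n])
    ultimately show ?thesis by (intro LIMSEQ_le_const[where X="\<lambda>j. ?c * (I + 1 / real (Suc j))"]) auto
  qed
  have "((\<lambda>e. ((1 + e) / (1 - e)) powr E * I) \<longlongrightarrow> ((1 + 0) / (1 - 0)) powr E * I) (at_right (0::real))"
    by (intro tendsto_intros) auto
  moreover have "eventually (\<lambda>e. centroid_ratio p N \<le> ((1 + e) / (1 - e)) powr E * I) (at_right 0)"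
    using eventually_at_right_less[of 0] eventually_at_right_real[of 0 1]
    by (auto elim!: eventually_mono simp: step)
  ultimately have "centroid_ratio p N \<le> I"
    by (intro tendsto_lowerbound) auto
  moreover have "I \<le> centroid_ratio p M" if "is_norm M" for M :: "real^'n \<Rightarrow> real"
    unfolding I_def using that by (intro cInf_lower[OF _ bdd]) (auto simp: R_def)
  ultimately show thesis using that[OF N] order_trans by blast
qed

section \<open>Steiner symmetrisation\<close>

definition reflect :: "'a::real_inner \<Rightarrow> 'a \<Rightarrow> 'a" where
  "reflect u x = x - (2 * (x \<bullet> u)) *\<^sub>R u"

text \<open>The unit ball of \<open>steiner u N\<close> consists of the points \<open>(P + reflect u Q) / 2\<close> with \<open>P\<close>, \<open>Q\<close> in the unit
  ball of \<open>N\<close> on a common line parallel to \<open>u\<close>.\<close>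

definition steiner :: "'a::euclidean_space \<Rightarrow> ('a \<Rightarrow> real) \<Rightarrow> 'a \<Rightarrow> real" where
  "steiner u N z = (INF c. max (N (z + c *\<^sub>R u)) (N (reflect u z + c *\<^sub>R u)))"

lemma reflect_add: "reflect u (x + y) = reflect u x + reflect u y"
  by (simp add: reflect_def inner_add_left algebra_simps)

lemma reflect_scaleR: "reflect u (t *\<^sub>R x) = t *\<^sub>R reflect u x"
  by (simp add: reflect_def algebra_simps)

lemma inner_reflect: "reflect u x \<bullet> y = x \<bullet> reflect u y"
  by (simp add: reflect_def inner_diff_left inner_diff_right inner_commute)

lemma unit_inner_self: "norm u = 1 \<Longrightarrow> u \<bullet> u = 1"
  by (simp add: dot_square_norm)

lemma reflect_line: "norm u = 1 \<Longrightarrow> reflect u (y + t *\<^sub>R u) = y - (2 * (y \<bullet> u) + t) *\<^sub>R u"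
  by (simp add: reflect_def inner_add_left unit_inner_self algebra_simps flip: scaleR_2)

context
  fixes u :: "'a::euclidean_space" and N :: "'a \<Rightarrow> real"
  assumes u: "norm u = 1" and N: "is_norm N"
begin

lemma steiner_bdd: "bdd_below (range (\<lambda>c. max (N (z + c *\<^sub>R u)) (N (reflect u z + c *\<^sub>R u))))"
  using is_norm_nonneg[OF N] by (intro bdd_belowI[of _ 0]) (auto simp: le_max_iff_disj)

lemma steiner_le: "steiner u N z \<le> max (N (z + c *\<^sub>R u)) (N (reflect u z + c *\<^sub>R u))"
  unfolding steiner_def by (rule cINF_lower[OF steiner_bdd]) simp

lemma steiner_less_iff: "steiner u N z < r \<longleftrightarrow> (\<exists>c. N (z + c *\<^sub>R u) < r \<and> N (reflect u z + c *\<^sub>R u) < r)"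
  unfolding steiner_def by (subst cINF_less_iff[OF _ steiner_bdd]) auto

lemma le_steiner: "(\<And>c. r \<le> max (N (z + c *\<^sub>R u)) (N (reflect u z + c *\<^sub>R u))) \<Longrightarrow> r \<le> steiner u N z"
  unfolding steiner_def by (rule cINF_greatest) auto

lemma is_norm_steiner: "is_norm (steiner u N)"
proof (rule is_normI)
  have nonneg: "0 \<le> steiner u N z" for z
    by (rule le_steiner) (simp add: le_max_iff_disj is_norm_nonneg[OF N])
  show "steiner u N (x + y) \<le> steiner u N x + steiner u N y" for x y
  proof (rule field_le_epsilon)
    fix e :: real assume e: "0 < e"
    have "steiner u N x < steiner u N x + e / 2" "steiner u N y < steiner u N y + e / 2" using e by auto
    then obtain c d where
      c: "N (x + c *\<^sub>R u) < steiner u N x + e / 2" "N (reflect u x + c *\<^sub>R u) < steiner u N x + e / 2" and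
      d: "N (y + d *\<^sub>R u) < steiner u N y + e / 2" "N (reflect u y + d *\<^sub>R u) < steiner u N y + e / 2"
      unfolding steiner_less_iff by blast
    have "N (x + y + (c + d) *\<^sub>R u) < steiner u N x + steiner u N y + e"
      using is_norm_triangle[OF N, of "x + c *\<^sub>R u" "y + d *\<^sub>R u"] c d by (simp add: algebra_simps)
    moreover have "N (reflect u (x + y) + (c + d) *\<^sub>R u) < steiner u N x + steiner u N y + e"
      using is_norm_triangle[OF N, of "reflect u x + c *\<^sub>R u" "reflect u y + d *\<^sub>R u"] c d
      by (simp add: reflect_add algebra_simps)
    ultimately have "steiner u N (x + y) < steiner u N x + steiner u N y + e"
      unfolding steiner_less_iff by blast
    then show "steiner u N (x + y) \<le> steiner u N x + steiner u N y + e" by simp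
  qed
  have le: "steiner u N (t *\<^sub>R x) \<le> \<bar>t\<bar> * steiner u N x" if t: "t \<noteq> 0" for t x
  proof (rule field_le_epsilon)
    fix e :: real assume e: "0 < e"
    then have "steiner u N x < steiner u N x + e / \<bar>t\<bar>" using t by simp
    then obtain c where c: "N (x + c *\<^sub>R u) < steiner u N x + e / \<bar>t\<bar>" "N (reflect u x + c *\<^sub>R u) < steiner u N x + e / \<bar>t\<bar>"
      unfolding steiner_less_iff by blast
    have "N (t *\<^sub>R x + (t * c) *\<^sub>R u) = \<bar>t\<bar> * N (x + c *\<^sub>R u)"
      "N (reflect u (t *\<^sub>R x) + (t * c) *\<^sub>R u) = \<bar>t\<bar> * N (reflect u x + c *\<^sub>R u)"
      unfolding is_norm_scale[OF N, symmetric] by (simp_all add: reflect_scaleR algebra_simps)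
    moreover have "\<bar>t\<bar> * N (x + c *\<^sub>R u) < \<bar>t\<bar> * steiner u N x + e" "\<bar>t\<bar> * N (reflect u x + c *\<^sub>R u) < \<bar>t\<bar> * steiner u N x + e"
      using c t mult_strict_left_mono[OF c(1), of "\<bar>t\<bar>"] mult_strict_left_mono[OF c(2), of "\<bar>t\<bar>"] by (auto simp: distrib_left)
    ultimately have "steiner u N (t *\<^sub>R x) < \<bar>t\<bar> * steiner u N x + e"
      unfolding steiner_less_iff by (intro exI[of _ "t * c"]) simp
    then show "steiner u N (t *\<^sub>R x) \<le> \<bar>t\<bar> * steiner u N x + e" by simp
  qed
  show "steiner u N (t *\<^sub>R x) = \<bar>t\<bar> * steiner u N x" for t x
  proof (cases "t = 0")
    case True
    have "steiner u N 0 \<le> max (N (0 + 0 *\<^sub>R u)) (N (reflect u 0 + 0 *\<^sub>R u))" by (rule steiner_le)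
    then show ?thesis using True nonneg[of 0] by (simp add: reflect_def is_norm_zero[OF N])
  next
    case False
    have "steiner u N (inverse t *\<^sub>R (t *\<^sub>R x)) \<le> \<bar>inverse t\<bar> * steiner u N (t *\<^sub>R x)" using False by (intro le) simp
    then have "\<bar>t\<bar> * steiner u N x \<le> steiner u N (t *\<^sub>R x)" using False by (simp add: field_simps)
    then show ?thesis using le[OF False, of x] by simp
  qed
  show "0 < steiner u N x" if x: "x \<noteq> 0" for x
  proof -
    obtain k where k: "k > 0" "\<And>x. k * norm x \<le> N x" using is_norm_lower[OF N] by auto
    have "k * norm x \<le> steiner u N x"
    proof (rule le_steiner)
      fix c
      \<comment> \<open>Both points have the component of x orthogonal to u, and their components
        along u are c + x.u and c - x.u. By the parallelogram identity one of the two is at least as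
        long as x, for every shift c.\<close>
      let ?P = "x + c *\<^sub>R u" and ?Q = "reflect u x + c *\<^sub>R u"
      have "(norm ?P)\<^sup>2 + (norm ?Q)\<^sup>2 = 2 * (norm x)\<^sup>2 + 2 * c\<^sup>2"
        unfolding power2_norm_eq_inner
        by (simp add: reflect_def inner_simps unit_inner_self[OF u] inner_commute power2_eq_square algebra_simps)
      then have "(norm x)\<^sup>2 \<le> (norm ?P)\<^sup>2 \<or> (norm x)\<^sup>2 \<le> (norm ?Q)\<^sup>2"
        using zero_le_power2[of c] by linarith
      then have "norm x \<le> norm ?P \<or> norm x \<le> norm ?Q" by (auto dest: power2_le_imp_le)
      then have "k * norm x \<le> k * norm ?P \<or> k * norm x \<le> k * norm ?Q" using k by auto
      then show "k * norm x \<le> max (N ?P) (N ?Q)"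
        using k(2)[of ?P] k(2)[of ?Q] by auto
    qed
    moreover have "0 < k * norm x" using k x by simp
    ultimately show ?thesis by linarith
  qed
qed

text \<open>The slice is open, bounded and convex. It is written with midpoint and half-length
  because symmetrisation changes only the midpoint.\<close>

lemma line_ball_interval:
  assumes "N (y + t0 *\<^sub>R u) < 1"
  obtains m r where "0 < r" "\<And>t. N (y + t *\<^sub>R u) < 1 \<longleftrightarrow> \<bar>t - m\<bar> < r"
proof -
  define J where "J = {t. N (y + t *\<^sub>R u) < 1}"
  have u0: "0 < N u" using u by (intro is_norm_pos[OF N]) auto
  have contN: "continuous_on UNIV (\<lambda>t. N (y + t *\<^sub>R u))"
    by (intro continuous_on_compose2[OF is_norm_continuous[OF N]] continuous_intros) auto
  have op: "open J" unfolding J_def by (intro open_Collect_less contN continuous_intros)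
  have ne: "J \<noteq> {}" using assms by (auto simp: J_def)
  have bnd: "bounded J"
  proof (rule boundedI)
    fix t assume "t \<in> J"
    then have "N (y + t *\<^sub>R u) < 1" by (simp add: J_def)
    moreover have "N (t *\<^sub>R u) \<le> N (y + t *\<^sub>R u) + N y"
      using is_norm_triangle[OF N, of "y + t *\<^sub>R u" "- y"] by (simp add: is_norm_minus[OF N])
    ultimately have "\<bar>t\<bar> * N u \<le> 1 + N y" by (simp add: is_norm_scale[OF N])
    then show "norm t \<le> (1 + N y) / N u" using u0 by (simp add: field_simps)
  qed
  have conv: "t \<in> J" if "s \<in> J" "s' \<in> J" "s < t" "t < s'" for s t s'
  proof -
    define l where "l = (t - s) / (s' - s)"
    have l: "0 < l" "l < 1" using that by (auto simp: l_def field_simps)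
    have t: "t = s + l * (s' - s)" using that by (simp add: l_def)
    have "y + t *\<^sub>R u = (1 - l) *\<^sub>R (y + s *\<^sub>R u) + l *\<^sub>R (y + s' *\<^sub>R u)"
      by (subst t) (simp add: algebra_simps)
    then have "N (y + t *\<^sub>R u) \<le> (1 - l) * N (y + s *\<^sub>R u) + l * N (y + s' *\<^sub>R u)"
      using is_norm_triangle[OF N, of "(1 - l) *\<^sub>R (y + s *\<^sub>R u)" "l *\<^sub>R (y + s' *\<^sub>R u)"] l
      by (simp add: is_norm_scale[OF N])
    also have "\<dots> < (1 - l) * 1 + l * 1"
      using l that by (intro add_strict_mono mult_strict_left_mono) (auto simp: J_def)
    finally show ?thesis by (simp add: J_def)
  qed
  define a b where "a = Inf J" and "b = Sup J"
  have ba: "bdd_above J" "bdd_below J" using bnd by (auto simp: bounded_imp_bdd_above bounded_imp_bdd_below)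
  have J: "t \<in> J \<longleftrightarrow> a < t \<and> t < b" for t
  proof
    assume t: "t \<in> J"
    obtain e where e: "e > 0" "\<And>x. dist x t < e \<Longrightarrow> x \<in> J" using op t by (auto simp: open_dist)
    have "t - e / 2 \<in> J" "t + e / 2 \<in> J" using e by (auto simp: dist_real_def)
    then have "a \<le> t - e / 2" "t + e / 2 \<le> b"
      unfolding a_def b_def using ba by (auto intro: cInf_lower cSup_upper)
    then show "a < t \<and> t < b" using e(1) by linarith
  next
    assume t: "a < t \<and> t < b"
    obtain s where "s \<in> J" "s < t" using t cInf_lessD[OF ne] unfolding a_def by blast
    moreover obtain s' where "s' \<in> J" "t < s'" using t less_cSupD[OF ne] unfolding b_def by blast
    ultimately show "t \<in> J" using conv by blast
  qed
  have "a < b" using J[of t0] assms by (auto simp: J_def)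
  show thesis
  proof (rule that[of "(b - a) / 2" "(a + b) / 2"])
    show "0 < (b - a) / 2" using \<open>a < b\<close> by simp
    show "N (y + t *\<^sub>R u) < 1 \<longleftrightarrow> \<bar>t - (a + b) / 2\<bar> < (b - a) / 2" for t
      using J[of t] by (auto simp: J_def abs_less_iff field_simps)
  qed
qed

text \<open>Reduces symmetrisation to one dimension: on each line the half-length is kept and the
  midpoint moves to the parameter -(y.u), where the line meets the hyperplane orthogonal to
  u.\<close>

lemma steiner_slice_cases:
  obtains (empty) "\<And>t. \<not> N (y + t *\<^sub>R u) < 1" "\<And>t. \<not> steiner u N (y + t *\<^sub>R u) < 1"
  | (segment) m r where "0 < r" "\<And>t. N (y + t *\<^sub>R u) < 1 \<longleftrightarrow> \<bar>t - m\<bar> < r"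
      "\<And>t. steiner u N (y + t *\<^sub>R u) < 1 \<longleftrightarrow> \<bar>t - (- (y \<bullet> u))\<bar> < r"
proof -
  have st: "steiner u N (y + t *\<^sub>R u) < 1 \<longleftrightarrow>
      (\<exists>c. N (y + (t + c) *\<^sub>R u) < 1 \<and> N (y + (c - 2 * (y \<bullet> u) - t) *\<^sub>R u) < 1)" for t
    unfolding steiner_less_iff reflect_line[OF u] by (simp add: algebra_simps)
  show thesis
  proof (cases "\<exists>t. N (y + t *\<^sub>R u) < 1")
    case False
    then show thesis using empty st by blast
  next
    case True
    then obtain m r where mr: "0 < r" "\<And>t. N (y + t *\<^sub>R u) < 1 \<longleftrightarrow> \<bar>t - m\<bar> < r"
      using line_ball_interval by metis
    have "steiner u N (y + t *\<^sub>R u) < 1 \<longleftrightarrow> \<bar>t - (- (y \<bullet> u))\<bar> < r" for t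
    proof
      assume "steiner u N (y + t *\<^sub>R u) < 1"
      then obtain c where "\<bar>t + c - m\<bar> < r" "\<bar>c - 2 * (y \<bullet> u) - t - m\<bar> < r" unfolding st mr(2) by blast
      then show "\<bar>t - (- (y \<bullet> u))\<bar> < r" by linarith
    next
      assume "\<bar>t - (- (y \<bullet> u))\<bar> < r"
      \<comment> \<open>With this shift the two points have parameters m + s and m - s for s = t +
        y.u, symmetric about the old midpoint.\<close>
      then show "steiner u N (y + t *\<^sub>R u) < 1" unfolding st mr(2) by (intro exI[of _ "m + y \<bullet> u"]) auto
    qed
    then show thesis using segment mr by blast
  qed
qed

lemma ball_indicator_measurable [measurable]:
  "(indicator {y. N y < 1} :: 'a \<Rightarrow> ennreal) \<in> borel_measurable borel"
  "(indicator {y. steiner u N y < 1} :: 'a \<Rightarrow> ennreal) \<in> borel_measurable borel"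
  using is_norm_ball_measurable[OF N, of 1] is_norm_ball_measurable[OF is_norm_steiner, of 1] by auto

end

section \<open>Integrals over the symmetrised ball\<close>

lemma nn_integral_segment:
  fixes g :: "real \<Rightarrow> ennreal"
  assumes [measurable]: "g \<in> borel_measurable borel" and c: "\<bar>c\<bar> = 1"
  shows "(\<integral>\<^sup>+t. of_bool (\<bar>t - m\<bar> < r) * g t \<partial>lborel) = (\<integral>\<^sup>+s. of_bool (\<bar>s\<bar> < r) * g (m + c * s) \<partial>lborel)"
proof -
  have "c \<noteq> 0" using c by auto
  then have "(\<integral>\<^sup>+t. of_bool (\<bar>t - m\<bar> < r) * g t \<partial>lborel)
      = ennreal \<bar>c\<bar> * (\<integral>\<^sup>+s. of_bool (\<bar>m + c * s - m\<bar> < r) * g (m + c * s) \<partial>lborel)"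
    by (intro nn_integral_real_affine) measurable
  then show ?thesis using c by (simp add: abs_mult)
qed

context
  fixes u :: "'a::euclidean_space" and N :: "'a \<Rightarrow> real"
  assumes u: "norm u = 1" and N: "is_norm N"
begin

text \<open>The point at offset s from the centre of the symmetrised chord is (P + reflect u Q)/2,
  where P and Q lie at offsets s and -s from the centre of the original chord. As s varies, P and Q
  each sweep the original chord uniformly, so the pointwise bound integrates over every
  line.\<close>

lemma steiner_integral_le:
  fixes F G K :: "'a \<Rightarrow> ennreal"
  assumes [measurable]: "F \<in> borel_measurable borel" "G \<in> borel_measurable borel" "K \<in> borel_measurable borel"
    and le: "\<And>P t. F ((P + reflect u (P + t *\<^sub>R u)) /\<^sub>R 2) \<le> G P + K (P + t *\<^sub>R u)"
  shows "(\<integral>\<^sup>+y. indicator {y. steiner u N y < 1} y * F y \<partial>lborel)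
       \<le> (\<integral>\<^sup>+y. indicator {y. N y < 1} y * G y \<partial>lborel) + (\<integral>\<^sup>+y. indicator {y. N y < 1} y * K y \<partial>lborel)"
proof -
  note [measurable] = ball_indicator_measurable[OF u N]
  have "(\<integral>\<^sup>+y. indicator {y. steiner u N y < 1} y * F y \<partial>lborel)
     = (\<integral>\<^sup>+y. slab u y * (\<integral>\<^sup>+t. indicator {y. steiner u N y < 1} (y + t *\<^sub>R u) * F (y + t *\<^sub>R u) \<partial>lborel) \<partial>lborel)"
    by (rule nn_integral_slices[OF _ u]) measurable
  also have "\<dots> \<le> (\<integral>\<^sup>+y. slab u y * (\<integral>\<^sup>+t. indicator {y. N y < 1} (y + t *\<^sub>R u) * G (y + t *\<^sub>R u) \<partial>lborel)
      + slab u y * (\<integral>\<^sup>+t. indicator {y. N y < 1} (y + t *\<^sub>R u) * K (y + t *\<^sub>R u) \<partial>lborel) \<partial>lborel)"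
    unfolding distrib_left[symmetric]
  proof (rule nn_integral_mono, rule mult_left_mono)
    fix y
    show "(\<integral>\<^sup>+t. indicator {y. steiner u N y < 1} (y + t *\<^sub>R u) * F (y + t *\<^sub>R u) \<partial>lborel)
      \<le> (\<integral>\<^sup>+t. indicator {y. N y < 1} (y + t *\<^sub>R u) * G (y + t *\<^sub>R u) \<partial>lborel)
       + (\<integral>\<^sup>+t. indicator {y. N y < 1} (y + t *\<^sub>R u) * K (y + t *\<^sub>R u) \<partial>lborel)"
    proof (cases rule: steiner_slice_cases[OF u N, of y])
      case 1
      then show ?thesis by simp
    next
      case (2 m r)
      have "(\<integral>\<^sup>+t. indicator {y. steiner u N y < 1} (y + t *\<^sub>R u) * F (y + t *\<^sub>R u) \<partial>lborel)
          = (\<integral>\<^sup>+t. of_bool (\<bar>t - (- (y \<bullet> u))\<bar> < r) * F (y + t *\<^sub>R u) \<partial>lborel)"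
        using 2(3) by (simp add: indicator_def)
      also have "\<dots> = (\<integral>\<^sup>+s. of_bool (\<bar>s\<bar> < r) * F (y + (- (y \<bullet> u) + 1 * s) *\<^sub>R u) \<partial>lborel)"
        by (rule nn_integral_segment) auto
      also have "\<dots> \<le> (\<integral>\<^sup>+s. of_bool (\<bar>s\<bar> < r) * G (y + (m + 1 * s) *\<^sub>R u) + of_bool (\<bar>s\<bar> < r) * K (y + (m + (-1) * s) *\<^sub>R u) \<partial>lborel)"
        unfolding distrib_left[symmetric]
      proof (rule nn_integral_mono, rule mult_left_mono)
        fix s
        let ?P = "y + (m + s) *\<^sub>R u"
        have Q: "?P + (-2 * s) *\<^sub>R u = y + (m + (-1) * s) *\<^sub>R u" by (simp add: algebra_simps flip: scaleR_2)
        have "(?P + reflect u (?P + (-2 * s) *\<^sub>R u)) = 2 *\<^sub>R (y + (- (y \<bullet> u) + 1 * s) *\<^sub>R u)"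
          unfolding Q reflect_line[OF u] by (simp add: algebra_simps) (simp add: algebra_simps flip: scaleR_2)
        then have "(?P + reflect u (?P + (-2 * s) *\<^sub>R u)) /\<^sub>R 2 = y + (- (y \<bullet> u) + 1 * s) *\<^sub>R u"
          by simp
        then show "F (y + (- (y \<bullet> u) + 1 * s) *\<^sub>R u) \<le> G (y + (m + 1 * s) *\<^sub>R u) + K (y + (m + (-1) * s) *\<^sub>R u)"
          using le[of ?P "-2 * s"] unfolding Q by simp
      qed simp
      also have "\<dots> = (\<integral>\<^sup>+s. of_bool (\<bar>s\<bar> < r) * G (y + (m + 1 * s) *\<^sub>R u) \<partial>lborel) + (\<integral>\<^sup>+s. of_bool (\<bar>s\<bar> < r) * K (y + (m + (-1) * s) *\<^sub>R u) \<partial>lborel)"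
        by (rule nn_integral_add) measurable
      also have "(\<integral>\<^sup>+s. of_bool (\<bar>s\<bar> < r) * G (y + (m + 1 * s) *\<^sub>R u) \<partial>lborel) = (\<integral>\<^sup>+t. of_bool (\<bar>t - m\<bar> < r) * G (y + t *\<^sub>R u) \<partial>lborel)"
        by (rule nn_integral_segment[symmetric]) auto
      also have "(\<integral>\<^sup>+s. of_bool (\<bar>s\<bar> < r) * K (y + (m + (-1) * s) *\<^sub>R u) \<partial>lborel) = (\<integral>\<^sup>+t. of_bool (\<bar>t - m\<bar> < r) * K (y + t *\<^sub>R u) \<partial>lborel)"
        by (rule nn_integral_segment[symmetric]) auto
      finally show ?thesis using 2(2) by (simp add: indicator_def)
    qed
  qed simp
  also have "\<dots> = (\<integral>\<^sup>+y. slab u y * (\<integral>\<^sup>+t. indicator {y. N y < 1} (y + t *\<^sub>R u) * G (y + t *\<^sub>R u) \<partial>lborel) \<partial>lborel)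
      + (\<integral>\<^sup>+y. slab u y * (\<integral>\<^sup>+t. indicator {y. N y < 1} (y + t *\<^sub>R u) * K (y + t *\<^sub>R u) \<partial>lborel) \<partial>lborel)"
    by (rule nn_integral_add) measurable
  also have "(\<integral>\<^sup>+y. slab u y * (\<integral>\<^sup>+t. indicator {y. N y < 1} (y + t *\<^sub>R u) * G (y + t *\<^sub>R u) \<partial>lborel) \<partial>lborel)
     = (\<integral>\<^sup>+y. indicator {y. N y < 1} y * G y \<partial>lborel)"
    by (rule nn_integral_slices[OF _ u, symmetric]) measurable
  also have "(\<integral>\<^sup>+y. slab u y * (\<integral>\<^sup>+t. indicator {y. N y < 1} (y + t *\<^sub>R u) * K (y + t *\<^sub>R u) \<partial>lborel) \<partial>lborel)
     = (\<integral>\<^sup>+y. indicator {y. N y < 1} y * K y \<partial>lborel)"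
    by (rule nn_integral_slices[OF _ u, symmetric]) measurable
  finally show ?thesis .
qed

text \<open>Chords keep their length, so an integrand that is constant along u notices no change.
  Used for the volume and for functionals orthogonal to u.\<close>

lemma steiner_integral_eq:
  fixes F :: "'a \<Rightarrow> ennreal"
  assumes [measurable]: "F \<in> borel_measurable borel" and const: "\<And>y t. F (y + t *\<^sub>R u) = F y"
  shows "(\<integral>\<^sup>+y. indicator {y. steiner u N y < 1} y * F y \<partial>lborel) = (\<integral>\<^sup>+y. indicator {y. N y < 1} y * F y \<partial>lborel)"
proof -
  note [measurable] = ball_indicator_measurable[OF u N]
  have "(\<integral>\<^sup>+y. indicator {y. steiner u N y < 1} y * F y \<partial>lborel)
     = (\<integral>\<^sup>+y. slab u y * (\<integral>\<^sup>+t. indicator {y. steiner u N y < 1} (y + t *\<^sub>R u) * F (y + t *\<^sub>R u) \<partial>lborel) \<partial>lborel)"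
    by (rule nn_integral_slices[OF _ u]) measurable
  also have "\<dots> = (\<integral>\<^sup>+y. slab u y * (\<integral>\<^sup>+t. indicator {y. N y < 1} (y + t *\<^sub>R u) * F (y + t *\<^sub>R u) \<partial>lborel) \<partial>lborel)"
  proof (rule nn_integral_cong, rule arg_cong2[of _ _ _ _ "(*)"], rule refl)
    fix y
    show "(\<integral>\<^sup>+t. indicator {y. steiner u N y < 1} (y + t *\<^sub>R u) * F (y + t *\<^sub>R u) \<partial>lborel)
      = (\<integral>\<^sup>+t. indicator {y. N y < 1} (y + t *\<^sub>R u) * F (y + t *\<^sub>R u) \<partial>lborel)"
    proof (cases rule: steiner_slice_cases[OF u N, of y])
      case 1
      then show ?thesis by simp
    next
      case (2 m r)
      have *: "(\<integral>\<^sup>+t. of_bool (\<bar>t - k\<bar> < r) * F y \<partial>lborel) = (\<integral>\<^sup>+s. of_bool (\<bar>s\<bar> < r) * F y \<partial>lborel)" for k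
        by (rule nn_integral_segment[of "\<lambda>_. F y" 1]) auto
      have "(\<integral>\<^sup>+t. of_bool (\<bar>t - (- (y \<bullet> u))\<bar> < r) * F y \<partial>lborel) = (\<integral>\<^sup>+t. of_bool (\<bar>t - m\<bar> < r) * F y \<partial>lborel)"
        using *[of m] *[of "- (y \<bullet> u)"] by simp
      then show ?thesis using 2(2,3) by (simp add: indicator_def const)
    qed
  qed
  also have "\<dots> = (\<integral>\<^sup>+y. indicator {y. N y < 1} y * F y \<partial>lborel)"
    by (rule nn_integral_slices[OF _ u, symmetric]) measurable
  finally show ?thesis .
qed

lemma ubvol_steiner: "ubvol (steiner u N) = ubvol N"
proof -
  have "ennreal (ubvol (steiner u N)) = ennreal (ubvol N)"
    using steiner_integral_eq[of "\<lambda>_. 1"] is_norm_ball_measurable[OF N, of 1] is_norm_ball_measurable[OF is_norm_steiner[OF u N], of 1]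
    by (simp add: ubvol_emeasure[OF N] ubvol_emeasure[OF is_norm_steiner[OF u N]])
  then show ?thesis
    using ubvol_pos[OF N] ubvol_pos[OF is_norm_steiner[OF u N]] by simp
qed

section \<open>Centroid norms of the symmetrised ball\<close>

context
  fixes p :: real
  assumes p: "1 \<le> p"
begin

lemma centroid_norm_steiner_perp:
  assumes "x \<bullet> u = 0"
  shows "centroid_norm p (steiner u N) x = centroid_norm p N x"
proof -
  have "ennreal (centroid_norm p (steiner u N) x powr p) = ennreal (centroid_norm p N x powr p)"
    unfolding centroid_norm_ennreal[OF N p] centroid_norm_ennreal[OF is_norm_steiner[OF u N] p]
    by (rule steiner_integral_eq) (use assms in \<open>auto simp: inner_add_left inner_commute[of u x]\<close>)
  then have "(centroid_norm p (steiner u N) x powr p) powr (1 / p) = (centroid_norm p N x powr p) powr (1 / p)" by simp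
  then show ?thesis
    using p is_norm_nonneg[OF is_norm_centroid_norm[OF N p], of x]
      is_norm_nonneg[OF is_norm_centroid_norm[OF is_norm_steiner[OF u N] p], of x] by (simp add: powr_powr)
qed

text \<open>The content of the inclusion of the symmetrised ball's centroid body in the Steiner
  symmetral of H, in terms of support functions. Functionals normalised to have inner product 1 with
  u bound H from both ends of each line parallel to u.\<close>

lemma centroid_norm_steiner_le:
  assumes x: "x \<bullet> u = 1" and w: "w \<bullet> u = 1"
  shows "centroid_norm p (steiner u N) (x - reflect u w) \<le> centroid_norm p N x + centroid_norm p N w"
proof -
  let ?h = "centroid_norm p N" and ?k = "centroid_norm p (steiner u N)"
  have h: "is_norm ?h" by (rule is_norm_centroid_norm[OF N p])
  have k: "is_norm ?k" by (rule is_norm_centroid_norm[OF is_norm_steiner[OF u N] p])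
  define a b where "a = ?h x" and "b = ?h w"
  have "x \<noteq> 0" "w \<noteq> 0" using x w by auto
  then have a: "0 < a" and b: "0 < b" by (auto simp: a_def b_def is_norm_pos[OF h])
  define c where "c = (a + b) powr (p - 1)"
  have uu: "u \<bullet> u = 1" by (rule unit_inner_self[OF u])
  have ux: "u \<bullet> x = 1" and uw: "u \<bullet> w = 1" using x w by (auto simp: inner_commute)
  have "ennreal (?k (x - reflect u w) powr p) \<le>
     (\<integral>\<^sup>+y. indicator {y. N y < 1} y * ennreal (c * a powr (1 - p) * \<bar>y \<bullet> x\<bar> powr p) \<partial>lborel)
   + (\<integral>\<^sup>+y. indicator {y. N y < 1} y * ennreal (c * b powr (1 - p) * \<bar>y \<bullet> w\<bar> powr p) \<partial>lborel)"
    unfolding centroid_norm_ennreal[OF is_norm_steiner[OF u N] p]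
  proof (rule steiner_integral_le)
    fix P t
    let ?Q = "P + t *\<^sub>R u"
    \<comment> \<open>Uses that P and Q differ by a multiple of u and that x and w have the same
      inner product with u: the functional then splits into one term in P and one in Q.\<close>
    have "((P + reflect u ?Q) /\<^sub>R 2) \<bullet> (x - reflect u w) = P \<bullet> x + (- (?Q \<bullet> w))"
      by (simp add: reflect_def inner_simps x w ux uw uu algebra_simps)
    then have "\<bar>((P + reflect u ?Q) /\<^sub>R 2) \<bullet> (x - reflect u w)\<bar> powr p
       \<le> c * a powr (1 - p) * \<bar>P \<bullet> x\<bar> powr p + c * b powr (1 - p) * \<bar>?Q \<bullet> w\<bar> powr p" (is "?l \<le> ?A + ?B")
      using convex_powr_abs_scaled[OF p a b, of "P \<bullet> x" "- (?Q \<bullet> w)"]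
      by (simp only: abs_minus_cancel c_def distrib_left mult.assoc)
    then have "ennreal ?l \<le> ennreal (?A + ?B)" by (rule ennreal_leI)
    also have "\<dots> = ennreal ?A + ennreal ?B" by (rule ennreal_plus) (auto simp: c_def)
    finally show "ennreal ?l \<le> ennreal ?A + ennreal ?B" .
  qed measurable
  also have "\<dots> = ennreal (c * a powr (1 - p)) * ennreal (a powr p) + ennreal (c * b powr (1 - p)) * ennreal (b powr p)"
  proof -
    have *: "(\<integral>\<^sup>+y. indicator {y. N y < 1} y * ennreal (d * \<bar>y \<bullet> v\<bar> powr p) \<partial>lborel) = ennreal d * ennreal (?h v powr p)"
      if "0 \<le> d" for d v
      unfolding centroid_norm_ennreal[OF N p] using that ball_indicator_measurable[OF u N]
      by (subst nn_integral_cmult[symmetric]) (auto simp: ennreal_mult' mult_ac)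
    show ?thesis using *[of "c * a powr (1 - p)" x] *[of "c * b powr (1 - p)" w] by (simp add: c_def a_def b_def)
  qed
  also have "\<dots> = ennreal ((a + b) powr p)"
  proof -
    have "c * a powr (1 - p) * a powr p = c * a" "c * b powr (1 - p) * b powr p = c * b"
      using a b by (simp_all add: mult.assoc flip: powr_add)
    moreover have "c * (a + b) = (a + b) powr p"
      using a b by (simp add: c_def powr_diff)
    then have "c * a + c * b = (a + b) powr p" by (simp only: distrib_left)
    ultimately have "c * a powr (1 - p) * a powr p + c * b powr (1 - p) * b powr p = (a + b) powr p"
      by (simp only:)
    moreover have "0 \<le> c" by (simp add: c_def)
    ultimately show ?thesis by (simp flip: ennreal_mult' ennreal_plus)
  qed
  finally have le: "?k (x - reflect u w) powr p \<le> (a + b) powr p" by simp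
  show ?thesis
  proof (rule ccontr)
    assume "\<not> ?k (x - reflect u w) \<le> ?h x + ?h w"
    then have "(a + b) powr p < ?k (x - reflect u w) powr p"
      using a b p by (intro powr_less_mono2) (auto simp: a_def b_def)
    with le show False by simp
  qed
qed

text \<open>A shift \<open>c\<close> realising \<open>steiner u (dual_norm h) z \<le> r\<close> is bounded below by the functionals with \<open>x \<bullet> u < 0\<close>
  and above by those with \<open>x \<bullet> u > 0\<close>; the previous lemma says that these bounds are compatible.\<close>

lemma steiner_dual_centroid_le:
  "steiner u (dual_norm (centroid_norm p N)) z \<le> dual_norm (centroid_norm p (steiner u N)) z"
proof -
  let ?h = "centroid_norm p N" and ?k = "centroid_norm p (steiner u N)"
  have h: "is_norm ?h" by (rule is_norm_centroid_norm[OF N p])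
  have k: "is_norm ?k" by (rule is_norm_centroid_norm[OF is_norm_steiner[OF u N] p])
  have D: "is_norm (dual_norm ?h)" by (rule is_norm_dual_norm[OF h])
  define r where "r = dual_norm ?k z"
  have r: "0 \<le> r" unfolding r_def by (rule dual_norm_nonneg[OF k])
  have kz: "x \<bullet> z \<le> r * ?k x" for x
    using inner_le_dual_norm[OF k, of x z] by (simp add: r_def mult.commute)
  have perp: "x \<bullet> z \<le> r * ?h x" "x \<bullet> reflect u z \<le> r * ?h x" if "x \<bullet> u = 0" for x
  proof -
    show 1: "x \<bullet> z \<le> r * ?h x" using kz[of x] by (simp add: centroid_norm_steiner_perp[OF that])
    have "x \<bullet> reflect u z = x \<bullet> z" using that by (simp add: reflect_def inner_diff_right)
    then show "x \<bullet> reflect u z \<le> r * ?h x" using 1 by simp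
  qed
  \<comment> \<open>If v and v' agree, only x - w matters; it is orthogonal to u, where
    symmetrisation leaves the centroid norm unchanged. The mixed cases are
    \<open>centroid_norm_steiner_le\<close> in its two orders.\<close>
  have cross: "x \<bullet> v - w \<bullet> v' \<le> r * (?h x + ?h w)"
    if x: "x \<bullet> u = 1" and w: "w \<bullet> u = 1" and v: "v = z \<or> v = reflect u z" and v': "v' = z \<or> v' = reflect u z" for x w v v'
  proof -
    have xw: "(x - w) \<bullet> u = 0" using x w by (simp add: inner_diff_left)
    have "r * ?h (x - w) \<le> r * (?h x + ?h w)"
      using is_norm_triangle[OF h, of x "- w"] r by (intro mult_left_mono) (auto simp: is_norm_minus[OF h])
    then have same: "(x - w) \<bullet> z \<le> r * (?h x + ?h w)" "(x - w) \<bullet> reflect u z \<le> r * (?h x + ?h w)"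
      using perp[OF xw] by linarith+
    have k1: "(x - reflect u w) \<bullet> z \<le> r * (?h x + ?h w)"
      using kz[of "x - reflect u w"] mult_left_mono[OF centroid_norm_steiner_le[OF x w] r] by linarith
    have "r * ?k (reflect u x - w) \<le> r * (?h w + ?h x)"
      using mult_left_mono[OF centroid_norm_steiner_le[OF w x] r] by (simp add: is_norm_minus_commute[OF k])
    then have k2: "(reflect u x - w) \<bullet> z \<le> r * (?h x + ?h w)"
      using kz[of "reflect u x - w"] by (simp add: add.commute)
    show ?thesis using v v' same k1 k2 by (auto simp: inner_diff_left inner_reflect)
  qed
  \<comment> \<open>The lower bounds for the shift: a functional with negative inner product with u
    is rescaled to -w with w.u = 1.\<close>
  define L where "L = {- r * ?h w - w \<bullet> v |w v. w \<bullet> u = 1 \<and> (v = z \<or> v = reflect u z)}"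
  have uu: "u \<bullet> u = 1" by (rule unit_inner_self[OF u])
  have Lle: "l \<le> r * ?h x - x \<bullet> v" if l: "l \<in> L" and x: "x \<bullet> u = 1" and v: "v = z \<or> v = reflect u z" for l x v
  proof -
    obtain w v' where w: "l = - r * ?h w - w \<bullet> v'" "w \<bullet> u = 1" "v' = z \<or> v' = reflect u z"
      using l unfolding L_def by blast
    show ?thesis using cross[OF x w(2) v w(3)] w(1) by (simp add: algebra_simps)
  qed
  have Lne: "L \<noteq> {}" using uu unfolding L_def by blast
  have Lbdd: "bdd_above L"
    by (rule bdd_aboveI[where M="r * ?h u - u \<bullet> z"], rule Lle[OF _ uu]) auto
  define c where "c = Sup L"
  have cup: "c \<le> r * ?h x - x \<bullet> v" if "x \<bullet> u = 1" "v = z \<or> v = reflect u z" for x v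
    unfolding c_def using Lle[OF _ that] Lne by (intro cSup_least)
  have clo: "- r * ?h x - x \<bullet> v \<le> c" if "x \<bullet> u = 1" "v = z \<or> v = reflect u z" for x v
    unfolding c_def by (rule cSup_upper[OF _ Lbdd]) (use that in \<open>auto simp: L_def\<close>)
  have main: "dual_norm ?h (v + c *\<^sub>R u) \<le> r" if v: "v = z \<or> v = reflect u z" for v
  proof (subst dual_norm_le_iff[OF h r], rule allI)
    fix x
    show "x \<bullet> (v + c *\<^sub>R u) \<le> r * ?h x"
    proof (cases "x \<bullet> u = 0")
      case True
      then show ?thesis using perp[OF True] v by (auto simp: inner_add_right)
    next
      case False
      define s where "s = x \<bullet> u"
      define y where "y = inverse s *\<^sub>R x"
      have s: "s \<noteq> 0" and xy: "x = s *\<^sub>R y" using False by (auto simp: s_def y_def)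
      have y1: "y \<bullet> u = 1" using False by (simp add: y_def s_def)
      have eq: "x \<bullet> (v + c *\<^sub>R u) = s * (y \<bullet> v + c)" by (simp add: xy inner_add_right y1 algebra_simps)
      have "s * (y \<bullet> v + c) \<le> \<bar>s\<bar> * (r * ?h y)"
      proof (cases "0 < s")
        case True
        then show ?thesis using cup[OF y1 v] by (simp add: mult_left_mono)
      next
        case False
        have "s * (y \<bullet> v + c) = - s * (- (y \<bullet> v + c))" by (simp only: minus_mult_minus)
        also have "\<dots> \<le> - s * (r * ?h y)"
          using clo[OF y1 v] False by (intro mult_left_mono) auto
        also have "- s = \<bar>s\<bar>" using False by simp
        finally show ?thesis .
      qed
      also have "\<dots> = r * ?h x" by (simp add: xy is_norm_scale[OF h])
      finally show ?thesis unfolding eq .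
    qed
  qed
  have "steiner u (dual_norm ?h) z \<le> max (dual_norm ?h (z + c *\<^sub>R u)) (dual_norm ?h (reflect u z + c *\<^sub>R u))"
    by (rule steiner_le[OF u D])
  also have "\<dots> \<le> r" using main by simp
  finally show ?thesis unfolding r_def .
qed

end

end

section \<open>The equality case of symmetrisation\<close>

text \<open>Equal volumes turn \<open>steiner_dual_centroid_le\<close> into an equality of norms,
  evaluated here at u. The functional \<open>a\<close> supports H at its boundary point in direction
  u; the hyperplane orthogonal to \<open>a\<close> turns out to contain the midpoints of the chords
  parallel to u.\<close>

lemma steiner_equality_functional:
  fixes N :: "'a::euclidean_space \<Rightarrow> real"
  assumes u: "norm u = 1" and N: "is_norm N" and p: "1 \<le> p"
    and ge: "centroid_vol p N \<le> centroid_vol p (steiner u N)"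
  obtains a where "a \<bullet> u = 1" "centroid_norm p N a \<le> centroid_norm p (steiner u N) u"
proof -
  let ?h = "centroid_norm p N" and ?k = "centroid_norm p (steiner u N)"
  let ?D = "dual_norm ?h"
  have uu: "u \<bullet> u = 1" by (rule unit_inner_self[OF u])
  have h: "is_norm ?h" by (rule is_norm_centroid_norm[OF N p])
  have k: "is_norm ?k" by (rule is_norm_centroid_norm[OF is_norm_steiner[OF u N] p])
  have D: "is_norm ?D" by (rule is_norm_dual_norm[OF h])
  have "steiner u ?D u = dual_norm ?k u"
  proof (rule is_norm_eq_of_measure_le[OF is_norm_dual_norm[OF k] is_norm_steiner[OF u D]])
    show "steiner u ?D x \<le> dual_norm ?k x" for x by (rule steiner_dual_centroid_le[OF u N p])
    show "measure lborel {x. steiner u ?D x < 1} \<le> measure lborel {x. dual_norm ?k x < 1}"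
      using ge ubvol_steiner[OF u D] by (simp add: centroid_vol_def ubvol_def)
  qed
  \<comment> \<open>The shift 0 suffices, because \<open>reflect u u\<close> is -u and the norm is
    even.\<close>
  moreover have "steiner u ?D u \<le> ?D u"
    using steiner_le[OF u D, of u 0] by (simp add: reflect_def uu scaleR_2 is_norm_minus[OF D])
  ultimately have dual: "dual_norm ?k u \<le> ?D u" by simp
  obtain x where x: "?h x \<le> 1" "x \<bullet> u = ?D u" using dual_norm_attained[OF h] by blast
  have "u \<noteq> 0" using u by auto
  then have Du: "0 < ?D u" by (rule is_norm_pos[OF D])
  have "1 \<le> ?k u * dual_norm ?k u" using inner_le_dual_norm[OF k, of u u] uu by simp
  also have "\<dots> \<le> ?k u * ?D u" by (intro mult_left_mono dual is_norm_nonneg[OF k])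
  finally have ku: "inverse (?D u) \<le> ?k u" using Du by (simp add: field_simps)
  show thesis
  proof (rule that[of "inverse (?D u) *\<^sub>R x"])
    show "(inverse (?D u) *\<^sub>R x) \<bullet> u = 1" using x Du by simp
    have "?h (inverse (?D u) *\<^sub>R x) = inverse (?D u) * ?h x" using Du by (simp add: is_norm_scale[OF h])
    also have "\<dots> \<le> inverse (?D u) * 1" using Du x by (intro mult_left_mono) auto
    finally show "?h (inverse (?D u) *\<^sub>R x) \<le> ?k u" using ku by simp
  qed
qed

text \<open>The maximum of |s| and |d| is the mean of |d + s| and |d - s|. Keeping it as an
  intermediate term gives strictness for |s| < |d| without strict convexity, so p = 1 is
  covered.\<close>

lemma max_powr_le_mean:
  fixes s d p :: real
  assumes p: "1 \<le> p"
  shows "2 * max \<bar>s\<bar> \<bar>d\<bar> powr p \<le> \<bar>d + s\<bar> powr p + \<bar>d - s\<bar> powr p"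
proof -
  have "max \<bar>s\<bar> \<bar>d\<bar> = (1 - 1 / 2) *\<^sub>R \<bar>d + s\<bar> + (1 / 2) *\<^sub>R \<bar>d - s\<bar>" by (auto simp: max_def abs_if field_simps)
  then have "max \<bar>s\<bar> \<bar>d\<bar> powr p \<le> (1 - 1 / 2) * \<bar>d + s\<bar> powr p + (1 / 2) * \<bar>d - s\<bar> powr p"
    using convex_onD[OF convex_on_powr_nonneg[OF p], of "1 / 2" "\<bar>d + s\<bar>" "\<bar>d - s\<bar>"] by simp
  then show ?thesis by simp
qed

lemma segment_powr_mean:
  fixes d r p :: real
  assumes p: "1 \<le> p"
  shows "(\<integral>\<^sup>+s. of_bool (\<bar>s\<bar> < r) * ennreal (max \<bar>s\<bar> \<bar>d\<bar> powr p) \<partial>lborel)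
     \<le> (\<integral>\<^sup>+s. of_bool (\<bar>s\<bar> < r) * ennreal (\<bar>d + s\<bar> powr p) \<partial>lborel)"
proof -
  let ?I = "\<lambda>g. (\<integral>\<^sup>+s. of_bool (\<bar>s\<bar> < r) * ennreal (g s) \<partial>lborel)"
  have "2 * ?I (\<lambda>s. max \<bar>s\<bar> \<bar>d\<bar> powr p) = (\<integral>\<^sup>+s. 2 * (of_bool (\<bar>s\<bar> < r) * ennreal (max \<bar>s\<bar> \<bar>d\<bar> powr p)) \<partial>lborel)"
    by (rule nn_integral_cmult[symmetric]) measurable
  also have "\<dots> \<le> (\<integral>\<^sup>+s. of_bool (\<bar>s\<bar> < r) * ennreal (\<bar>d + s\<bar> powr p) + of_bool (\<bar>s\<bar> < r) * ennreal (\<bar>d - s\<bar> powr p) \<partial>lborel)"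
  proof (rule nn_integral_mono)
    fix s
    have "ennreal (2 * max \<bar>s\<bar> \<bar>d\<bar> powr p) \<le> ennreal (\<bar>d + s\<bar> powr p + \<bar>d - s\<bar> powr p)"
      by (intro ennreal_leI max_powr_le_mean p)
    then show "2 * (of_bool (\<bar>s\<bar> < r) * ennreal (max \<bar>s\<bar> \<bar>d\<bar> powr p))
       \<le> of_bool (\<bar>s\<bar> < r) * ennreal (\<bar>d + s\<bar> powr p) + of_bool (\<bar>s\<bar> < r) * ennreal (\<bar>d - s\<bar> powr p)"
      by (cases "\<bar>s\<bar> < r") (auto simp: ennreal_mult')
  qed
  also have "\<dots> = ?I (\<lambda>s. \<bar>d + s\<bar> powr p) + ?I (\<lambda>s. \<bar>d - s\<bar> powr p)"
    by (rule nn_integral_add) measurable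
  also have "?I (\<lambda>s. \<bar>d - s\<bar> powr p) = ?I (\<lambda>s. \<bar>d + s\<bar> powr p)"
    using nn_integral_segment[of "\<lambda>s. ennreal (\<bar>d - s\<bar> powr p)" "-1" 0 r] by simp
  also have "?I (\<lambda>s. \<bar>d + s\<bar> powr p) + ?I (\<lambda>s. \<bar>d + s\<bar> powr p) = 2 * ?I (\<lambda>s. \<bar>d + s\<bar> powr p)"
    by (simp add: mult_2)
  finally show ?thesis
    by (subst (asm) ennreal_mult_le_mult_iff) auto
qed

lemma segment_powr_finite:
  fixes r p :: real
  assumes p: "1 \<le> p"
  shows "(\<integral>\<^sup>+s. of_bool (\<bar>s\<bar> < r) * ennreal (\<bar>s\<bar> powr p) \<partial>lborel) < \<infinity>"
proof -
  have "(\<integral>\<^sup>+s. of_bool (\<bar>s\<bar> < r) * ennreal (\<bar>s\<bar> powr p) \<partial>lborel) \<le> (\<integral>\<^sup>+s. ennreal (r powr p) * indicator {-r<..<r} s \<partial>lborel)"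
    using p by (intro nn_integral_mono) (auto simp: indicator_def intro!: ennreal_leI powr_mono2)
  also have "\<dots> < \<infinity>"
    by (cases "0 \<le> r") (auto simp: nn_integral_cmult_indicator ennreal_mult_less_top)
  finally show ?thesis .
qed

lemma segment_powr_shift:
  fixes d r p :: real
  assumes p: "1 \<le> p"
  shows "(\<integral>\<^sup>+s. of_bool (\<bar>s\<bar> < r) * ennreal (\<bar>s\<bar> powr p) \<partial>lborel)
     \<le> (\<integral>\<^sup>+s. of_bool (\<bar>s\<bar> < r) * ennreal (\<bar>d + s\<bar> powr p) \<partial>lborel)"
proof -
  have "(\<integral>\<^sup>+s. of_bool (\<bar>s\<bar> < r) * ennreal (\<bar>s\<bar> powr p) \<partial>lborel)
     \<le> (\<integral>\<^sup>+s. of_bool (\<bar>s\<bar> < r) * ennreal (max \<bar>s\<bar> \<bar>d\<bar> powr p) \<partial>lborel)"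
    using p by (intro nn_integral_mono mult_left_mono ennreal_leI powr_mono2) auto
  also note segment_powr_mean[OF p]
  finally show ?thesis .
qed

text \<open>For d nonzero the intermediate integrand, with the maximum of |s| and |d|, exceeds |s|^p
  on an interval of positive length; since the integral of |s|^p is finite, the inequality of
  integrals would be strict.\<close>

lemma segment_powr_shift_equality:
  fixes d r p :: real
  assumes p: "1 \<le> p" and r: "0 < r"
    and le: "(\<integral>\<^sup>+s. of_bool (\<bar>s\<bar> < r) * ennreal (\<bar>d + s\<bar> powr p) \<partial>lborel)
      \<le> (\<integral>\<^sup>+s. of_bool (\<bar>s\<bar> < r) * ennreal (\<bar>s\<bar> powr p) \<partial>lborel)"
  shows "d = 0"
proof (rule ccontr)
  assume d: "d \<noteq> 0"
  let ?f = "\<lambda>s. of_bool (\<bar>s\<bar> < r) * ennreal (\<bar>s\<bar> powr p)"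
  let ?g = "\<lambda>s. of_bool (\<bar>s\<bar> < r) * ennreal (max \<bar>s\<bar> \<bar>d\<bar> powr p)"
  have fg: "?f s \<le> ?g s" for s using p by (intro mult_left_mono ennreal_leI powr_mono2) auto
  have "(\<integral>\<^sup>+s. ?g s - ?f s \<partial>lborel) = (\<integral>\<^sup>+s. ?g s \<partial>lborel) - (\<integral>\<^sup>+s. ?f s \<partial>lborel)"
    using segment_powr_finite[OF p, of r] fg by (intro nn_integral_diff) auto
  also have "\<dots> = 0"
  proof -
    have I: "(\<integral>\<^sup>+s. ?g s \<partial>lborel) \<le> (\<integral>\<^sup>+s. ?f s \<partial>lborel)"
      using segment_powr_mean[OF p, of r d] le by (rule order_trans)
    then show ?thesis
      using le_less_trans[OF I segment_powr_finite[OF p, of r]] by (auto simp: diff_eq_0_iff_ennreal)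
  qed
  finally have "AE s in lborel. ?g s - ?f s = 0" by (subst (asm) nn_integral_0_iff_AE) auto
  then have "AE s in lborel. s \<notin> {0<..<min r \<bar>d\<bar>}"
  proof eventually_elim
    case (elim s)
    show ?case
    proof
      assume s: "s \<in> {0<..<min r \<bar>d\<bar>}"
      then have "ennreal (\<bar>d\<bar> powr p) - ennreal (s powr p) = 0" using elim by (auto simp: max_def split: if_splits)
      then have "\<bar>d\<bar> powr p \<le> s powr p" by (simp add: ennreal_minus ennreal_eq_0_iff)
      moreover have "s powr p < \<bar>d\<bar> powr p" using s p by (intro powr_less_mono2) auto
      ultimately show False by simp
    qed
  qed
  then have "emeasure lborel {0<..<min r \<bar>d\<bar>} = 0"
    by (subst (asm) AE_iff_measurable[of "{0<..<min r \<bar>d\<bar>}"]) auto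
  then show False using r d by simp
qed

text \<open>On each line both functionals integrate over a segment of the same length:
  \<open>f\<close> over one centred at 0, \<open>g\<close> over one whose centre is possibly
  shifted, so f is at most g. The hypothesis reverses this after integration over the lines, hence
  almost every line has equality and shift 0. The map \<open>A\<close> is the skew reflection along
  u that fixes the hyperplane orthogonal to \<open>a\<close>.\<close>

lemma steiner_equality_reflection:
  fixes N :: "'a::euclidean_space \<Rightarrow> real"
  assumes u: "norm u = 1" and N: "is_norm N" and p: "1 \<le> p"
    and a: "a \<bullet> u = 1" and le: "centroid_norm p N a \<le> centroid_norm p (steiner u N) u"
  shows "N (z - (2 * (z \<bullet> a)) *\<^sub>R u) = N z"
proof -
  note [measurable] = ball_indicator_measurable[OF u N]
  have [measurable]: "N \<in> borel_measurable borel" by (rule is_norm_measurable[OF N])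
  have uu: "u \<bullet> u = 1" by (rule unit_inner_self[OF u])
  have ua: "u \<bullet> a = 1" using a by (simp add: inner_commute)
  define A where "A z = z - (2 * (z \<bullet> a)) *\<^sub>R u" for z
  have [measurable]: "A \<in> borel \<rightarrow>\<^sub>M borel" unfolding A_def[abs_def] by measurable
  have Aadd: "A (x + y) = A x + A y" for x y by (simp add: A_def inner_add_left algebra_simps)
  have Asc: "A (t *\<^sub>R x) = t *\<^sub>R A x" for t x by (simp add: A_def algebra_simps)
  have AA: "A (A x) = x" for x
    by (simp add: A_def inner_diff_left ua algebra_simps flip: scaleR_2)
  have NA: "is_norm (\<lambda>x. N (A x))"
  proof (rule is_normI)
    show "0 < N (A x)" if "x \<noteq> 0" for x
    proof -
      have "A x \<noteq> 0" using that AA[of x] Asc[of 0 0] by auto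
      then show ?thesis by (rule is_norm_pos[OF N])
    qed
  qed (simp_all add: Aadd Asc is_norm_triangle[OF N] is_norm_scale[OF N])
  define f where "f y = (\<integral>\<^sup>+t. indicator {y. steiner u N y < 1} (y + t *\<^sub>R u) * ennreal (\<bar>(y + t *\<^sub>R u) \<bullet> u\<bar> powr p) \<partial>lborel)" for y
  define g where "g y = (\<integral>\<^sup>+t. indicator {y. N y < 1} (y + t *\<^sub>R u) * ennreal (\<bar>(y + t *\<^sub>R u) \<bullet> a\<bar> powr p) \<partial>lborel)" for y
  have [measurable]: "f \<in> borel_measurable borel" "g \<in> borel_measurable borel"
    unfolding f_def[abs_def] g_def[abs_def] by measurable
  have fI: "(\<integral>\<^sup>+y. slab u y * f y \<partial>lborel) = ennreal (centroid_norm p (steiner u N) u powr p)"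
    unfolding centroid_norm_ennreal[OF is_norm_steiner[OF u N] p] f_def
    by (rule nn_integral_slices[OF _ u, symmetric]) measurable
  have gI: "(\<integral>\<^sup>+y. slab u y * g y \<partial>lborel) = ennreal (centroid_norm p N a powr p)"
    unfolding centroid_norm_ennreal[OF N p] g_def
    by (rule nn_integral_slices[OF _ u, symmetric]) measurable
  have fseg: "f y = (\<integral>\<^sup>+s. of_bool (\<bar>s\<bar> < r) * ennreal (\<bar>s\<bar> powr p) \<partial>lborel)"
    if "\<And>t. steiner u N (y + t *\<^sub>R u) < 1 \<longleftrightarrow> \<bar>t - (- (y \<bullet> u))\<bar> < r" for y r
  proof -
    have "f y = (\<integral>\<^sup>+t. of_bool (\<bar>t - (- (y \<bullet> u))\<bar> < r) * ennreal (\<bar>y \<bullet> u + t\<bar> powr p) \<partial>lborel)"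
      unfolding f_def using that by (simp add: indicator_def inner_add_left uu)
    also have "\<dots> = (\<integral>\<^sup>+s. of_bool (\<bar>s\<bar> < r) * ennreal (\<bar>y \<bullet> u + (- (y \<bullet> u) + 1 * s)\<bar> powr p) \<partial>lborel)"
      by (rule nn_integral_segment) auto
    finally show ?thesis by simp
  qed
  have gseg: "g y = (\<integral>\<^sup>+s. of_bool (\<bar>s\<bar> < r) * ennreal (\<bar>(y \<bullet> a + m) + s\<bar> powr p) \<partial>lborel)"
    if "\<And>t. N (y + t *\<^sub>R u) < 1 \<longleftrightarrow> \<bar>t - m\<bar> < r" for y m r
  proof -
    have "g y = (\<integral>\<^sup>+t. of_bool (\<bar>t - m\<bar> < r) * ennreal (\<bar>y \<bullet> a + t\<bar> powr p) \<partial>lborel)"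
      unfolding g_def using that by (simp add: indicator_def inner_add_left ua)
    also have "\<dots> = (\<integral>\<^sup>+s. of_bool (\<bar>s\<bar> < r) * ennreal (\<bar>y \<bullet> a + (m + 1 * s)\<bar> powr p) \<partial>lborel)"
      by (rule nn_integral_segment) auto
    finally show ?thesis by (simp add: add.assoc)
  qed
  have fg: "f y \<le> g y" and ffin: "f y < \<infinity>"
    and eq: "g y \<le> f y \<Longrightarrow> N (y + t *\<^sub>R u) < 1 \<longleftrightarrow> N (A (y + t *\<^sub>R u)) < 1" for y t
  proof -
    have "f y \<le> g y \<and> f y < \<infinity> \<and> (g y \<le> f y \<longrightarrow> (N (y + t *\<^sub>R u) < 1 \<longleftrightarrow> N (A (y + t *\<^sub>R u)) < 1))"
    proof (cases rule: steiner_slice_cases[OF u N, of y])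
      case 1
      have "A (y + t *\<^sub>R u) = y + (- t - 2 * (y \<bullet> a)) *\<^sub>R u"
        by (simp add: A_def inner_add_left ua algebra_simps flip: scaleR_2)
      then show ?thesis using 1 by (simp add: f_def)
    next
      case (2 m r)
      \<comment> \<open>This number is the inner product of the chord's midpoint y + m u with
        \<open>a\<close>.\<close>
      have "y \<bullet> a + m = 0" if "g y \<le> f y"
        using segment_powr_shift_equality[OF p 2(1)] that unfolding gseg[OF 2(2)] fseg[OF 2(3)] .
      moreover have "A (y + t *\<^sub>R u) = y + (- t - 2 * (y \<bullet> a)) *\<^sub>R u"
        by (simp add: A_def inner_add_left ua algebra_simps flip: scaleR_2)
      ultimately have "g y \<le> f y \<longrightarrow> (N (y + t *\<^sub>R u) < 1 \<longleftrightarrow> N (A (y + t *\<^sub>R u)) < 1)"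
        using 2(2)[of t] 2(2)[of "- t - 2 * (y \<bullet> a)"] by (auto simp: abs_less_iff)
      then show ?thesis
        using segment_powr_shift[OF p, of r "y \<bullet> a + m"] segment_powr_finite[OF p, of r]
        unfolding gseg[OF 2(2)] fseg[OF 2(3)] by blast
    qed
    then show "f y \<le> g y" "f y < \<infinity>" "g y \<le> f y \<Longrightarrow> N (y + t *\<^sub>R u) < 1 \<longleftrightarrow> N (A (y + t *\<^sub>R u)) < 1" by auto
  qed
  have "(\<integral>\<^sup>+y. slab u y * g y - slab u y * f y \<partial>lborel) = (\<integral>\<^sup>+y. slab u y * g y \<partial>lborel) - (\<integral>\<^sup>+y. slab u y * f y \<partial>lborel)"
    using fI by (intro nn_integral_diff AE_I2 mult_left_mono fg) auto
  also have "\<dots> = 0"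
    unfolding fI gI using le p is_norm_nonneg[OF is_norm_centroid_norm[OF N p], of a]
    by (simp add: ennreal_minus ennreal_eq_0_iff powr_mono2)
  finally have "AE y in lborel. slab u y * g y - slab u y * f y = 0" by (subst (asm) nn_integral_0_iff_AE) auto
  then have ae: "AE y in lborel. slab u y * (\<integral>\<^sup>+t. indicator {z. N z < 1 \<and> \<not> N (A z) < 1} (y + t *\<^sub>R u) \<partial>lborel) = 0"
  proof eventually_elim
    case (elim y)
    show ?case
    proof (cases "slab u y = 0")
      case False
      then have "slab u y = 1" by (auto simp: slab_def indicator_def split: if_splits)
      then have "g y - f y = 0" using elim by simp
      then have "g y \<le> f y" using ffin[of y] fg[of y] by (metis diff_eq_0_iff_ennreal infinity_ennreal_def)
      then show ?thesis using eq[of y] by simp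
    qed simp
  qed
  have mA: "{z. N z < 1 \<and> \<not> N (A z) < 1} \<in> sets borel" by measurable
  have "emeasure lborel {z. N z < 1 \<and> \<not> N (A z) < 1} = (\<integral>\<^sup>+z. indicator {z. N z < 1 \<and> \<not> N (A z) < 1} z \<partial>lborel)"
    using mA by simp
  also have "\<dots> = (\<integral>\<^sup>+y. slab u y * (\<integral>\<^sup>+t. indicator {z. N z < 1 \<and> \<not> N (A z) < 1} (y + t *\<^sub>R u) \<partial>lborel) \<partial>lborel)"
    using mA by (intro nn_integral_slices[OF _ u]) auto
  also have "\<dots> = 0"
    using ae by (subst nn_integral_0_iff_AE) (use mA in measurable)
  \<comment> \<open>Passes from almost every line to every point. Since \<open>A\<close> is an
    involution, the same inequality at \<open>A z\<close> gives the converse.\<close>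
  finally have "N (A z) \<le> N z" for z by (rule is_norm_le_of_null[OF N NA])
  from this[of z] this[of "A z"] show ?thesis unfolding AA by (simp add: A_def)
qed

section \<open>The \<open>L\<^sup>p\<close> Busemann--Petty centroid inequality\<close>

lemma orthonormal_family:
  fixes B :: "real^'n \<Rightarrow> real^'n \<Rightarrow> real"
  assumes lin: "\<And>z. linear (\<lambda>x. B x z)" and sym: "\<And>x y. B x y = B y x"
    and pos: "\<And>x. x \<noteq> 0 \<Longrightarrow> 0 < B x x" and k: "k \<le> CARD('n)"
  shows "\<exists>b :: nat \<Rightarrow> real^'n. \<forall>i<k. \<forall>j<k. B (b i) (b j) = of_bool (i = j)"
  using k
proof (induction k)
  case 0 then show ?case by simp
next
  case (Suc k)
  have B1: "B (x + y) z = B x z + B y z" "B (c *\<^sub>R x) z = c * B x z" "B (x - y) z = B x z - B y z" for x y z c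
    using linear_add[OF lin] linear_scale[OF lin] linear_diff[OF lin] by auto
  have B2: "B z (c *\<^sub>R x) = c * B z x" for x z c using B1(2) by (simp add: sym[of z])
  obtain b where b: "\<And>i j. i < k \<Longrightarrow> j < k \<Longrightarrow> B (b i) (b j) = of_bool (i = j)" using Suc by auto
  have "dim (span (b ` {..<k})) \<le> card (b ` {..<k})" by (simp add: dim_le_card')
  also have "\<dots> \<le> k" using card_image_le[of "{..<k}" b] by simp
  also have "\<dots> < CARD('n)" using Suc.prems by simp
  finally have "span (b ` {..<k}) \<noteq> UNIV" by (metis dim_UNIV DIM_cart DIM_real mult.right_neutral less_irrefl)
  \<comment> \<open>A Gram-Schmidt step: a vector outside the span, minus its B-projection onto the
    span, is nonzero and B-orthogonal to the family.\<close>
  then obtain v where v: "v \<notin> span (b ` {..<k})" by auto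
  define s where "s = (\<Sum>i<k. B v (b i) *\<^sub>R b i)"
  define w where "w = v - s"
  have "s \<in> span (b ` {..<k})" unfolding s_def by (intro span_sum span_scale span_base) auto
  then have "w \<noteq> 0" using v by (auto simp: w_def)
  then have w: "0 < B w w" by (rule pos)
  have wb: "B w (b j) = 0" if "j < k" for j
  proof -
    have "B s (b j) = (\<Sum>i<k. B (B v (b i) *\<^sub>R b i) (b j))"
      unfolding s_def by (rule linear_sum[OF lin])
    also have "\<dots> = (\<Sum>i<k. if i = j then B v (b j) else 0)"
      by (rule sum.cong) (use b that in \<open>auto simp: B1\<close>)
    also have "\<dots> = B v (b j)" using that by simp
    finally show ?thesis by (simp add: w_def B1)
  qed
  define t where "t = 1 / sqrt (B w w)"
  have "t * t * B w w = 1" using w by (simp add: t_def)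
  then have "B (t *\<^sub>R w) (t *\<^sub>R w) = 1" by (simp add: B1 B2)
  then have "\<forall>i<Suc k. \<forall>j<Suc k. B ((b(k := t *\<^sub>R w)) i) ((b(k := t *\<^sub>R w)) j) = of_bool (i = j)"
    using b wb by (auto simp: less_Suc_eq B1 B2 sym[of "b _" w])
  then show ?case by blast
qed

lemma orthonormalising_matrix:
  fixes B :: "real^'n \<Rightarrow> real^'n \<Rightarrow> real"
  assumes lin: "\<And>z. linear (\<lambda>x. B x z)" and sym: "\<And>x y. B x y = B y x"
    and pos: "\<And>x. x \<noteq> 0 \<Longrightarrow> 0 < B x x"
  obtains A :: "real^'n^'n" where "\<And>x. B (A *v x) (A *v x) = x \<bullet> x"
proof -
  obtain b :: "nat \<Rightarrow> real^'n" where b: "\<And>i j. i < CARD('n) \<Longrightarrow> j < CARD('n) \<Longrightarrow> B (b i) (b j) = of_bool (i = j)"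
    using orthonormal_family[OF lin sym pos order_refl] by blast
  obtain e :: "'n \<Rightarrow> nat" where e: "bij_betw e UNIV {0..<CARD('n)}"
    using ex_bij_betw_finite_nat[of "UNIV :: 'n set"] by auto
  then have el: "e i < CARD('n)" and ei: "e i = e j \<longleftrightarrow> i = j" for i j
    by (auto simp: bij_betw_def inj_on_def)
  define A :: "real^'n^'n" where "A = (\<chi> i j. b (e j) $ i)"
  have col: "A *v x = (\<Sum>j\<in>UNIV. x $ j *\<^sub>R b (e j))" for x
    by (simp add: matrix_mult_sum scalar_mult_eq_scaleR column_def A_def)
  have lin2: "linear (\<lambda>x. B z x)" for z using lin by (simp add: sym[of z])
  have "B (A *v x) (A *v x) = x \<bullet> x" for x
  proof -
    have "B (A *v x) (A *v x) = (\<Sum>j\<in>UNIV. B (x $ j *\<^sub>R b (e j)) (A *v x))"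
      by (subst (1) col) (rule linear_sum[OF lin])
    also have "\<dots> = (\<Sum>j\<in>UNIV. \<Sum>i\<in>UNIV. B (x $ j *\<^sub>R b (e j)) (x $ i *\<^sub>R b (e i)))"
      by (subst col) (rule sum.cong[OF refl], rule linear_sum[OF lin2])
    also have "\<dots> = (\<Sum>j\<in>UNIV. \<Sum>i\<in>UNIV. if i = j then x $ j * x $ j else 0)"
      by (intro sum.cong refl) (auto simp: linear_scale[OF lin] linear_scale[OF lin2] b el ei)
    also have "\<dots> = x \<bullet> x" by (simp add: inner_vec_def)
    finally show ?thesis .
  qed
  then show thesis by (rule that)
qed

text \<open>The square of the centroid norm for p = 2 is the quadratic form of second moments of the
  unit ball. A matrix that orthonormalises this form makes the norm Euclidean, and
  \<open>centroid_norm_matrix\<close> carries this over to the transformed body.\<close>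

lemma isotropic_position:
  fixes N :: "real^'n \<Rightarrow> real"
  assumes N: "is_norm N"
  obtains C :: "real^'n^'n" and c where "det C \<noteq> 0" "0 < c" "\<And>x. centroid_norm 2 (\<lambda>x. N (C *v x)) x = c * norm x"
proof -
  let ?M = "density lborel (indicator {y. N y < 1})"
  let ?q = "centroid_norm 2 N"
  have q: "is_norm ?q" by (rule is_norm_centroid_norm[OF N]) simp
  define B where "B x z = (\<integral>y. (y \<bullet> x) * (y \<bullet> z) \<partial>?M)" for x z
  have sq: "integrable ?M (\<lambda>y. (y \<bullet> x)\<^sup>2)" for x
    using centroid_integrable[OF N, of 2 x] by simp
  have int: "integrable ?M (\<lambda>y. (y \<bullet> x) * (y \<bullet> z))" for x z
  proof -
    \<comment> \<open>Polarisation, which reduces integrability of mixed moments to that of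
      squares.\<close>
    have "(y \<bullet> x) * (y \<bullet> z) = ((y \<bullet> (x + z))\<^sup>2 - (y \<bullet> x)\<^sup>2 - (y \<bullet> z)\<^sup>2) / 2" for y
      by (simp add: inner_add_right power2_eq_square field_simps)
    then show ?thesis using sq[of "x + z"] sq[of x] sq[of z] by (simp only:) simp
  qed
  have Bq: "B x x = (?q x)\<^sup>2" for x
  proof -
    have "B x x = (\<integral>y. \<bar>y \<bullet> x\<bar> powr 2 \<partial>?M)" unfolding B_def by (simp add: power2_eq_square)
    also have "\<dots> = ?q x powr 2" unfolding centroid_norm_def by (rule lp_functional_powr[symmetric]) simp
    finally show ?thesis using is_norm_nonneg[OF q] by simp
  qed
  have "linear (\<lambda>x. B x z)" for z
    by (rule linearI) (auto simp: B_def inner_add_right distrib_right int mult.assoc)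
  moreover have "B x y = B y x" for x y by (simp add: B_def mult.commute)
  moreover have "0 < B x x" if "x \<noteq> 0" for x using is_norm_pos[OF q that] by (simp add: Bq)
  ultimately obtain A :: "real^'n^'n" where A: "\<And>x. B (A *v x) (A *v x) = x \<bullet> x"
    using orthonormalising_matrix[of B] by blast
  have qA: "?q (A *v x) = norm x" for x
    using A[of x] is_norm_nonneg[OF q, of "A *v x"] by (simp add: Bq norm_eq_sqrt_inner real_sqrt_unique)
  have "A *v x = 0 \<Longrightarrow> x = 0" for x using qA[of x] is_norm_zero[OF q] by simp
  then have "invertible A"
    by (metis matrix_left_invertible_ker invertible_left_inverse)
  then obtain A' where A': "A ** A' = mat 1" "A' ** A = mat 1" unfolding invertible_def by auto
  \<comment> \<open>The inverse transpose of A, because transforming the body by C transforms the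
    centroid norm by the transpose of C.\<close>
  define C where "C = transpose A'"
  have dC: "det C \<noteq> 0"
  proof -
    have "det A' * det A = 1" using A'(2) by (metis det_I det_mul)
    then show ?thesis by (auto simp: C_def det_transpose)
  qed
  define c where "c = \<bar>det C\<bar> powr (- 1 / 2)"
  have "centroid_norm 2 (\<lambda>x. N (C *v x)) x = c * norm x" for x
  proof -
    have "transpose C *v (A *v x) = x"
      by (simp only: C_def transpose_transpose matrix_vector_mul_assoc A' matrix_vector_mul_lid)
    then have "centroid_norm 2 (\<lambda>x. N (C *v x)) x = centroid_norm 2 (\<lambda>x. N (C *v x)) (transpose C *v (A *v x))" by (simp only:)
    also have "\<dots> = c * ?q (A *v x)" unfolding c_def by (rule centroid_norm_matrix[OF N dC]) simp
    finally show ?thesis by (simp add: qA)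
  qed
  moreover have "0 < c" using dC by (simp add: c_def)
  ultimately show thesis using that dC by blast
qed

text \<open>The skew reflection T preserves N and has |det T| = 1, so its transpose preserves the
  Euclidean norm by isotropy. Applied to u this says that u - 2a is a unit vector, so a.a = 1; with
  a.u = 1 this forces a = u.\<close>

lemma isotropic_minimiser_euclidean:
  fixes N :: "real^'n \<Rightarrow> real"
  assumes N: "is_norm N" and p: "1 \<le> p"
    and min: "\<And>M :: real^'n \<Rightarrow> real. is_norm M \<Longrightarrow> centroid_ratio p N \<le> centroid_ratio p M"
    and iso: "\<And>x. centroid_norm 2 N x = c * norm x" and c: "0 < c"
  obtains d where "0 < d" "\<And>x. N x = d * norm x"
proof -
  have refl: "N (reflect u z) = N z" if u: "norm u = 1" for u z
  proof -
    have S: "is_norm (steiner u N)" by (rule is_norm_steiner[OF u N])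
    have "centroid_vol p N \<le> centroid_vol p (steiner u N)"
      using min[OF S] ubvol_pos[OF N] by (simp add: centroid_ratio_def ubvol_steiner[OF u N])
    then obtain a where a: "a \<bullet> u = 1" "centroid_norm p N a \<le> centroid_norm p (steiner u N) u"
      by (rule steiner_equality_functional[OF u N p])
    define A where "A z = z - (2 * (z \<bullet> a)) *\<^sub>R u" for z
    have NA: "N (A z) = N z" for z unfolding A_def by (rule steiner_equality_reflection[OF u N p a])
    have linA: "linear A" by (rule linearI) (auto simp: A_def inner_add_left algebra_simps)
    define T where "T = matrix A"
    have T: "T *v z = A z" for z using linA by (simp add: T_def matrix_works)
    have uu: "u \<bullet> u = 1" by (rule unit_inner_self[OF u])
    have ua: "u \<bullet> a = 1" using a by (simp add: inner_commute)
    have "(T ** T) *v x = mat 1 *v x" for x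
      by (simp only: matrix_vector_mul_assoc[symmetric] T matrix_vector_mul_lid)
         (simp add: A_def inner_diff_left ua algebra_simps flip: scaleR_2)
    then have "T ** T = mat 1" by (simp add: matrix_eq)
    then have dT: "det T * det T = 1" by (metis det_I det_mul)
    then have dT1: "det T \<noteq> 0" "\<bar>det T\<bar> = 1" by (auto simp: abs_if square_eq_1_iff)
    have adj: "u v* T = u - 2 *\<^sub>R a"
    proof (rule vector_eq_ldot[THEN iffD1], rule allI)
      fix x
      have "x \<bullet> (u v* T) = u \<bullet> A x" by (metis T dot_lmul_matrix inner_commute)
      also have "\<dots> = x \<bullet> (u - 2 *\<^sub>R a)"
        by (simp add: A_def inner_diff_right uu inner_commute)
      finally show "x \<bullet> (u v* T) = x \<bullet> (u - 2 *\<^sub>R a)" .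
    qed
    have "centroid_norm 2 (\<lambda>x. N (T *v x)) (transpose T *v u) = \<bar>det T\<bar> powr (- 1 / 2) * centroid_norm 2 N u"
      by (rule centroid_norm_matrix[OF N dT1(1)]) simp
    then have "norm (u - 2 *\<^sub>R a) = norm u"
      using c by (simp add: T NA dT1 iso adj)
    then have "(u - 2 *\<^sub>R a) \<bullet> (u - 2 *\<^sub>R a) = 1" using u by (simp add: dot_square_norm)
    then have "a \<bullet> a = 1"
      by (simp add: inner_simps uu ua a(1))
    then have "(a - u) \<bullet> (a - u) = 0" by (simp add: inner_simps uu ua a(1))
    then have "a = u" by simp
    then show ?thesis using NA[of z] by (simp add: A_def reflect_def)
  qed
  \<comment> \<open>Two distinct unit vectors are exchanged by the orthogonal reflection along their
    difference.\<close>
  have unit: "N x = N y" if x: "norm x = 1" and y: "norm y = 1" for x y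
  proof (cases "x = y")
    case False
    define u where "u = inverse (norm (x - y)) *\<^sub>R (x - y)"
    have u: "norm u = 1" using False by (simp add: u_def)
    have xx: "x \<bullet> x = 1" "y \<bullet> y = 1" using x y by (auto simp: dot_square_norm)
    have n2: "norm (x - y) * norm (x - y) = 2 * (x \<bullet> (x - y))"
      by (simp add: power2_norm_eq_inner inner_simps xx inner_commute flip: power2_eq_square)
    have "2 * (x \<bullet> u) = norm (x - y)"
      using n2 False by (simp add: u_def divide_simps del: inner_diff_right)
    then have "reflect u x = y" using False by (simp add: reflect_def u_def)
    then show ?thesis using refl[OF u, of x] by simp
  qed simp
  let ?e = "axis undefined 1 :: real^'n"
  have e: "norm ?e = 1" by simp
  have "N x = N ?e * norm x" for x
  proof (cases "x = 0")
    case True then show ?thesis by (simp add: is_norm_zero[OF N])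
  next
    case False
    have "N x = N (norm x *\<^sub>R (inverse (norm x) *\<^sub>R x))" using False by simp
    also have "\<dots> = norm x * N (inverse (norm x) *\<^sub>R x)" by (simp add: is_norm_scale[OF N] del: scaleR_scaleR)
    also have "N (inverse (norm x) *\<^sub>R x) = N ?e" using False by (intro unit e) simp
    finally show ?thesis by simp
  qed
  moreover have "0 < N ?e" using e by (intro is_norm_pos[OF N]) auto
  ultimately show thesis using that by blast
qed

lemma minimiser_ellipsoid:
  fixes N :: "real^'n \<Rightarrow> real"
  assumes N: "is_norm N" and p: "1 \<le> p"
    and min: "\<And>M :: real^'n \<Rightarrow> real. is_norm M \<Longrightarrow> centroid_ratio p N \<le> centroid_ratio p M"
  obtains C :: "real^'n^'n" where "det C \<noteq> 0" "\<And>x. N (C *v x) = norm x"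
proof -
  obtain C :: "real^'n^'n" and c where C: "det C \<noteq> 0" "0 < c" "\<And>x. centroid_norm 2 (\<lambda>x. N (C *v x)) x = c * norm x"
    using isotropic_position[OF N] by blast
  have "centroid_ratio p (\<lambda>x. N (C *v x)) \<le> centroid_ratio p M" if "is_norm M" for M :: "real^'n \<Rightarrow> real"
    using min[OF that] by (simp add: centroid_ratio_matrix[OF N C(1) p])
  then obtain d where d: "0 < d" "\<And>x. N (C *v x) = d * norm x"
    using isotropic_minimiser_euclidean[OF is_norm_matrix[OF N C(1)] p _ C(3,2)] by blast
  define C' where "C' = C ** matrix ((*\<^sub>R) (1 / d))"
  show thesis
  proof (rule that[of C'])
    show "det C' \<noteq> 0" using C(1) d(1) by (simp add: C'_def det_mul)
    show "N (C' *v x) = norm x" for x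
      using d by (simp add: C'_def matrix_scaleR_mult d(2) flip: matrix_vector_mul_assoc)
  qed
qed

text \<open>By invariance the minimal ratio is that of the ball, since some minimiser is an
  ellipsoid. A norm with this ratio is then a minimiser, to which \<open>minimiser_ellipsoid\<close>
  applies again.\<close>

theorem busemann_petty_centroid:
  fixes N :: "real^'n \<Rightarrow> real"
  assumes N: "is_norm N" and p: "1 \<le> p"
  shows "centroid_ratio p (norm :: real^'n \<Rightarrow> real) \<le> centroid_ratio p N"
    and "centroid_ratio p N = centroid_ratio p (norm :: real^'n \<Rightarrow> real) \<Longrightarrow>
      \<exists>C :: real^'n^'n. det C \<noteq> 0 \<and> (\<forall>x. N (C *v x) = norm x)"
proof -
  obtain N0 :: "real^'n \<Rightarrow> real" where N0: "is_norm N0"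
    "\<And>M :: real^'n \<Rightarrow> real. is_norm M \<Longrightarrow> centroid_ratio p N0 \<le> centroid_ratio p M"
    using centroid_ratio_minimiser[OF p] by blast
  obtain C :: "real^'n^'n" where C: "det C \<noteq> 0" "\<And>x. N0 (C *v x) = norm x"
    using minimiser_ellipsoid[OF N0(1) p N0(2)] by blast
  have eq: "centroid_ratio p N0 = centroid_ratio p (norm :: real^'n \<Rightarrow> real)"
    using centroid_ratio_matrix[OF N0(1) C(1) p] by (simp add: C(2))
  show "centroid_ratio p (norm :: real^'n \<Rightarrow> real) \<le> centroid_ratio p N"
    using N0(2)[OF N] by (simp add: eq)
  assume "centroid_ratio p N = centroid_ratio p (norm :: real^'n \<Rightarrow> real)"
  then have "centroid_ratio p N \<le> centroid_ratio p M" if "is_norm M" for M :: "real^'n \<Rightarrow> real"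
    using N0(2)[OF that] by (simp add: eq)
  then obtain C :: "real^'n^'n" where "det C \<noteq> 0" "\<And>x. N (C *v x) = norm x"
    using minimiser_ellipsoid[OF N p] by blast
  then show "\<exists>C :: real^'n^'n. det C \<noteq> 0 \<and> (\<forall>x. N (C *v x) = norm x)" by blast
qed

section \<open>Polar integration and constants\<close>

lemma nn_integral_lborel_scale:
  fixes f :: "'a::euclidean_space \<Rightarrow> ennreal"
  assumes [measurable]: "f \<in> borel_measurable borel" and s: "0 < s"
  shows "(\<integral>\<^sup>+x. f x \<partial>lborel) = ennreal (s ^ DIM('a)) * (\<integral>\<^sup>+x. f (s *\<^sub>R x) \<partial>lborel)"
  using s by (subst lborel_affine[of s 0])
    (simp_all add: nn_integral_density nn_integral_distr nn_integral_cmult)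

lemma nn_integral_monomial_tail:
  fixes a k :: real
  assumes a: "0 < a" and k: "0 < k"
  shows "(\<integral>\<^sup>+s. ennreal (s powr (- k - 1)) * of_bool (a < s) \<partial>lborel) = ennreal (a powr (- k) / k)"
proof -
  have "(\<integral>\<^sup>+s. ennreal (s powr (- k - 1)) * of_bool (a < s) \<partial>lborel)
      = (\<integral>\<^sup>+s. ennreal (indicator {a..} s * s powr (- k - 1)) * indicator {a..} s \<partial>lborel)"
    using AE_lborel_singleton[of a] by (intro nn_integral_cong_AE) (auto elim!: eventually_mono simp: indicator_def)
  also have "\<dots> = ennreal (0 - (- (a powr (- k) / k)))"
  proof (rule nn_integral_FTC_atLeast)
    show "((\<lambda>x. - (x powr (- k) / k)) has_real_derivative indicator {a..} x * x powr (- k - 1)) (at x)" if "a \<le> x" for x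
      using that a k by (auto intro!: derivative_eq_intros)
    have "((\<lambda>x::real. x powr (- k)) \<longlongrightarrow> 0) at_top"
      using k by (intro tendsto_neg_powr filterlim_ident) auto
    then have "((\<lambda>x. - (x powr (- k) / k)) \<longlongrightarrow> - (0 / k)) at_top"
      using k by (intro tendsto_intros) auto
    then show "((\<lambda>x. - (x powr (- k) / k)) \<longlongrightarrow> 0) at_top" by simp
  qed (auto simp: indicator_def)
  finally show ?thesis by simp
qed

lemma nn_integral_monomial_initial:
  fixes b :: real
  assumes b: "0 < b" and n: "0 < n"
  shows "(\<integral>\<^sup>+s. ennreal (s ^ (n - 1)) * of_bool (0 < s \<and> s < b) \<partial>lborel) = ennreal (b ^ n / real n)"
proof -
  have "(\<integral>\<^sup>+s. ennreal (s ^ (n - 1)) * of_bool (0 < s \<and> s < b) \<partial>lborel)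
      = (\<integral>\<^sup>+s. ennreal (s ^ (n - 1)) * indicator {0..b} s \<partial>lborel)"
    using AE_lborel_singleton[of 0] AE_lborel_singleton[of b]
    by (intro nn_integral_cong_AE) (auto elim!: eventually_elim2 simp: indicator_def)
  also have "\<dots> = ennreal (b ^ n / real n - 0 ^ n / real n)"
  proof (rule nn_integral_FTC_Icc)
    show "((\<lambda>x. x ^ n / real n) has_real_derivative x ^ (n - 1)) (at x)" if "x \<in> {0..b}" for x
      using n by (auto intro!: derivative_eq_intros)
  qed (use b in auto)
  finally show ?thesis using n by (simp add: zero_power)
qed

text \<open>Both sides equal, up to a factor, the integral of \<open>\<phi> x (s |x|)\<^sup>n / s\<close> over all \<open>x\<close> with \<open>N x < 1\<close> and
  all \<open>s > 0\<close> with \<open>s |x| < 1\<close>: integrate first in \<open>s\<close>, or first rescale \<open>x = y / s\<close>.\<close>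

lemma polar_integral:
  fixes N \<phi> :: "'a::euclidean_space \<Rightarrow> real" and p :: real
  assumes N: "is_norm N" and p: "0 \<le> p"
    and [measurable]: "\<phi> \<in> borel_measurable borel" and nonneg: "\<And>x. 0 \<le> \<phi> x"
    and hom: "\<And>t x. 0 < t \<Longrightarrow> \<phi> (t *\<^sub>R x) = t powr p * \<phi> x"
  shows "ennreal (real DIM('a)) * (\<integral>\<^sup>+y. indicator (ball 0 1) y *
      ennreal (N (y /\<^sub>R norm y) powr (- real DIM('a) - p) * \<phi> (y /\<^sub>R norm y)) \<partial>lborel)
    = ennreal (real DIM('a) + p) * (\<integral>\<^sup>+x. indicator {x. N x < 1} x * ennreal (\<phi> x) \<partial>lborel)"
proof -
  define n where "n = DIM('a)"
  have n: "0 < n" by (simp add: n_def)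
  define k where "k = real n + p"
  have k: "0 < k" using n p by (simp add: k_def add_pos_nonneg)
  have [measurable]: "N \<in> borel_measurable borel" by (rule is_norm_measurable[OF N])
  define D where "D = (\<integral>\<^sup>+s. \<integral>\<^sup>+x. ennreal (s ^ (n - 1)) * of_bool (0 < s) * of_bool (s * norm x < 1)
      * of_bool (N x < 1) * ennreal (norm x ^ n * \<phi> x) \<partial>lborel \<partial>lborel)"
  have "D = (\<integral>\<^sup>+x. \<integral>\<^sup>+s. ennreal (s ^ (n - 1)) * of_bool (0 < s) * of_bool (s * norm x < 1)
      * of_bool (N x < 1) * ennreal (norm x ^ n * \<phi> x) \<partial>lborel \<partial>lborel)"
    unfolding D_def by (rule lborel_pair.Fubini') measurable
  also have "\<dots> = (\<integral>\<^sup>+x. ennreal (1 / real n) * (indicator {x. N x < 1} x * ennreal (\<phi> x)) \<partial>lborel)"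
  proof (rule nn_integral_cong_AE)
    show "AE x in lborel. (\<integral>\<^sup>+s. ennreal (s ^ (n - 1)) * of_bool (0 < s) * of_bool (s * norm x < 1)
      * of_bool (N x < 1) * ennreal (norm x ^ n * \<phi> x) \<partial>lborel)
      = ennreal (1 / real n) * (indicator {x. N x < 1} x * ennreal (\<phi> x))"
      using AE_lborel_singleton[of "0::'a"]
    proof eventually_elim
      case (elim x)
      then have nx: "0 < norm x" by simp
      have "(\<integral>\<^sup>+s. ennreal (s ^ (n - 1)) * of_bool (0 < s) * of_bool (s * norm x < 1)
      * of_bool (N x < 1) * ennreal (norm x ^ n * \<phi> x) \<partial>lborel)
        = (\<integral>\<^sup>+s. (ennreal (s ^ (n - 1)) * of_bool (0 < s \<and> s < 1 / norm x)) * (of_bool (N x < 1) * ennreal (norm x ^ n * \<phi> x)) \<partial>lborel)"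
        using nx by (intro nn_integral_cong) (auto simp: field_simps)
      also have "\<dots> = ennreal ((1 / norm x) ^ n / real n) * (of_bool (N x < 1) * ennreal (norm x ^ n * \<phi> x))"
      proof (subst nn_integral_multc)
        show "(\<lambda>s. ennreal (s ^ (n - 1)) * of_bool (0 < s \<and> s < 1 / norm x)) \<in> borel_measurable lborel"
          by measurable
      qed (use nn_integral_monomial_initial[of "1 / norm x" n] nx n in simp)
      also have "\<dots> = ennreal (1 / real n) * (indicator {x. N x < 1} x * ennreal (\<phi> x))"
        using nx nonneg[of x] by (auto simp: indicator_def power_one_over simp flip: ennreal_mult')
      finally show ?case .
    qed
  qed
  also have "\<dots> = ennreal (1 / real n) * (\<integral>\<^sup>+x. indicator {x. N x < 1} x * ennreal (\<phi> x) \<partial>lborel)"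
    by (rule nn_integral_cmult) measurable
  finally have D1: "D = ennreal (1 / real n) * (\<integral>\<^sup>+x. indicator {x. N x < 1} x * ennreal (\<phi> x) \<partial>lborel)" .
  have "D = (\<integral>\<^sup>+s. \<integral>\<^sup>+y. ennreal (s powr (- k - 1)) * of_bool (0 < s) * of_bool (norm y < 1)
      * of_bool (N y < s) * ennreal (norm y ^ n * \<phi> y) \<partial>lborel \<partial>lborel)"
    unfolding D_def
  proof (rule nn_integral_cong)
    fix s :: real
    show "(\<integral>\<^sup>+x. ennreal (s ^ (n - 1)) * of_bool (0 < s) * of_bool (s * norm x < 1)
      * of_bool (N x < 1) * ennreal (norm x ^ n * \<phi> x) \<partial>lborel)
      = (\<integral>\<^sup>+y. ennreal (s powr (- k - 1)) * of_bool (0 < s) * of_bool (norm y < 1)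
      * of_bool (N y < s) * ennreal (norm y ^ n * \<phi> y) \<partial>lborel)"
    proof (cases "0 < s")
      case s: True
      have "(\<integral>\<^sup>+y. ennreal (s powr (- k - 1)) * of_bool (0 < s) * of_bool (norm y < 1)
          * of_bool (N y < s) * ennreal (norm y ^ n * \<phi> y) \<partial>lborel)
        = ennreal (s ^ n) * (\<integral>\<^sup>+x. ennreal (s powr (- k - 1)) * of_bool (0 < s) * of_bool (norm (s *\<^sub>R x) < 1)
          * of_bool (N (s *\<^sub>R x) < s) * ennreal (norm (s *\<^sub>R x) ^ n * \<phi> (s *\<^sub>R x)) \<partial>lborel)"
        unfolding n_def by (rule nn_integral_lborel_scale[OF _ s]) measurable
      also have "\<dots> = (\<integral>\<^sup>+x. ennreal (s ^ n) * (ennreal (s powr (- k - 1)) * of_bool (0 < s) * of_bool (norm (s *\<^sub>R x) < 1)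
          * of_bool (N (s *\<^sub>R x) < s) * ennreal (norm (s *\<^sub>R x) ^ n * \<phi> (s *\<^sub>R x))) \<partial>lborel)"
        by (rule nn_integral_cmult[symmetric]) measurable
      also have "\<dots> = (\<integral>\<^sup>+x. ennreal (s ^ (n - 1)) * of_bool (0 < s) * of_bool (s * norm x < 1)
      * of_bool (N x < 1) * ennreal (norm x ^ n * \<phi> x) \<partial>lborel)"
      proof (rule nn_integral_cong)
        fix x
        have "s ^ n * (s powr (- k - 1) * (norm (s *\<^sub>R x) ^ n * \<phi> (s *\<^sub>R x)))
            = (s ^ n * s powr (- k - 1) * s ^ n * s powr p) * (norm x ^ n * \<phi> x)"
          using s by (simp add: hom power_mult_distrib mult_ac)
        also have "s ^ n * s powr (- k - 1) * s ^ n * s powr p = s powr (real n + (- k - 1) + real n + p)"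
          by (simp only: powr_add powr_realpow[OF s])
        also have "real n + (- k - 1) + real n + p = real (n - 1)" using n by (simp add: k_def of_nat_diff)
        also have "s powr real (n - 1) = s ^ (n - 1)" using s by (rule powr_realpow)
        finally have "ennreal (s ^ n) * (ennreal (s powr (- k - 1)) * ennreal (norm (s *\<^sub>R x) ^ n * \<phi> (s *\<^sub>R x)))
            = ennreal (s ^ (n - 1)) * ennreal (norm x ^ n * \<phi> x)"
          using s nonneg by (simp flip: ennreal_mult')
        then show "ennreal (s ^ n) * (ennreal (s powr (- k - 1)) * of_bool (0 < s) * of_bool (norm (s *\<^sub>R x) < 1)
          * of_bool (N (s *\<^sub>R x) < s) * ennreal (norm (s *\<^sub>R x) ^ n * \<phi> (s *\<^sub>R x)))
          = ennreal (s ^ (n - 1)) * of_bool (0 < s) * of_bool (s * norm x < 1)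
            * of_bool (N x < 1) * ennreal (norm x ^ n * \<phi> x)"
          using s by (cases "s * norm x < 1"; cases "N x < 1") (simp_all add: is_norm_scale[OF N])
      qed
      finally show ?thesis by simp
    qed simp
  qed
  also have "\<dots> = (\<integral>\<^sup>+y. \<integral>\<^sup>+s. ennreal (s powr (- k - 1)) * of_bool (0 < s) * of_bool (norm y < 1)
      * of_bool (N y < s) * ennreal (norm y ^ n * \<phi> y) \<partial>lborel \<partial>lborel)"
    by (rule lborel_pair.Fubini') measurable
  also have "\<dots> = (\<integral>\<^sup>+y. ennreal (1 / k) * (indicator (ball 0 1) y *
      ennreal (N (y /\<^sub>R norm y) powr (- real n - p) * \<phi> (y /\<^sub>R norm y))) \<partial>lborel)"
  proof (rule nn_integral_cong_AE)
    show "AE y in lborel. (\<integral>\<^sup>+s. ennreal (s powr (- k - 1)) * of_bool (0 < s) * of_bool (norm y < 1)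
      * of_bool (N y < s) * ennreal (norm y ^ n * \<phi> y) \<partial>lborel)
      = ennreal (1 / k) * (indicator (ball 0 1) y * ennreal (N (y /\<^sub>R norm y) powr (- real n - p) * \<phi> (y /\<^sub>R norm y)))"
      using AE_lborel_singleton[of "0::'a"]
    proof eventually_elim
      case (elim y)
      then have ny: "0 < norm y" and Ny: "0 < N y" using is_norm_pos[OF N] by auto
      have "(\<integral>\<^sup>+s. ennreal (s powr (- k - 1)) * of_bool (0 < s) * of_bool (norm y < 1)
        * of_bool (N y < s) * ennreal (norm y ^ n * \<phi> y) \<partial>lborel)
        = (\<integral>\<^sup>+s. (ennreal (s powr (- k - 1)) * of_bool (N y < s)) * (of_bool (norm y < 1) * ennreal (norm y ^ n * \<phi> y)) \<partial>lborel)"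
        using Ny by (intro nn_integral_cong) auto
      also have "\<dots> = ennreal (N y powr (- k) / k) * (of_bool (norm y < 1) * ennreal (norm y ^ n * \<phi> y))"
        using Ny k by (subst nn_integral_multc) (auto simp: nn_integral_monomial_tail)
      also have "\<dots> = ennreal (1 / k) * (of_bool (norm y < 1) * ennreal (N y powr (- k) * (norm y ^ n * \<phi> y)))"
        using k nonneg[of y] ny by (auto simp: mult_ac divide_inverse simp flip: ennreal_mult')
      also have "N y powr (- k) * (norm y ^ n * \<phi> y) = N (y /\<^sub>R norm y) powr (- k) * \<phi> (y /\<^sub>R norm y)"
      proof -
        define z where "z = y /\<^sub>R norm y"
        have yz: "y = norm y *\<^sub>R z" using ny by (simp add: z_def)
        have "N y = norm y * N z" by (subst yz) (simp add: is_norm_scale[OF N])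
        moreover have "\<phi> y = norm y powr p * \<phi> z" by (subst yz) (rule hom[OF ny])
        ultimately have "N y powr (- k) * (norm y ^ n * \<phi> y)
            = (norm y powr (- k) * (norm y powr real n * norm y powr p)) * (N z powr (- k) * \<phi> z)"
          using is_norm_nonneg[OF N, of z] ny by (simp add: powr_mult powr_realpow)
        also have "norm y powr (- k) * (norm y powr real n * norm y powr p) = norm y powr (- k + (real n + p))"
          by (simp only: powr_add)
        also have "\<dots> = 1" using ny by (simp add: k_def)
        finally show ?thesis by (simp add: z_def)
      qed
      finally show ?case by (simp add: indicator_def k_def)
    qed
  qed
  also have "\<dots> = ennreal (1 / k) * (\<integral>\<^sup>+y. indicator (ball 0 1) y *
      ennreal (N (y /\<^sub>R norm y) powr (- real n - p) * \<phi> (y /\<^sub>R norm y)) \<partial>lborel)" (is "_ = _ * ?R")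
  proof (rule nn_integral_cmult)
    have [measurable]: "ball (0::'a) 1 \<in> sets borel" by simp
    show "(\<lambda>y. indicator (ball 0 1) y * ennreal (N (y /\<^sub>R norm y) powr (- real n - p) * \<phi> (y /\<^sub>R norm y))) \<in> borel_measurable lborel"
      by measurable
  qed
  finally have D2: "D = ennreal (1 / k) * ?R" .
  let ?L = "(\<integral>\<^sup>+x. indicator {x. N x < 1} x * ennreal (\<phi> x) \<partial>lborel)"
  have "ennreal (real n) * ?R = ennreal (real n * k) * (ennreal (1 / k) * ?R)"
    using k by (simp add: mult.assoc[symmetric] flip: ennreal_mult')
  also have "\<dots> = ennreal (real n * k) * (ennreal (1 / real n) * ?L)" using D1 D2 by simp
  also have "\<dots> = ennreal k * ?L"
    using k n by (simp add: mult.assoc[symmetric] flip: ennreal_mult')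
  finally show ?thesis by (simp add: n_def k_def)
qed

text \<open>Transfers \<open>polar_integral\<close> to the Bochner integral inside
  \<open>sphere_integral\<close>; nonnegativity lets \<open>enn2real\<close> stand in for an
  integrability proof.\<close>

lemma sphere_integral_polar:
  fixes N \<phi> :: "real^'n \<Rightarrow> real" and p :: real
  assumes N: "is_norm N" and p: "0 \<le> p"
    and [measurable]: "\<phi> \<in> borel_measurable borel" and nonneg: "\<And>x. 0 \<le> \<phi> x"
    and hom: "\<And>t x. 0 < t \<Longrightarrow> \<phi> (t *\<^sub>R x) = t powr p * \<phi> x"
  shows "sphere_integral (\<lambda>\<xi>. N \<xi> powr (- real CARD('n) - p) * \<phi> \<xi>)
     = (real CARD('n) + p) * enn2real (\<integral>\<^sup>+x. indicator {x. N x < 1} x * ennreal (\<phi> x) \<partial>lborel)"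
proof -
  have [measurable]: "N \<in> borel_measurable borel" by (rule is_norm_measurable[OF N])
  let ?g = "\<lambda>y. N (y /\<^sub>R norm y) powr (- real CARD('n) - p) * \<phi> (y /\<^sub>R norm y)"
  have "(LINT y : ball 0 1 | lborel. ?g y) = enn2real (\<integral>\<^sup>+y. ennreal (indicator (ball 0 1) y *\<^sub>R ?g y) \<partial>lborel)"
    unfolding set_lebesgue_integral_def
  proof (rule integral_eq_nn_integral)
    have "?g \<in> borel_measurable borel" by measurable
    then show "(\<lambda>y. indicator (ball 0 1) y *\<^sub>R ?g y) \<in> borel_measurable lborel"
      by (intro borel_measurable_scaleR borel_measurable_indicator) auto
  qed (auto simp: nonneg)
  also have "(\<integral>\<^sup>+y. ennreal (indicator (ball 0 1) y *\<^sub>R ?g y) \<partial>lborel) = (\<integral>\<^sup>+y. indicator (ball 0 1) y * ennreal (?g y) \<partial>lborel)"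
    by (intro nn_integral_cong) (simp add: indicator_def)
  finally have "sphere_integral (\<lambda>\<xi>. N \<xi> powr (- real CARD('n) - p) * \<phi> \<xi>)
      = enn2real (ennreal (real CARD('n)) * (\<integral>\<^sup>+y. indicator (ball 0 1) y * ennreal (?g y) \<partial>lborel))"
    by (simp add: sphere_integral_def enn2real_mult)
  also have "\<dots> = enn2real (ennreal (real CARD('n) + p) * (\<integral>\<^sup>+x. indicator {x. N x < 1} x * ennreal (\<phi> x) \<partial>lborel))"
    using polar_integral[OF N p _ nonneg hom] by simp
  finally show ?thesis using p by (simp add: enn2real_mult del: ennreal_plus)
qed

section \<open>Gaussian integrals and moments of the Euclidean ball\<close>

lemma Gamma_nn_integral:
  fixes a :: real
  assumes a: "0 < a"
  shows "(\<integral>\<^sup>+t. of_bool (0 < t) * ennreal (t powr (a - 1) * exp (- t)) \<partial>lborel) = ennreal (Gamma a)"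
proof -
  have "(\<integral>\<^sup>+t. of_bool (0 < t) * ennreal (t powr (a - 1) * exp (- t)) \<partial>lborel)
     = (\<integral>\<^sup>+t. ennreal (t powr (a - 1) / exp t) * indicator {0..} t \<partial>lborel)"
    using AE_lborel_singleton[of 0]
    by (intro nn_integral_cong_AE) (auto elim!: eventually_mono simp: indicator_def exp_minus divide_inverse)
  also have "\<dots> = ennreal (Gamma a)"
    by (rule nn_integral_has_integral_lebesgue'[OF _ Gamma_integral_real[OF a]]) auto
  finally show ?thesis .
qed

text \<open>Write exp(-|x|^2) as the integral of exp(-t) over t > |x|^2. The resulting balls of
  radius sqrt t have moments proportional to t^((n+p)/2), which leaves a Gamma integral. It trades
  ball moments for Gaussian moments, which factor over coordinates.\<close>

lemma gaussian_layer_cake: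
  fixes \<phi> :: "'a::euclidean_space \<Rightarrow> real" and p :: real
  assumes p: "0 \<le> p" and [measurable]: "\<phi> \<in> borel_measurable borel" and nonneg: "\<And>x. 0 \<le> \<phi> x"
    and hom: "\<And>t x. 0 < t \<Longrightarrow> \<phi> (t *\<^sub>R x) = t powr p * \<phi> x"
  shows "(\<integral>\<^sup>+x. ennreal (\<phi> x * exp (- (norm x)\<^sup>2)) \<partial>lborel)
     = ennreal (Gamma ((real DIM('a) + p) / 2 + 1)) * (\<integral>\<^sup>+x. indicator {x. norm x < 1} x * ennreal (\<phi> x) \<partial>lborel)"
proof -
  let ?B = "\<integral>\<^sup>+x. indicator {x. norm x < 1} x * ennreal (\<phi> x) \<partial>lborel"
  define q where "q = (real DIM('a) + p) / 2"
  have q: "0 < q" using p by (simp add: q_def add_pos_nonneg)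
  have exp_tail: "(\<integral>\<^sup>+t. of_bool (r < t) * ennreal (exp (- t)) \<partial>lborel) = ennreal (exp (- r))" for r :: real
  proof -
    have "(\<integral>\<^sup>+t. of_bool (r < t) * ennreal (exp (- t)) \<partial>lborel) = (\<integral>\<^sup>+t. ennreal (exp (- t)) * indicator {r..} t \<partial>lborel)"
      using AE_lborel_singleton[of r] by (intro nn_integral_cong_AE) (auto elim!: eventually_mono simp: indicator_def)
    also have "\<dots> = ennreal (0 - (- exp (- r)))"
    proof (rule nn_integral_FTC_atLeast)
      show "((\<lambda>x. - exp (- x)) has_real_derivative exp (- x)) (at x)" for x :: real
        by (auto intro!: derivative_eq_intros)
      have "((\<lambda>x::real. exp (- x)) \<longlongrightarrow> 0) at_top"
        by (rule filterlim_compose[OF exp_at_bot filterlim_uminus_at_bot_at_top])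
      then show "((\<lambda>x::real. - exp (- x)) \<longlongrightarrow> 0) at_top" using tendsto_minus by fastforce
    qed auto
    finally show ?thesis by simp
  qed
  have "(\<integral>\<^sup>+x. ennreal (\<phi> x * exp (- (norm x)\<^sup>2)) \<partial>lborel)
      = (\<integral>\<^sup>+x. \<integral>\<^sup>+t. ennreal (\<phi> x) * (of_bool ((norm x)\<^sup>2 < t) * ennreal (exp (- t))) \<partial>lborel \<partial>lborel)"
  proof (rule nn_integral_cong)
    fix x
    show "ennreal (\<phi> x * exp (- (norm x)\<^sup>2)) = (\<integral>\<^sup>+t. ennreal (\<phi> x) * (of_bool ((norm x)\<^sup>2 < t) * ennreal (exp (- t))) \<partial>lborel)"
      by (subst nn_integral_cmult) (auto simp: exp_tail nonneg ennreal_mult')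
  qed
  also have "\<dots> = (\<integral>\<^sup>+t. \<integral>\<^sup>+x. ennreal (\<phi> x) * (of_bool ((norm x)\<^sup>2 < t) * ennreal (exp (- t))) \<partial>lborel \<partial>lborel)"
    by (rule lborel_pair.Fubini') measurable
  also have "\<dots> = (\<integral>\<^sup>+t. (of_bool (0 < t) * ennreal (t powr ((q + 1) - 1) * exp (- t))) * ?B \<partial>lborel)"
  proof (rule nn_integral_cong)
    fix t :: real
    show "(\<integral>\<^sup>+x. ennreal (\<phi> x) * (of_bool ((norm x)\<^sup>2 < t) * ennreal (exp (- t))) \<partial>lborel)
        = (of_bool (0 < t) * ennreal (t powr ((q + 1) - 1) * exp (- t))) * ?B"
    proof (cases "0 < t")
      case False
      then have "\<not> (norm x)\<^sup>2 < t" for x :: 'a using zero_le_power2[of "norm x"] by linarith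
      then show ?thesis using False by simp
    next
      case t: True
      define s where "s = sqrt t"
      have s: "0 < s" "s\<^sup>2 = t" using t by (auto simp: s_def)
      have "(\<integral>\<^sup>+x. ennreal (\<phi> x) * (of_bool ((norm x)\<^sup>2 < t) * ennreal (exp (- t))) \<partial>lborel)
          = ennreal (s ^ DIM('a)) * (\<integral>\<^sup>+x. ennreal (\<phi> (s *\<^sub>R x)) * (of_bool ((norm (s *\<^sub>R x))\<^sup>2 < t) * ennreal (exp (- t))) \<partial>lborel)"
        by (rule nn_integral_lborel_scale[OF _ s(1)]) measurable
      also have "\<dots> = ennreal (s ^ DIM('a)) * (\<integral>\<^sup>+x. ennreal (s powr p * exp (- t)) * (indicator {x. norm x < 1} x * ennreal (\<phi> x)) \<partial>lborel)"
      proof (rule arg_cong2[of _ _ _ _ "(*)"], rule refl, rule nn_integral_cong)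
        fix x :: 'a
        have "(norm (s *\<^sub>R x))\<^sup>2 < t \<longleftrightarrow> norm x < 1"
          using s by (simp add: power_mult_distrib flip: s(2)) (metis norm_ge_zero one_power2 power2_less_imp_less power_strict_mono zero_le_one zero_less_numeral)
        then show "ennreal (\<phi> (s *\<^sub>R x)) * (of_bool ((norm (s *\<^sub>R x))\<^sup>2 < t) * ennreal (exp (- t)))
            = ennreal (s powr p * exp (- t)) * (indicator {x. norm x < 1} x * ennreal (\<phi> x))"
          using s nonneg[of x] by (simp add: hom indicator_def ennreal_mult' mult_ac)
      qed
      also have "\<dots> = ennreal (s ^ DIM('a)) * (ennreal (s powr p * exp (- t)) * ?B)"
        by (subst nn_integral_cmult) auto
      also have "\<dots> = ennreal (s ^ DIM('a) * s powr p * exp (- t)) * ?B"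
        using s by (simp add: ennreal_mult' mult.assoc)
      also have "s ^ DIM('a) * s powr p = s powr (real DIM('a) + p)"
        using s by (simp add: powr_add powr_realpow)
      also have "\<dots> = t powr ((q + 1) - 1)" using t by (simp add: s_def q_def powr_half_sqrt[symmetric] powr_powr)
      finally show ?thesis using t by simp
    qed
  qed
  also have "\<dots> = (\<integral>\<^sup>+t. of_bool (0 < t) * ennreal (t powr ((q + 1) - 1) * exp (- t)) \<partial>lborel) * ?B"
    by (rule nn_integral_multc) measurable
  also have "\<dots> = ennreal (Gamma (q + 1)) * ?B"
    using q by (subst Gamma_nn_integral) auto
  finally show ?thesis by (simp add: q_def)
qed

text \<open>The layer-cake formula in dimension one: the interval (-1,1) has moment 2/(p+1), which
  cancels against the functional equation of Gamma.\<close>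

lemma gaussian_moment:
  fixes p :: real
  assumes p: "0 \<le> p"
  shows "(\<integral>\<^sup>+t. ennreal (\<bar>t\<bar> powr p * exp (- t\<^sup>2)) \<partial>lborel) = ennreal (Gamma ((p + 1) / 2))"
proof -
  have "(\<integral>\<^sup>+t. ennreal (\<bar>t\<bar> powr p * exp (- (norm (t::real))\<^sup>2)) \<partial>lborel)
     = ennreal (Gamma ((real DIM(real) + p) / 2 + 1)) * (\<integral>\<^sup>+t. indicator {t::real. norm t < 1} t * ennreal (\<bar>t\<bar> powr p) \<partial>lborel)"
    by (rule gaussian_layer_cake[OF p]) (auto simp: abs_mult powr_mult)
  also have "(\<integral>\<^sup>+t. indicator {t::real. norm t < 1} t * ennreal (\<bar>t\<bar> powr p) \<partial>lborel) = ennreal (2 / (p + 1))"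
  proof -
    have half: "(\<integral>\<^sup>+t. ennreal (t powr p) * indicator {0..1} t \<partial>lborel) = ennreal (1 / (p + 1))"
    proof -
      have "((\<lambda>t::real. t powr p) has_integral (1 powr (p + 1) / (p + 1))) {0..1}"
        using p by (intro has_integral_powr_from_0) auto
      then show ?thesis
        using nn_integral_has_integral_lebesgue'[of "{0..1}" "\<lambda>t. t powr p" "1 / (p + 1)"] by auto
    qed
    have "(\<integral>\<^sup>+t. indicator {t::real. norm t < 1} t * ennreal (\<bar>t\<bar> powr p) \<partial>lborel)
        = (\<integral>\<^sup>+t. ennreal (t powr p) * indicator {0..1} t + ennreal ((0 + (-1) * t) powr p) * indicator {0..1} (0 + (-1) * t) \<partial>lborel)"
    proof (rule nn_integral_cong_AE)
      show "AE t in lborel. indicator {t::real. norm t < 1} t * ennreal (\<bar>t\<bar> powr p)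
        = ennreal (t powr p) * indicator {0..1} t + ennreal ((0 + (-1) * t) powr p) * indicator {0..1} (0 + (-1) * t)"
        using AE_lborel_singleton[of "0::real"] AE_lborel_singleton[of "1::real"] AE_lborel_singleton[of "-1::real"]
        by eventually_elim (auto simp: indicator_def)
    qed
    also have "\<dots> = (\<integral>\<^sup>+t. ennreal (t powr p) * indicator {0..1} t \<partial>lborel)
       + (\<integral>\<^sup>+t. ennreal ((0 + (-1) * t) powr p) * indicator {0..1} (0 + (-1) * t) \<partial>lborel)"
      by (rule nn_integral_add) measurable
    also have "(\<integral>\<^sup>+t. ennreal ((0 + (-1) * t) powr p) * indicator {0..1} (0 + (-1) * t) \<partial>lborel)
       = (\<integral>\<^sup>+t. ennreal (t powr p) * indicator {0..1} t \<partial>lborel)"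
      using nn_integral_real_affine[of "\<lambda>t. ennreal (t powr p) * indicator {0..1} t" "-1" 0] by simp
    finally show ?thesis using p by (simp add: half flip: ennreal_plus)
  qed
  also have "ennreal (Gamma ((real DIM(real) + p) / 2 + 1)) * ennreal (2 / (p + 1)) = ennreal (Gamma ((p + 1) / 2))"
  proof -
    have "Gamma ((p + 1) / 2 + 1) = (p + 1) / 2 * Gamma ((p + 1) / 2)"
      using p by (intro Gamma_plus1) (auto simp: nonpos_Ints_def field_simps)
    then have "Gamma ((real DIM(real) + p) / 2 + 1) * (2 / (p + 1)) = Gamma ((p + 1) / 2)"
      using p by (simp add: add.commute)
    then show ?thesis using p by (simp flip: ennreal_mult'')
  qed
  finally show ?thesis by simp
qed

text \<open>The integral of |x.e|^p over the Euclidean unit ball of dimension n for a unit vector e,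
  in closed form.\<close>

definition ball_moment :: "real \<Rightarrow> real \<Rightarrow> real" where
  "ball_moment n p = Gamma ((p + 1) / 2) * pi powr ((n - 1) / 2) / Gamma ((n + p) / 2 + 1)"

lemma ball_moment_pos:
  assumes "0 < n" "0 \<le> p"
  shows "0 < ball_moment n p"
proof -
  have "0 < Gamma ((p + 1) / 2)" "0 < Gamma ((n + p) / 2 + 1)"
    using assms by (auto intro!: Gamma_real_pos add_nonneg_pos)
  then show ?thesis by (simp add: ball_moment_def)
qed

text \<open>Against the Gaussian weight the integrand is a product over coordinates:
  \<open>e\<close> contributes a Gamma value, every other coordinate sqrt pi.\<close>

lemma nn_integral_ball_axis:
  fixes e :: "'a::euclidean_space"
  assumes p: "0 \<le> p" and e: "e \<in> Basis"
  shows "(\<integral>\<^sup>+x. indicator {x. norm x < 1} x * ennreal (\<bar>x \<bullet> e\<bar> powr p) \<partial>lborel) = ennreal (ball_moment (real DIM('a)) p)"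
proof -
  let ?I = "(\<integral>\<^sup>+x. indicator {x. norm x < 1} x * ennreal (\<bar>x \<bullet> e\<bar> powr p) \<partial>lborel)"
  define G where "G = Gamma ((real DIM('a) + p) / 2 + 1)"
  have G: "0 < G" unfolding G_def using p by (intro Gamma_real_pos) (simp add: add_nonneg_pos)
  define g where "g b t = (if b = e then \<bar>t\<bar> powr p else 1) * exp (- t\<^sup>2)" for b :: 'a and t :: real
  have "ennreal G * ?I = (\<integral>\<^sup>+x. ennreal (\<bar>x \<bullet> e\<bar> powr p * exp (- (norm x)\<^sup>2)) \<partial>lborel)"
    unfolding G_def by (rule gaussian_layer_cake[OF p, symmetric]) (auto simp: abs_mult powr_mult)
  also have "\<dots> = (\<integral>\<^sup>+x. (\<Prod>b\<in>Basis. ennreal (g b (x \<bullet> b))) \<partial>lborel)"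
  proof (rule nn_integral_cong)
    fix x :: 'a
    have "(\<Prod>b\<in>Basis. g b (x \<bullet> b)) = (\<Prod>b\<in>Basis. if b = e then \<bar>x \<bullet> b\<bar> powr p else 1) * (\<Prod>b\<in>Basis. exp (- (x \<bullet> b)\<^sup>2))"
      unfolding g_def by (rule prod.distrib)
    also have "(\<Prod>b\<in>Basis. if b = e then \<bar>x \<bullet> b\<bar> powr p else 1) = \<bar>x \<bullet> e\<bar> powr p"
      using e by simp
    also have "(\<Prod>b\<in>Basis. exp (- (x \<bullet> b)\<^sup>2)) = exp (- (norm x)\<^sup>2)"
    proof -
      have "(norm x)\<^sup>2 = (\<Sum>b\<in>Basis. (x \<bullet> b)\<^sup>2)"
        by (subst power2_norm_eq_inner, subst euclidean_inner) (simp add: power2_eq_square)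
      then show ?thesis by (simp add: exp_sum[symmetric] sum_negf)
    qed
    finally show "ennreal (\<bar>x \<bullet> e\<bar> powr p * exp (- (norm x)\<^sup>2)) = (\<Prod>b\<in>Basis. ennreal (g b (x \<bullet> b)))"
      by (subst prod_ennreal) (auto simp: g_def)
  qed
  also have "\<dots> = (\<Prod>b\<in>Basis. \<integral>\<^sup>+t. ennreal (g b t) \<partial>lborel)"
    by (rule nn_integral_lborel_prod) (auto simp: g_def[abs_def])
  also have "\<dots> = (\<Prod>b\<in>Basis. ennreal (if b = e then Gamma ((p + 1) / 2) else sqrt pi))"
  proof (rule prod.cong[OF refl])
    fix b :: 'a
    \<comment> \<open>\<open>0 powr 0\<close> is 0, so the two integrands differ at t = 0 and agree
      only almost everywhere.\<close>
    have "(\<integral>\<^sup>+t. ennreal (exp (- t\<^sup>2)) \<partial>lborel) = (\<integral>\<^sup>+t. ennreal (\<bar>t\<bar> powr 0 * exp (- t\<^sup>2)) \<partial>lborel)"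
      using AE_lborel_singleton[of "0::real"] by (intro nn_integral_cong_AE) (auto elim!: eventually_mono)
    also have "\<dots> = ennreal (sqrt pi)" by (subst gaussian_moment) (auto simp: Gamma_one_half_real)
    finally show "(\<integral>\<^sup>+t. ennreal (g b t) \<partial>lborel) = ennreal (if b = e then Gamma ((p + 1) / 2) else sqrt pi)"
      by (simp add: g_def gaussian_moment[OF p])
  qed
  also have "\<dots> = ennreal (\<Prod>b\<in>Basis. if b = e then Gamma ((p + 1) / 2) else sqrt pi)"
    using p by (intro prod_ennreal) (auto intro: Gamma_real_nonneg)
  also have "(\<Prod>b\<in>Basis. if b = e then Gamma ((p + 1) / 2) else sqrt pi) = Gamma ((p + 1) / 2) * (\<Prod>b\<in>Basis - {e}. sqrt pi)"
    using e by (subst prod.remove[of _ e]) (auto intro!: prod.cong)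
  also have "(\<Prod>b\<in>Basis - {e}. sqrt pi) = pi powr ((real DIM('a) - 1) / 2)"
  proof -
    have "(\<Prod>b\<in>Basis - {e}. sqrt pi) = sqrt pi ^ (DIM('a) - 1)" using e by simp
    also have "\<dots> = (pi powr (1 / 2)) powr real (DIM('a) - 1)"
      using powr_realpow[of "sqrt pi" "DIM('a) - 1"] by (simp only: powr_half_sqrt pi_ge_zero real_sqrt_gt_zero pi_gt_zero)
    also have "\<dots> = pi powr ((real DIM('a) - 1) / 2)"
      by (simp add: powr_powr of_nat_diff Suc_leI)
    finally show ?thesis .
  qed
  finally have "ennreal (1 / G) * (ennreal G * ?I) = ennreal (1 / G) * ennreal (Gamma ((p + 1) / 2) * pi powr ((real DIM('a) - 1) / 2))"
    by simp
  then show ?thesis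
    using G by (simp add: mult.assoc[symmetric] ball_moment_def G_def flip: ennreal_mult')
qed

text \<open>Rotation invariance: an orthogonal map carries x to a multiple of a basis vector, where
  the moment is known.\<close>

lemma centroid_norm_ball:
  fixes x :: "real^'n"
  assumes p: "1 \<le> p"
  shows "centroid_norm p norm x = ball_moment (real CARD('n)) p powr (1 / p) * norm x"
proof -
  let ?h = "centroid_norm p (norm :: real^'n \<Rightarrow> real)"
  have h: "is_norm ?h" by (rule is_norm_centroid_norm[OF is_norm_norm p])
  define e :: "real^'n" where "e = axis undefined 1"
  have e: "e \<in> Basis" "norm e = 1" by (auto simp: e_def Basis_vec_def)
  have "ennreal (?h e powr p) = ennreal (ball_moment (real CARD('n)) p)"
    using nn_integral_ball_axis[of p e] p e by (simp add: centroid_norm_ennreal[OF is_norm_norm p])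
  then have "?h e powr p = ball_moment (real CARD('n)) p"
    using ball_moment_pos[of "real CARD('n)" p] p by simp
  then have he: "?h e = ball_moment (real CARD('n)) p powr (1 / p)"
    using p is_norm_nonneg[OF h, of e] by (auto simp: powr_powr simp flip: \<open>?h e powr p = _\<close>)
  obtain f where f: "orthogonal_transformation f" "f x = norm x *\<^sub>R e"
    using orthogonal_transformation_exists[of x "norm x *\<^sub>R e"] e by auto
  have lin: "linear f" using f(1) by (rule orthogonal_transformation_linear)
  define A where "A = transpose (matrix f)"
  have om: "orthogonal_matrix A"
    using f(1) unfolding A_def orthogonal_matrix_transpose by (simp add: orthogonal_transformation_matrix)
  then have dA: "\<bar>det A\<bar> = 1" using det_orthogonal_matrix by fastforce
  have "orthogonal_transformation ((*v) A)" using om by (simp add: orthogonal_transformation_matrix)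
  then have nA: "norm (A *v y) = norm y" for y by (rule orthogonal_transformation_norm)
  have "transpose A *v x = norm x *\<^sub>R e" using f(2) lin by (simp add: A_def matrix_works)
  then have "?h (norm x *\<^sub>R e) = ?h x"
    using centroid_norm_matrix[OF is_norm_norm _ p, of A x] dA by (simp add: nA)
  then show ?thesis by (simp add: is_norm_scale[OF h] he mult.commute)
qed

lemma dual_norm_scaled_norm:
  fixes z :: "'a::euclidean_space"
  assumes m: "0 < m"
  shows "dual_norm (\<lambda>x. m * norm x) z = norm z / m"
proof -
  have h: "is_norm (\<lambda>x::'a. m * norm x)" by (rule is_norm_cmult[OF is_norm_norm m])
  have iff: "dual_norm (\<lambda>x. m * norm x) z \<le> r \<longleftrightarrow> norm z / m \<le> r" if r: "0 \<le> r" for r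
  proof -
    have "dual_norm (\<lambda>x. m * norm x) z \<le> r \<longleftrightarrow> (\<forall>x. x \<bullet> z \<le> r * (m * norm x))" by (rule dual_norm_le_iff[OF h r])
    also have "\<dots> \<longleftrightarrow> norm z \<le> r * m"
    proof
      assume *: "\<forall>x. x \<bullet> z \<le> r * (m * norm x)"
      show "norm z \<le> r * m"
      proof (cases "z = 0")
        case False
        have "norm z * norm z \<le> (r * m) * norm z" using *[rule_format, of z] by (simp add: dot_square_norm power2_eq_square mult.assoc)
        then show ?thesis using False by simp
      qed (use r m in simp)
    next
      assume *: "norm z \<le> r * m"
      show "\<forall>x. x \<bullet> z \<le> r * (m * norm x)"
      proof
        fix x
        have "x \<bullet> z \<le> norm x * norm z" by (rule norm_cauchy_schwarz)
        also have "\<dots> \<le> norm x * (r * m)" using * by (intro mult_left_mono) auto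
        finally show "x \<bullet> z \<le> r * (m * norm x)" by (simp add: mult_ac)
      qed
    qed
    finally show ?thesis using m by (simp add: field_simps)
  qed
  show ?thesis
    using iff[of "norm z / m"] iff[of "dual_norm (\<lambda>x. m * norm x) z"] m dual_norm_nonneg[OF h, of z] by auto
qed

section \<open>Identities between \<open>omega\<close>, \<open>a1\<close> and ball moments\<close>

lemma omega_pos: "-2 < k \<Longrightarrow> 0 < omega k"
  unfolding omega_def by (intro divide_pos_pos Gamma_real_pos) auto

lemma ubvol_norm: "ubvol (norm :: real^'n \<Rightarrow> real) = omega (real CARD('n))"
proof -
  have "{x :: real^'n. norm x < 1} = ball 0 1" by auto
  then have "ubvol (norm :: real^'n \<Rightarrow> real) = unit_ball_vol (real CARD('n))"
    by (simp add: ubvol_def content_ball)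
  then show ?thesis by (simp add: unit_ball_vol_def omega_def)
qed

text \<open>Identifies \<open>a1\<close> as the mean of |x.e|^p over the unit ball, for a unit
  vector e.\<close>

lemma a1_ball_moment:
  assumes n: "0 < n" and p: "1 \<le> p"
  shows "a1 n p = ball_moment n p / omega n"
proof -
  have "omega 2 = pi" using Gamma_fact[of 1, where 'a=real] by (simp add: omega_def)
  have "pi powr ((n - 1) / 2) * (pi * pi powr ((p - 1) / 2)) = pi powr ((n + p) / 2)"
  proof -
    have "pi powr ((n - 1) / 2) * (pi powr 1 * pi powr ((p - 1) / 2)) = pi powr ((n + p) / 2)"
      unfolding powr_add[symmetric] by (rule arg_cong[of _ _ "(powr) pi"]) (simp add: field_simps)
    then show ?thesis by simp
  qed
  then have e: "pi powr ((n + p) / 2) / (pi * pi powr ((p - 1) / 2)) = pi powr ((n - 1) / 2)"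
    by (metis nonzero_mult_div_cancel_right pi_neq_zero powr_eq_0_iff mult_eq_0_iff)
  have g: "(p - 1) / 2 + 1 = (p + 1) / 2" by (simp add: field_simps)
  have "a1 n p = (pi powr ((n + p) / 2) / (pi * pi powr ((p - 1) / 2))) * Gamma ((p + 1) / 2) / Gamma ((n + p) / 2 + 1) / omega n"
    unfolding a1_def \<open>omega 2 = pi\<close> by (simp add: omega_def[of "n + p"] omega_def[of "p - 1"] g)
  then show ?thesis unfolding e by (simp add: ball_moment_def mult.commute)
qed

text \<open>Both sides are the integral of |xi.e|^p over the unit sphere. The left side is the shape
  in which this quantity occurs in \<open>cnp\<close>.\<close>

lemma omega_ball_moment:
  assumes n: "1 \<le> n" and p: "1 < p"
  shows "2 * omega (n + p - 2) / omega (p - 1) = (n + p) * ball_moment n p"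
proof -
  have G: "Gamma ((n + p) / 2 + 1) = (n + p) / 2 * Gamma ((n + p) / 2)"
    using n p by (intro Gamma_plus1) (auto simp: nonpos_Ints_def field_simps)
  have "pi powr ((n + p - 2) / 2) = pi powr ((n - 1) / 2) * pi powr ((p - 1) / 2)"
    unfolding powr_add[symmetric] by (rule arg_cong[of _ _ "(powr) pi"]) (simp add: field_simps)
  moreover have e: "(p - 1) / 2 + 1 = (p + 1) / 2" "(n + p - 2) / 2 + 1 = (n + p) / 2" by (simp_all add: field_simps)
  ultimately have o1: "omega (n + p - 2) = pi powr ((n - 1) / 2) * pi powr ((p - 1) / 2) / Gamma ((n + p) / 2)"
    by (simp only: omega_def)
  have o2: "omega (p - 1) = pi powr ((p - 1) / 2) / Gamma ((p + 1) / 2)"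
    by (simp only: omega_def e)
  have bm: "ball_moment n p = Gamma ((p + 1) / 2) * pi powr ((n - 1) / 2) / ((n + p) / 2 * Gamma ((n + p) / 2))"
    by (simp only: ball_moment_def G)
  have "0 < Gamma ((n + p) / 2)" "0 < Gamma ((p + 1) / 2)" using n p by (auto intro!: Gamma_real_pos)
  moreover have "0 < pi powr ((p - 1) / 2)" by simp
  moreover have "2 * (a * b / g) / (b / c) = s * (c * a / (s / 2 * g))"
    if "0 < g" "0 < c" "0 < b" "0 < s" for a b c g s :: real
    using that by (simp add: field_simps)
  ultimately show ?thesis unfolding o1 o2 bm using n p by simp
qed

text \<open>The power -p/n is the one with which the volume of K_f enters the inequality. For the
  ball, the centroid body is a ball of radius k^(1/p) with k the ball moment, and the powers of
  \<open>omega\<close> combine to exponent 1.\<close>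

lemma centroid_ratio_norm:
  assumes p: "1 \<le> p"
  shows "centroid_ratio p (norm :: real^'n \<Rightarrow> real) powr (- p / real CARD('n)) = 1 / a1 (real CARD('n)) p"
proof -
  define n where "n = real CARD('n)"
  have n: "1 \<le> n" by (simp add: n_def)
  define k where "k = ball_moment n p"
  have k: "0 < k" unfolding k_def using n p by (intro ball_moment_pos) auto
  define m where "m = k powr (1 / p)"
  have m: "0 < m" using k by (simp add: m_def)
  have w: "0 < omega n" using n by (intro omega_pos) simp
  have h: "centroid_norm p (norm :: real^'n \<Rightarrow> real) = (\<lambda>x. m * norm x)"
    using centroid_norm_ball[OF p] by (auto simp: m_def k_def n_def)
  have "dual_norm (\<lambda>x::real^'n. m * norm x) = (\<lambda>z. inverse m * norm z)"
    using dual_norm_scaled_norm[OF m] by (auto simp: divide_inverse mult.commute)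
  then have "centroid_vol p (norm :: real^'n \<Rightarrow> real) = omega n * m ^ CARD('n)"
    using m by (simp add: centroid_vol_def h ubvol_cmult[OF is_norm_norm] ubvol_norm n_def power_inverse divide_inverse)
  also have "m ^ CARD('n) = k powr (n / p)"
    using k by (simp add: m_def n_def powr_powr flip: powr_realpow)
  finally have "centroid_ratio p (norm :: real^'n \<Rightarrow> real) = omega n * k powr (n / p) * omega n powr (- (n + p) / p)"
    by (simp add: centroid_ratio_def ubvol_norm n_def)
  then have "centroid_ratio p (norm :: real^'n \<Rightarrow> real) powr (- p / n)
      = omega n powr (- p / n) * (k powr (n / p)) powr (- p / n) * (omega n powr (- (n + p) / p)) powr (- p / n)"
    using w by (simp add: powr_mult)
  also have "(k powr (n / p)) powr (- p / n) = k powr (- 1)" using n p by (simp add: powr_powr)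
  also have "(omega n powr (- (n + p) / p)) powr (- p / n) = omega n powr ((n + p) / n)"
  proof -
    have "- (n + p) / p * (- p / n) = (n + p) / n" using n p by (simp add: divide_simps)
    then show ?thesis by (simp only: powr_powr)
  qed
  also have "omega n powr (- p / n) * k powr (- 1) * omega n powr ((n + p) / n)
      = k powr (- 1) * omega n powr (- p / n + (n + p) / n)" by (simp only: powr_add mult_ac)
  also have "- p / n + (n + p) / n = 1" using n by (simp add: field_simps)
  also have "k powr (- 1) * omega n powr 1 = 1 / a1 n p"
    using a1_ball_moment[of n p] n p k w by (simp add: k_def powr_minus divide_inverse)
  finally show ?thesis by (simp add: n_def)
qed

subsection \<open>Spherical integrals attached to a norm\<close>

context
  fixes N :: "real^'n \<Rightarrow> real" and p :: real
  assumes N: "is_norm N" and p: "1 \<le> p"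
begin

lemma sphere_integral_ubvol:
  "sphere_integral (\<lambda>\<xi>. N \<xi> powr (- real CARD('n))) = real CARD('n) * ubvol N"
proof -
  have "sphere_integral (\<lambda>\<xi>. N \<xi> powr (- real CARD('n) - 0) * 1)
      = (real CARD('n) + 0) * enn2real (\<integral>\<^sup>+x. indicator {x. N x < 1} x * ennreal 1 \<partial>lborel)"
    by (rule sphere_integral_polar[OF N]) auto
  also have "(\<integral>\<^sup>+x. indicator {x. N x < 1} x * ennreal 1 \<partial>lborel) = ennreal (ubvol N)"
    using is_norm_ball_measurable[OF N, of 1] by (simp add: ubvol_emeasure[OF N])
  finally show ?thesis using ubvol_pos[OF N] by simp
qed

lemma sphere_integral_centroid:
  "sphere_integral (\<lambda>\<xi>. N \<xi> powr (- real CARD('n) - p) * \<bar>x \<bullet> \<xi>\<bar> powr p)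
    = (real CARD('n) + p) * centroid_norm p N x powr p"
proof -
  have "sphere_integral (\<lambda>\<xi>. N \<xi> powr (- real CARD('n) - p) * \<bar>x \<bullet> \<xi>\<bar> powr p)
      = (real CARD('n) + p) * enn2real (\<integral>\<^sup>+y. indicator {x. N x < 1} y * ennreal (\<bar>x \<bullet> y\<bar> powr p) \<partial>lborel)"
    using p by (intro sphere_integral_polar[OF N]) (auto simp: abs_mult powr_mult)
  also have "(\<integral>\<^sup>+y. indicator {x. N x < 1} y * ennreal (\<bar>x \<bullet> y\<bar> powr p) \<partial>lborel) = ennreal (centroid_norm p N x powr p)"
    by (simp add: centroid_norm_ennreal[OF N p] inner_commute)
  finally show ?thesis by simp
qed

text \<open>With the weight N^p the powers of N on the sphere combine to exponent -n, the integrand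
  that computes the volume; both sides are one spherical integral.\<close>

lemma nn_integral_norm_power:
  "ennreal (real CARD('n) + p) * (\<integral>\<^sup>+x. indicator {x. N x < 1} x * ennreal (N x powr p) \<partial>lborel)
    = ennreal (real CARD('n) * ubvol N)"
proof -
  have m: "N \<in> borel_measurable borel" by (rule is_norm_measurable[OF N])
  let ?n = "real DIM(real^'n)"
  have "ennreal (?n + p) * (\<integral>\<^sup>+x. indicator {x. N x < 1} x * ennreal (N x powr p) \<partial>lborel)
      = ennreal ?n * (\<integral>\<^sup>+y. indicator (ball 0 1) y * ennreal (N (y /\<^sub>R norm y) powr (- ?n - p) * N (y /\<^sub>R norm y) powr p) \<partial>lborel)"
    using p m by (intro polar_integral[OF N, symmetric]) (auto simp: is_norm_scale[OF N] powr_mult is_norm_nonneg[OF N])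
  also have "\<dots> = ennreal ?n * (\<integral>\<^sup>+y. indicator (ball 0 1) y * ennreal (N (y /\<^sub>R norm y) powr (- ?n - 0) * 1) \<partial>lborel)"
    unfolding powr_add[symmetric] by simp
  also have "\<dots> = ennreal (?n + 0) * (\<integral>\<^sup>+x. indicator {x. N x < 1} x * ennreal 1 \<partial>lborel)"
    by (rule polar_integral[OF N]) auto
  also have "\<dots> = ennreal (real CARD('n) * ubvol N)"
    using is_norm_ball_measurable[OF N, of 1] by (simp add: ubvol_emeasure[OF N] ennreal_mult')
  finally show ?thesis by simp
qed

end

text \<open>\<open>ubvol\<close> is defined by open balls whereas K_f is closed, so the closed ball
  is squeezed between the open ball of the same radius and slightly larger open balls.\<close>

lemma measure_norm_cball:
  fixes N :: "real^'n \<Rightarrow> real"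
  assumes N: "is_norm N" and r: "0 < r"
  shows "measure lebesgue {x. N x \<le> r} = r ^ CARD('n) * ubvol N"
proof -
  have cl: "closed {x. N x \<le> r}" using is_norm_cball_compact[OF N] by (rule compact_imp_closed)
  have open_vol: "measure lborel {x. N x < s} = s ^ CARD('n) * ubvol N" if s: "0 < s" for s
  proof -
    have "{x. N x < s} = {x. inverse s * N x < 1}" using s by (auto simp: field_simps)
    then show ?thesis
      using ubvol_cmult[OF N, of "inverse s"] s by (simp add: ubvol_def power_inverse divide_inverse mult.commute)
  qed
  have fin: "emeasure lborel {x. N x < s} \<noteq> \<infinity>" for s using is_norm_ball_finite[OF N, of s] by simp
  have le: "measure lborel {x. N x \<le> r} \<le> s ^ CARD('n) * ubvol N" if s: "r < s" for s
  proof -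
    have "measure lborel {x. N x \<le> r} \<le> measure lborel {x. N x < s}"
      using s cl fin is_norm_ball_measurable[OF N] by (intro measure_mono_fmeasurable) (auto simp: fmeasurable_def less_top)
    then show ?thesis using open_vol[of s] r s by simp
  qed
  have "measure lborel {x. N x \<le> r} \<le> r ^ CARD('n) * ubvol N"
  proof (rule tendsto_lowerbound)
    show "((\<lambda>s. s ^ CARD('n) * ubvol N) \<longlongrightarrow> r ^ CARD('n) * ubvol N) (at_right r)" by (intro tendsto_intros)
    show "eventually (\<lambda>s. measure lborel {x. N x \<le> r} \<le> s ^ CARD('n) * ubvol N) (at_right r)"
      using eventually_at_right_less[of r] by eventually_elim (rule le)
  qed simp
  moreover have "r ^ CARD('n) * ubvol N \<le> measure lborel {x. N x \<le> r}"
  proof -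
    have "emeasure lborel {x. N x \<le> r} < \<infinity>"
      using is_norm_cball_compact[OF N] by (intro emeasure_bounded_finite compact_imp_bounded)
    then have "measure lborel {x. N x < r} \<le> measure lborel {x. N x \<le> r}"
      using cl is_norm_ball_measurable[OF N] by (intro measure_mono_fmeasurable) (auto simp: fmeasurable_def)
    then show ?thesis using open_vol[OF r] by simp
  qed
  ultimately show ?thesis using cl by (simp add: measure_completion)
qed

section \<open>The norm attached to a smooth function\<close>

lemma grad_eqI: "GDERIV f x :> D \<Longrightarrow> grad f x = D"
proof -
  assume D: "GDERIV f x :> D"
  have unique: "E = D" if E: "GDERIV f x :> E" for E
  proof -
    have "(\<lambda>h. h \<bullet> E) = (\<lambda>h. h \<bullet> D)"
      using D E unfolding gderiv_def by (rule has_derivative_unique[rotated])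
    then have "\<forall>h. h \<bullet> E = h \<bullet> D" by (auto dest: fun_cong)
    then show ?thesis by (simp only: vector_eq_ldot)
  qed
  show ?thesis unfolding grad_def by (rule the_equality) (fact D, fact unique)
qed

lemma GDERIV_grad:
  fixes f :: "real^'n \<Rightarrow> real"
  assumes "f differentiable (at x)"
  shows "GDERIV f x :> grad f x"
proof -
  let ?F = "frechet_derivative f (at x)"
  have F: "(f has_derivative ?F) (at x)" using assms by (simp add: frechet_derivative_works)
  have lin: "linear ?F" using F by (rule has_derivative_linear)
  define D :: "real^'n" where "D = (\<chi> i. ?F (axis i 1))"
  have "?F h = h \<bullet> D" for h
  proof -
    have "?F h = ?F (\<Sum>i\<in>UNIV. h $ i *\<^sub>R axis i 1)"
      by (simp only: basis_expansion flip: scalar_mult_eq_scaleR)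
    also have "\<dots> = (\<Sum>i\<in>UNIV. h $ i * ?F (axis i 1))"
      by (simp add: linear_sum[OF lin] linear_scale[OF lin])
    finally show ?thesis by (simp add: inner_vec_def D_def)
  qed
  then have Feq: "?F = (\<lambda>h. h \<bullet> D)" by auto
  have "GDERIV f x :> D" using F unfolding gderiv_def Feq .
  then show ?thesis by (simp add: grad_eqI)
qed

lemma grad_matrix_compose:
  fixes f :: "real^'n \<Rightarrow> real" and A :: "real^'n^'n"
  assumes "f differentiable (at (A *v x))"
  shows "grad (\<lambda>y. f (A *v y)) x = transpose A *v grad f (A *v x)"
proof (rule grad_eqI)
  have adj: "(A *v h) \<bullet> w = h \<bullet> (w v* A)" for h w by (metis dot_lmul_matrix inner_commute)
  have "(f has_derivative (\<lambda>h. h \<bullet> grad f (A *v x))) (at (A *v x))"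
    using GDERIV_grad[OF assms] by (simp add: gderiv_def)
  moreover have "((*v) A has_derivative (*v) A) (at x)"
    by (intro bounded_linear_imp_has_derivative matrix_vector_mul_bounded_linear)
  ultimately have "((\<lambda>y. f (A *v y)) has_derivative (\<lambda>h. (A *v h) \<bullet> grad f (A *v x))) (at x)"
    by (rule has_derivative_compose[rotated])
  then show "GDERIV (\<lambda>y. f (A *v y)) x :> transpose A *v grad f (A *v x)"
    unfolding gderiv_def by (simp add: adj)
qed

context
  fixes f :: "real^'n \<Rightarrow> real" and p :: real
  assumes p: "1 \<le> p" and smooth: "smooth f" and supp: "compact (closure {x. f x \<noteq> 0})" and nz: "f \<noteq> (\<lambda>x. 0)"
begin

lemma smooth_differentiable: "f differentiable (at x)"
proof -
  have "higher_differentiable_on UNIV f (Suc 0)" using smooth unfolding smooth_def by blast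
  then show ?thesis by simp
qed

lemma grad_continuous: "continuous_on UNIV (grad f)"
proof -
  have "higher_differentiable_on UNIV f (Suc 0)" using smooth unfolding smooth_def by blast
  then have c: "continuous_on UNIV (\<lambda>x. frechet_derivative f (at x) v)" for v by simp
  have "frechet_derivative f (at x) v = v \<bullet> grad f x" for x v
    using frechet_derivative_at[OF GDERIV_grad[OF smooth_differentiable, unfolded gderiv_def]] by metis
  then have "continuous_on UNIV (\<lambda>x. axis i 1 \<bullet> grad f x)" for i using c[of "axis i 1"] by simp
  then have "continuous_on UNIV (\<lambda>x. \<chi> i. grad f x $ i)"
    by (intro continuous_on_vec_lambda) (simp add: inner_axis')
  then show ?thesis by simp
qed

lemma grad_measurable: "grad f \<in> borel_measurable borel"
  using grad_continuous by (rule borel_measurable_continuous_onI)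

lemma grad_outside_support:
  assumes "x \<notin> closure {x. f x \<noteq> 0}"
  shows "grad f x = 0"
proof (rule grad_eqI)
  let ?U = "- closure {x. f x \<noteq> 0}"
  have "((\<lambda>_. 0) has_derivative (\<lambda>_. 0)) (at x)" by simp
  then have "(f has_derivative (\<lambda>_. 0)) (at x)"
  proof (rule has_derivative_transform_within_open[of _ _ _ _ ?U])
    show "0 = f y" if "y \<in> ?U" for y using that closure_subset[of "{x. f x \<noteq> 0}"] by auto
  qed (use assms in auto)
  then show "GDERIV f x :> 0" by (simp add: gderiv_def)
qed

lemma dir_grad_eq_lp: "dir_grad_norm p f = lp_functional lborel (grad f) p"
  by (auto simp: dir_grad_norm_def lp_functional_def)

lemma grad_powr_continuous: "continuous_on UNIV (\<lambda>x. \<bar>grad f x \<bullet> \<xi>\<bar> powr p)"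
  using p by (intro continuous_on_powr' continuous_intros grad_continuous) auto

lemma grad_powr_integrable: "integrable lborel (\<lambda>x. \<bar>grad f x \<bullet> \<xi>\<bar> powr p)"
proof -
  let ?S = "closure {x. f x \<noteq> 0}"
  have "integrable lborel (\<lambda>x. indicator ?S x *\<^sub>R (\<bar>grad f x \<bullet> \<xi>\<bar> powr p))"
    by (intro borel_integrable_compact supp continuous_on_subset[OF grad_powr_continuous]) auto
  moreover have "indicator ?S x *\<^sub>R (\<bar>grad f x \<bullet> \<xi>\<bar> powr p) = \<bar>grad f x \<bullet> \<xi>\<bar> powr p" for x
    using grad_outside_support[of x] by (auto simp: indicator_def)
  ultimately show ?thesis by (simp only:)
qed

text \<open>If the norm vanished at some nonzero vector, the derivative in that direction would
  vanish almost everywhere, hence everywhere by continuity. Then f is constant on parallel lines,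
  all of which leave the compact support, so f is zero.\<close>

lemma is_norm_dir_grad_norm: "is_norm (dir_grad_norm p f)"
  unfolding dir_grad_eq_lp
proof (rule is_norm_lp_functional[OF p grad_powr_integrable])
  fix \<xi> :: "real^'n" assume \<xi>: "\<xi> \<noteq> 0"
  show "(\<integral>x. \<bar>grad f x \<bullet> \<xi>\<bar> powr p \<partial>lborel) \<noteq> 0"
  proof
    assume 0: "(\<integral>x. \<bar>grad f x \<bullet> \<xi>\<bar> powr p \<partial>lborel) = 0"
    then have ae: "AE x in lborel. \<bar>grad f x \<bullet> \<xi>\<bar> powr p = 0"
      using integral_nonneg_eq_0_iff_AE[OF grad_powr_integrable] by simp
    let ?U = "{x. grad f x \<bullet> \<xi> \<noteq> 0}"
    have o: "open ?U"
    proof -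
      have "?U = (\<lambda>x. grad f x \<bullet> \<xi>) -` (- {0})" by auto
      moreover have "continuous_on UNIV (\<lambda>x. grad f x \<bullet> \<xi>)" by (intro continuous_intros grad_continuous)
      ultimately show ?thesis by (metis open_vimage open_Compl closed_singleton)
    qed
    have "AE x in lborel. \<not> grad f x \<bullet> \<xi> \<noteq> 0" using ae by eventually_elim simp
    then have "emeasure lborel ?U = 0" using o by (subst (asm) AE_iff_measurable[of ?U]) auto
    then have "?U = {}" by (rule open_null_empty[OF o])
    then have g0: "grad f x \<bullet> \<xi> = 0" for x by auto
    have "f x = 0" for x
    proof -
      have der: "((\<lambda>t. f (x + t *\<^sub>R \<xi>)) has_real_derivative 0) (at t)" for t
      proof -
        have "(f has_derivative (\<lambda>h. h \<bullet> grad f (x + t *\<^sub>R \<xi>))) (at (x + t *\<^sub>R \<xi>))"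
          using GDERIV_grad[OF smooth_differentiable] by (simp add: gderiv_def)
        moreover have "((\<lambda>t. x + t *\<^sub>R \<xi>) has_derivative (\<lambda>s. s *\<^sub>R \<xi>)) (at t)"
          by (auto intro!: derivative_eq_intros)
        ultimately have "((\<lambda>t. f (x + t *\<^sub>R \<xi>)) has_derivative (\<lambda>s. (s *\<^sub>R \<xi>) \<bullet> grad f (x + t *\<^sub>R \<xi>))) (at t)"
          by (rule has_derivative_compose[rotated])
        then show ?thesis by (simp add: has_field_derivative_def inner_commute[of \<xi>] g0 flip: lambda_zero)
      qed
      obtain B where B: "\<And>y. y \<in> closure {x. f x \<noteq> 0} \<Longrightarrow> norm y \<le> B"
        using compact_imp_bounded[OF supp] by (auto simp: bounded_iff)
      define t where "t = (\<bar>B\<bar> + norm x + 1) / norm \<xi>"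
      have "norm (t *\<^sub>R \<xi>) = \<bar>B\<bar> + norm x + 1" using \<xi> by (simp add: t_def)
      then have "B < norm (x + t *\<^sub>R \<xi>)"
        using norm_triangle_ineq[of "x + t *\<^sub>R \<xi>" "- x"] by simp
      then have "x + t *\<^sub>R \<xi> \<notin> closure {x. f x \<noteq> 0}" using B[of "x + t *\<^sub>R \<xi>"] by linarith
      then have "f (x + t *\<^sub>R \<xi>) = 0" using closure_subset[of "{x. f x \<noteq> 0}"] by auto
      moreover have "f (x + t *\<^sub>R \<xi>) = f (x + 0 *\<^sub>R \<xi>)" using DERIV_isconst_all[of "\<lambda>t. f (x + t *\<^sub>R \<xi>)" t 0] der by blast
      ultimately show ?thesis by simp
    qed
    then show False using nz by auto
  qed
qed

lemma nn_integral_grad_inner: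
  "(\<integral>\<^sup>+x. ennreal (\<bar>grad f x \<bullet> \<xi>\<bar> powr p) \<partial>lborel) = ennreal (dir_grad_norm p f \<xi> powr p)"
  using nn_integral_eq_integral[OF grad_powr_integrable] p by (simp add: dir_grad_eq_lp lp_functional_powr)

lemma Zp_eq: "Zp p f = (real CARD('n) * ubvol (dir_grad_norm p f)) powr (- 1 / real CARD('n))"
  by (simp add: Zp_def sphere_integral_ubvol[OF is_norm_dir_grad_norm p])

lemma Cstar_eq: "Cstar p f x = (real CARD('n) + p) * centroid_norm p (dir_grad_norm p f) x powr p"
  unfolding Cstar_def by (rule sphere_integral_centroid[OF is_norm_dir_grad_norm p])

lemma integral_Cstar_grad:
  "(LINT x | lborel. Cstar p f (grad f x)) = real CARD('n) * ubvol (dir_grad_norm p f)"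
proof -
  let ?N = "dir_grad_norm p f" and ?n = "real CARD('n)"
  have N: "is_norm ?N" by (rule is_norm_dir_grad_norm)
  note [measurable] = is_norm_measurable[OF N] grad_measurable
  have hm: "centroid_norm p ?N \<in> borel_measurable borel"
    by (rule is_norm_measurable[OF is_norm_centroid_norm[OF N p]])
  have "(LINT x | lborel. Cstar p f (grad f x)) = enn2real (\<integral>\<^sup>+x. ennreal (Cstar p f (grad f x)) \<partial>lborel)"
  proof (rule integral_eq_nn_integral)
    show "(\<lambda>x. Cstar p f (grad f x)) \<in> borel_measurable lborel" unfolding Cstar_eq using hm by measurable
    show "AE x in lborel. 0 \<le> Cstar p f (grad f x)" unfolding Cstar_eq using p by auto
  qed
  also have "(\<integral>\<^sup>+x. ennreal (Cstar p f (grad f x)) \<partial>lborel)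
      = (\<integral>\<^sup>+x. ennreal (?n + p) * (\<integral>\<^sup>+y. indicator {y. ?N y < 1} y * ennreal (\<bar>y \<bullet> grad f x\<bar> powr p) \<partial>lborel) \<partial>lborel)"
    unfolding Cstar_eq centroid_norm_ennreal[OF N p, symmetric] using p by (intro nn_integral_cong ennreal_mult) auto
  also have "\<dots> = ennreal (?n + p) * (\<integral>\<^sup>+x. \<integral>\<^sup>+y. indicator {y. ?N y < 1} y * ennreal (\<bar>y \<bullet> grad f x\<bar> powr p) \<partial>lborel \<partial>lborel)"
    by (rule nn_integral_cmult) measurable
  also have "(\<integral>\<^sup>+x. \<integral>\<^sup>+y. indicator {y. ?N y < 1} y * ennreal (\<bar>y \<bullet> grad f x\<bar> powr p) \<partial>lborel \<partial>lborel)
      = (\<integral>\<^sup>+y. \<integral>\<^sup>+x. indicator {y. ?N y < 1} y * ennreal (\<bar>y \<bullet> grad f x\<bar> powr p) \<partial>lborel \<partial>lborel)"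
    by (rule lborel_pair.Fubini') measurable
  also have "\<dots> = (\<integral>\<^sup>+y. indicator {y. ?N y < 1} y * ennreal (?N y powr p) \<partial>lborel)"
  proof (rule nn_integral_cong)
    fix y
    have "(\<integral>\<^sup>+x. indicator {y. ?N y < 1} y * ennreal (\<bar>y \<bullet> grad f x\<bar> powr p) \<partial>lborel)
        = indicator {y. ?N y < 1} y * (\<integral>\<^sup>+x. ennreal (\<bar>y \<bullet> grad f x\<bar> powr p) \<partial>lborel)"
      by (rule nn_integral_cmult) measurable
    then show "(\<integral>\<^sup>+x. indicator {y. ?N y < 1} y * ennreal (\<bar>y \<bullet> grad f x\<bar> powr p) \<partial>lborel)
        = indicator {y. ?N y < 1} y * ennreal (?N y powr p)"
      by (simp add: nn_integral_grad_inner inner_commute[of y])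
  qed
  also have "ennreal (?n + p) * \<dots> = ennreal (?n * ubvol ?N)"
    by (rule nn_integral_norm_power[OF N p])
  finally show ?thesis using ubvol_pos[OF N] by simp
qed

end

section \<open>The affine inequality\<close>

text \<open>Young's inequality. The slope is the best possible: the line through the origin touches
  the graph of 1 + c a^p at a = ((p-1)c)^(-1/p).\<close>

lemma linear_le_one_plus_power:
  fixes p q c a y :: real
  assumes p: "1 < p" and q: "q = p / (p - 1)" and c: "0 < c" and a: "0 \<le> a"
  shows "q * ((p - 1) * c) powr (1 / p) * a \<le> 1 + c * a powr p"
proof -
  define b where "b = ((p - 1) * c) powr (1 / p) * a"
  have b: "0 \<le> b" using a by (simp add: b_def)
  have bp: "b powr p = (p - 1) * c * a powr p"
    using p c a by (simp add: b_def powr_mult powr_powr)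
  have "b * 1 \<le> b powr p / p + 1 powr q / q"
    using p b by (intro Youngs_inequality) (auto simp: q field_simps)
  then have "q * b \<le> q * (b powr p / p + 1 / q)"
    using p by (intro mult_left_mono) (auto simp: q)
  also have "\<dots> = 1 + c * a powr p"
    using p by (simp add: q bp divide_simps) (simp add: algebra_simps)
  finally show ?thesis by (simp add: b_def mult.assoc)
qed

text \<open>Changing the sign of one coordinate preserves the Euclidean norm and reverses
  orientation.\<close>

lemma exists_det_pos_ellipsoid:
  fixes C :: "real^'n^'n"
  assumes C: "det C \<noteq> 0" and N: "\<And>x. N (C *v x) = norm x"
  obtains C' :: "real^'n^'n" where "0 < det C'" "\<And>x. N (C' *v x) = norm x"
proof (cases "0 < det C")
  case True
  then show thesis using that N by blast
next
  case False
  define k :: 'n where "k = undefined"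
  define D :: "real^'n^'n" where "D = (\<chi> i j. if i = j then (if i = k then -1 else 1) else 0)"
  have "det D = (\<Prod>i\<in>UNIV. D $ i $ i)" by (rule det_diagonal) (simp add: D_def)
  also have "\<dots> = -1" by (simp add: D_def)
  finally have dD: "det D = -1" .
  have Dx: "(D *v x) $ i = (if i = k then - x $ i else x $ i)" for x i
    by (simp add: matrix_vector_mult_def D_def if_distrib[of "\<lambda>z. z * _"] cong: if_cong)
  have "norm (D *v x) = norm x" for x
    unfolding norm_eq_sqrt_inner inner_vec_def
    by (rule arg_cong[of _ _ sqrt], rule sum.cong) (auto simp: Dx)
  then show thesis
    using that[of "C ** D"] False C N by (simp add: det_mul dD flip: matrix_vector_mul_assoc)
qed

context
  fixes f :: "real^'n \<Rightarrow> real" and p :: real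
  assumes p: "1 < p" and smooth: "smooth f" and supp: "compact (closure {x. f x \<noteq> 0})" and nz: "f \<noteq> (\<lambda>x. 0)"
begin

text \<open>Membership in K_f means that x.z is at most 1 + c h(x)^p for all x. Along each ray the
  left side is linear, so only the tangent line through the origin matters; its slope is the
  dilation factor \<open>R\<close> between K_f and the body with support function h.\<close>

lemma measure_Kf:
  assumes q: "q = p / (p - 1)"
  shows "measure lebesgue (Kf p f)
    = (q * ((p - 1) * (real CARD('n) + p)) powr (1 / p)) ^ CARD('n) * centroid_vol p (dir_grad_norm p f)"
proof -
  let ?N = "dir_grad_norm p f"
  let ?h = "centroid_norm p ?N"
  have p1: "1 \<le> p" using p by simp
  have N: "is_norm ?N" by (rule is_norm_dir_grad_norm[OF p1 smooth supp nz])
  have h: "is_norm ?h" by (rule is_norm_centroid_norm[OF N p1])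
  define c where "c = real CARD('n) + p"
  have c: "0 < c" using p by (simp add: c_def add_nonneg_pos)
  define b where "b = ((p - 1) * c) powr (1 / p)"
  have b: "0 < b" using p c by (simp add: b_def)
  have bp: "b powr p = (p - 1) * c" using p c by (simp add: b_def powr_powr)
  define R where "R = q * b"
  have R: "0 < R" using p b by (simp add: R_def q)
  have "z \<in> Kf p f \<longleftrightarrow> dual_norm ?h z \<le> R" for z
  proof -
    have "z \<in> Kf p f \<longleftrightarrow> (\<forall>x. x \<bullet> z \<le> 1 + c * ?h x powr p)"
      unfolding Kf_def Cf_def Cstar_eq[OF p1 smooth supp nz] c_def
      by (simp add: SUP_le_iff one_ereal_def algebra_simps del: ereal_eq_1)
    also have "\<dots> \<longleftrightarrow> (\<forall>x. x \<bullet> z \<le> R * ?h x)"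
    proof safe
      fix x assume *: "\<forall>x. x \<bullet> z \<le> 1 + c * ?h x powr p"
      show "x \<bullet> z \<le> R * ?h x"
      proof (cases "x = 0")
        case True then show ?thesis by (simp add: is_norm_zero[OF h])
      next
        case False
        then have hx: "0 < ?h x" by (rule is_norm_pos[OF h])
        \<comment> \<open>Rescales x to the point of tangency, where h equals 1/b and 1 + c h^p
          equals q.\<close>
        define t where "t = 1 / (b * ?h x)"
        have t: "0 < t" using b hx by (simp add: t_def)
        have "?h (t *\<^sub>R x) = 1 / b" using b hx by (simp add: is_norm_scale[OF h] t_def)
        then have "c * ?h (t *\<^sub>R x) powr p = c / ((p - 1) * c)"
          using b by (simp add: powr_divide bp)
        also have "1 + \<dots> = q" using p c by (simp add: q field_simps)
        finally have "t * (x \<bullet> z) \<le> q" using *[rule_format, of "t *\<^sub>R x"] by simp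
        then show ?thesis using b hx by (simp add: t_def R_def field_simps)
      qed
    next
      fix x assume "\<forall>x. x \<bullet> z \<le> R * ?h x"
      then have "x \<bullet> z \<le> R * ?h x" by blast
      also have "\<dots> \<le> 1 + c * ?h x powr p"
        unfolding R_def b_def by (rule linear_le_one_plus_power[OF p q c is_norm_nonneg[OF h]])
      finally show "x \<bullet> z \<le> 1 + c * ?h x powr p" .
    qed
    also have "\<dots> \<longleftrightarrow> dual_norm ?h z \<le> R" using R by (intro dual_norm_le_iff[OF h, symmetric]) simp
    finally show ?thesis .
  qed
  then have "Kf p f = {z. dual_norm ?h z \<le> R}" by auto
  then have "measure lebesgue (Kf p f) = R ^ CARD('n) * centroid_vol p ?N"
    using measure_norm_cball[OF is_norm_dual_norm[OF h] R] by (simp only: centroid_vol_def)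
  then show ?thesis by (simp only: R_def b_def c_def)
qed

text \<open>Up to the factor \<open>ball_moment\<close>, |w|^p is the integral of |y.w|^p over y in
  the unit ball. Exchanging the integrals reduces the energy of f composed with C to the directional
  norms N(C y) = |y|.\<close>

lemma integral_grad_ellipsoid:
  fixes C :: "real^'n^'n"
  assumes C: "det C \<noteq> 0" and NC: "\<And>x. dir_grad_norm p f (C *v x) = norm x"
  shows "(LINT x | lborel. norm (grad (\<lambda>y. f (C *v y)) x) powr p)
    = real CARD('n) * omega (real CARD('n)) / ((real CARD('n) + p) * ball_moment (real CARD('n)) p * \<bar>det C\<bar>)"
proof -
  let ?n = "real CARD('n)"
  let ?k = "ball_moment ?n p"
  have p1: "1 \<le> p" using p by simp
  have k: "0 < ?k" using p by (intro ball_moment_pos) auto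
  note gm [measurable] = grad_measurable[OF p1 smooth supp nz]
  define G where "G x = transpose C *v grad f (C *v x)" for x
  have G: "grad (\<lambda>y. f (C *v y)) x = G x" for x
    unfolding G_def by (rule grad_matrix_compose[OF smooth_differentiable[OF p1 smooth supp nz]])
  have [measurable]: "G \<in> borel_measurable borel" unfolding G_def[abs_def] by measurable
  have [measurable]: "{x::real^'n. norm x < 1} \<in> sets borel" by measurable
  let ?X = "\<integral>\<^sup>+x. ennreal (norm (G x) powr p) \<partial>lborel"
  have adj: "y \<bullet> (w v* C) = w \<bullet> (C *v y)" for y w by (metis dot_lmul_matrix inner_commute)
  have kw: "ennreal ?k * ennreal (norm w powr p) = (\<integral>\<^sup>+y. indicator {y. norm y < 1} y * ennreal (\<bar>y \<bullet> w\<bar> powr p) \<partial>lborel)"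
    for w :: "real^'n"
    using k p1 by (simp add: centroid_norm_ennreal[OF is_norm_norm p1, symmetric] centroid_norm_ball[OF p1] powr_mult powr_powr ennreal_mult')
  have "ennreal \<bar>det C\<bar> * (ennreal ?k * ?X) = ennreal \<bar>det C\<bar> * (\<integral>\<^sup>+x. ennreal ?k * ennreal (norm (G x) powr p) \<partial>lborel)"
    by (subst nn_integral_cmult) auto
  also have "(\<integral>\<^sup>+x. ennreal ?k * ennreal (norm (G x) powr p) \<partial>lborel)
      = (\<integral>\<^sup>+x. \<integral>\<^sup>+y. indicator {y. norm y < 1} y * ennreal (\<bar>y \<bullet> G x\<bar> powr p) \<partial>lborel \<partial>lborel)"
    unfolding kw ..
  also have "\<dots> = (\<integral>\<^sup>+y. \<integral>\<^sup>+x. indicator {y. norm y < 1} y * ennreal (\<bar>y \<bullet> G x\<bar> powr p) \<partial>lborel \<partial>lborel)"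
    by (rule lborel_pair.Fubini') measurable
  also have "ennreal \<bar>det C\<bar> * \<dots> = (\<integral>\<^sup>+y. ennreal \<bar>det C\<bar> * (\<integral>\<^sup>+x. indicator {y. norm y < 1} y * ennreal (\<bar>y \<bullet> G x\<bar> powr p) \<partial>lborel) \<partial>lborel)"
    by (rule nn_integral_cmult[symmetric]) measurable
  also have "\<dots> = (\<integral>\<^sup>+y. indicator {y. norm y < 1} y * ennreal (norm (y :: real^'n) powr p) \<partial>lborel)"
  proof (rule nn_integral_cong)
    fix y :: "real^'n"
    have "ennreal \<bar>det C\<bar> * (\<integral>\<^sup>+x. indicator {y. norm y < 1} y * ennreal (\<bar>y \<bullet> G x\<bar> powr p) \<partial>lborel)
        = indicator {y. norm y < 1} y * (ennreal \<bar>det C\<bar> * (\<integral>\<^sup>+x. ennreal (\<bar>grad f (C *v x) \<bullet> (C *v y)\<bar> powr p) \<partial>lborel))"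
      by (subst nn_integral_cmult) (auto simp: G_def adj mult_ac)
    also have "ennreal \<bar>det C\<bar> * (\<integral>\<^sup>+x. ennreal (\<bar>grad f (C *v x) \<bullet> (C *v y)\<bar> powr p) \<partial>lborel)
        = (\<integral>\<^sup>+x. ennreal (\<bar>grad f x \<bullet> (C *v y)\<bar> powr p) \<partial>lborel)"
      by (rule nn_integral_matrix[OF C]) measurable
    also have "\<dots> = ennreal (norm y powr p)"
      by (simp add: nn_integral_grad_inner[OF p1 smooth supp nz] NC)
    finally show "ennreal \<bar>det C\<bar> * (\<integral>\<^sup>+x. indicator {y. norm y < 1} y * ennreal (\<bar>y \<bullet> G x\<bar> powr p) \<partial>lborel)
        = indicator {y. norm y < 1} y * ennreal (norm y powr p)" .
  qed
  finally have "ennreal (?n + p) * (ennreal \<bar>det C\<bar> * (ennreal ?k * ?X)) = ennreal (?n * omega ?n)"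
    by (simp only: nn_integral_norm_power[OF is_norm_norm p1] ubvol_norm)
  then have "enn2real (ennreal (?n + p) * (ennreal \<bar>det C\<bar> * (ennreal ?k * ?X))) = enn2real (ennreal (?n * omega ?n))"
    by (simp only:)
  then have "(?n + p) * (\<bar>det C\<bar> * (?k * enn2real ?X)) = ?n * omega ?n"
    using k p omega_pos[of ?n] by (simp add: enn2real_mult del: ennreal_plus)
  moreover have "(LINT x | lborel. norm (G x) powr p) = enn2real ?X"
    by (rule integral_eq_nn_integral) auto
  ultimately show ?thesis
    unfolding G using C k p by (simp add: divide_simps) (simp add: mult_ac)
qed

end

theorem mainTheorem9:
  fixes f :: "real^'n \<Rightarrow> real" and p q :: real
  assumes "p > 1" and "q = p / (p - 1)"
    and "smooth f" and "compact (closure {x. f x \<noteq> 0})" and "f \<noteq> (\<lambda>x. 0)"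
  defines "a2 \<equiv> ell p q * real CARD('n) powr ((real CARD('n) + p) / real CARD('n))
                 / (a1 (real CARD('n)) p * (real CARD('n) + p))"
  shows "measure lebesgue (Kf p f) powr (- p / real CARD('n)) * (LINT x | lborel. Cstar p f (grad f x))
           \<le> a2 * Zp p f powr p \<and>
         (measure lebesgue (Kf p f) powr (- p / real CARD('n)) * (LINT x | lborel. Cstar p f (grad f x))
           = a2 * Zp p f powr p \<longrightarrow>
         (\<exists>M :: real^'n^'n. invertible M \<and> det M > 0 \<and>
            Ep p f powr p = det M powr ((p - real CARD('n)) / real CARD('n)) *
              (LINT x | lborel. norm (grad (\<lambda>y. f (matrix_inv M *v y)) x) powr p)))"
proof -
  note f = assms(3,4,5)
  have p1: "1 \<le> p" using assms(1) by simp
  define n where "n = real CARD('n)"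
  have n: "1 \<le> n" by (simp add: n_def)
  let ?N = "dir_grad_norm p f"
  have N: "is_norm ?N" by (rule is_norm_dir_grad_norm[OF p1 f])
  define V W where "V = ubvol ?N" and "W = centroid_vol p ?N"
  have V: "0 < V" and W: "0 < W" using ubvol_pos[OF N] centroid_vol_pos[OF N p1] by (auto simp: V_def W_def)
  define ratio where "ratio = centroid_ratio p ?N"
  define ratio0 where "ratio0 = centroid_ratio p (norm :: real^'n \<Rightarrow> real)"
  have ratio: "ratio = W * V powr (- (n + p) / p)" by (simp add: ratio_def centroid_ratio_def W_def V_def n_def)
  have pos: "0 < ratio" "0 < ratio0"
    using centroid_vol_pos[OF N p1] ubvol_pos[OF N] centroid_vol_pos[OF is_norm_norm[where 'a="real^'n"] p1] ubvol_pos[OF is_norm_norm[where 'a="real^'n"]]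
    by (auto simp: ratio_def ratio0_def centroid_ratio_def intro!: mult_pos_pos)
  have r0: "ratio0 powr (- p / n) = 1 / a1 n p" unfolding ratio0_def n_def by (rule centroid_ratio_norm[OF p1])
  define b where "b = q * ((p - 1) * (n + p)) powr (1 / p)"
  have q: "1 < q" unfolding assms(2) using assms(1) by (simp add: less_divide_eq)
  have np: "0 < n + p" using n p1 by simp
  have b: "0 < b" using q np assms(1) by (simp add: b_def)
  \<comment> \<open>The factor common to both sides of the inequality, which become K times a power
    of the centroid ratio of N and of the ball respectively.\<close>
  define K where "K = ell p q / (n + p) * (n * V powr (- p / n))"
  have K: "0 < K" using q np n V assms(1) by (simp add: K_def ell_def)
  \<comment> \<open>This is where \<open>ell\<close> arises: it is the dilation factor of K_f raised
    to -p, by p/q = p - 1.\<close>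
  have bp: "b powr (- p) = ell p q / (n + p)"
  proof -
    have "b powr p = q powr p * ((p - 1) * (n + p))"
      using q np assms(1) by (simp add: b_def powr_mult powr_powr)
    also have "q powr p = q powr (p / q) * q powr 1"
    proof -
      have "p / q = p - 1" using assms(1) by (simp add: assms(2))
      then show ?thesis unfolding powr_add[symmetric] by simp
    qed
    also have "q powr 1 = q" using q by simp
    also have "q powr (p / q) * q * ((p - 1) * (n + p)) = (n + p) * (q powr (p / q) * p)"
      using assms(1) by (simp add: assms(2))
    finally have "b powr p = (n + p) * (q powr (p / q) * p)" .
    then show ?thesis by (simp add: powr_minus ell_def divide_inverse mult_ac)
  qed
  have lhs: "measure lebesgue (Kf p f) powr (- p / n) * (LINT x | lborel. Cstar p f (grad f x)) = K * ratio powr (- p / n)"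
  proof -
    have "measure lebesgue (Kf p f) = b powr n * W"
      using measure_Kf[OF assms(1) f assms(2)] b by (simp add: b_def W_def n_def powr_realpow)
    then have "measure lebesgue (Kf p f) powr (- p / n) = b powr (- p) * W powr (- p / n)"
      using n by (simp add: powr_mult powr_powr)
    moreover have "ratio powr (- p / n) = W powr (- p / n) * V powr ((n + p) / n)"
    proof -
      have "- (n + p) / p * (- p / n) = (n + p) / n" using n p1 by (simp add: divide_simps)
      then show ?thesis by (simp only: ratio powr_mult powr_powr)
    qed
    moreover have "V powr (- p / n) * V powr ((n + p) / n) = V"
    proof -
      have "- p / n + (n + p) / n = 1" using n by (simp add: field_simps)
      then show ?thesis using V by (simp flip: powr_add)
    qed
    ultimately show ?thesis
      by (simp add: K_def integral_Cstar_grad[OF p1 f] bp mult_ac flip: V_def n_def)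
  qed
  have rhs: "a2 * Zp p f powr p = K * ratio0 powr (- p / n)"
  proof -
    have "Zp p f powr p = n powr (- p / n) * V powr (- p / n)"
      using n by (simp add: Zp_eq[OF p1 f] powr_powr powr_mult flip: V_def n_def)
    moreover have "n powr ((n + p) / n) * n powr (- p / n) = n"
    proof -
      have "(n + p) / n + - p / n = 1" using n by (simp add: field_simps)
      then show ?thesis using n by (simp flip: powr_add)
    qed
    moreover have "a2 = ell p q * n powr ((n + p) / n) / (a1 n p * (n + p))" by (simp add: a2_def n_def)
    ultimately have "a2 * Zp p f powr p = ell p q / (a1 n p * (n + p)) * (n * V powr (- p / n))"
      by (simp add: mult_ac)
    then show ?thesis unfolding K_def r0 by (simp add: mult_ac)
  qed
  have le: "ratio0 \<le> ratio" unfolding ratio_def ratio0_def by (rule busemann_petty_centroid(1)[OF N p1])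
  \<comment> \<open>The negative exponent turns the lower bound on the ratio into the claimed upper
    bound, and makes equality of powers force equality of ratios.\<close>
  have exponent: "- p / n < 0" using n p1 by simp
  show ?thesis unfolding n_def[symmetric] lhs rhs
  proof (intro conjI impI)
    show "K * ratio powr (- p / n) \<le> K * ratio0 powr (- p / n)"
      using le pos K exponent by (intro mult_left_mono powr_mono2') auto
    assume "K * ratio powr (- p / n) = K * ratio0 powr (- p / n)"
    then have eq: "ratio powr (- p / n) = ratio0 powr (- p / n)" using K by simp
    have "ratio = ratio0"
    proof (rule ccontr)
      assume "ratio \<noteq> ratio0"
      then have "ratio0 < ratio" using le by simp
      then have "ratio powr (- p / n) < ratio0 powr (- p / n)" using pos exponent by (intro powr_less_mono2_neg)
      with eq show False by simp
    qed
    then obtain C0 :: "real^'n^'n" where "det C0 \<noteq> 0" "\<And>x. ?N (C0 *v x) = norm x"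
      using busemann_petty_centroid(2)[OF N p1] by (auto simp: ratio_def ratio0_def)
    then obtain C :: "real^'n^'n" where C: "0 < det C" "\<And>x. ?N (C *v x) = norm x"
      using exists_det_pos_ellipsoid[of C0 ?N] by metis
    define d where "d = det C"
    have d: "0 < d" using C by (simp add: d_def)
    have "invertible C" using C by (simp add: invertible_det_nz)
    \<comment> \<open>M is the inverse of C, so the function g of the claim is f composed with
      C.\<close>
    then obtain M where M: "C ** M = mat 1" "M ** C = mat 1" unfolding invertible_def by auto
    then have "invertible M" by (auto simp: invertible_def)
    have "M ** matrix_inv M = mat 1"
      unfolding matrix_inv_def using someI_ex[OF \<open>invertible M\<close>[unfolded invertible_def]] by blast
    then have "matrix_inv M = C" using M
      by (metis matrix_mul_assoc matrix_mul_lid matrix_mul_rid)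
    have "d * det M = 1" unfolding d_def det_mul[symmetric] M by simp
    then have dM: "det M = inverse d" using d by (simp add: field_simps)
    let ?k = "ball_moment n p"
    define w where "w = omega n"
    have k: "0 < ?k" using n p1 by (intro ball_moment_pos) auto
    have w: "0 < w" using n by (simp add: w_def omega_pos)
    have "V / d = w"
      using ubvol_matrix[OF N, of C] C by (simp add: V_def d_def w_def ubvol_norm n_def)
    then have Vw: "V = w * d" using d by (simp add: field_simps)
    \<comment> \<open>S is the p-th power of the second factor of \<open>cnp\<close>, and also d =
      det C times the energy of f composed with C; both sides of the claim are expressed through S
      and d.\<close>
    define S where "S = n * w / ((n + p) * ?k)"
    have S: "0 < S" using n w np k by (simp add: S_def)
    have "n * w * omega (p - 1) / (2 * omega (n + p - 2)) = S"
      unfolding S_def omega_ball_moment[OF n assms(1), symmetric] by simp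
    then have "cnp n p = (n * w) powr (1 / n) * S powr (1 / p)"
      by (simp add: cnp_def w_def)
    then have "Ep p f powr p = ((n * w) powr (1 / n) * S powr (1 / p) * (n * V) powr (- 1 / n)) powr p"
      by (simp add: Ep_def Zp_eq[OF p1 f] flip: V_def n_def)
    also have "\<dots> = (n * w) powr (p / n) * S * (n * w * d) powr (- p / n)"
      using S p1 by (simp add: powr_mult powr_powr Vw mult.assoc)
    also have "\<dots> = (n * w) powr (p / n + - p / n) * (S * d powr (- p / n))"
      by (simp only: powr_mult powr_add mult_ac)
    also have "\<dots> = d powr (- p / n) * S" using n w by simp
    also have "d powr (- p / n) = det M powr ((p - n) / n) * inverse d"
    proof -
      have "det M powr ((p - n) / n) * inverse d = d powr (- ((p - n) / n)) * d powr (- 1)"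
      proof -
        have "inverse d = d powr (- 1)" using d by (simp add: powr_minus)
        then show ?thesis by (simp only: dM powr_powr mult_minus1)
      qed
      also have "\<dots> = d powr (- ((p - n) / n) + - 1)" by (rule powr_add[symmetric])
      also have "- ((p - n) / n) + - 1 = - p / n" using n by (simp add: field_simps)
      finally show ?thesis by simp
    qed
    finally have "Ep p f powr p = det M powr ((p - n) / n) * (S / d)" by (simp add: divide_inverse mult_ac)
    moreover have "(LINT x | lborel. norm (grad (\<lambda>y. f (matrix_inv M *v y)) x) powr p) = S / d"
      unfolding \<open>matrix_inv M = C\<close> using integral_grad_ellipsoid[OF assms(1) f _ C(2)] C(1)
      by (simp add: S_def d_def w_def n_def)
    ultimately show "\<exists>M :: real^'n^'n. invertible M \<and> det M > 0 \<and>
            Ep p f powr p = det M powr ((p - n) / n) *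
              (LINT x | lborel. norm (grad (\<lambda>y. f (matrix_inv M *v y)) x) powr p)"
      using \<open>invertible M\<close> d dM by (intro exI[of _ M]) auto
  qed
qed

end
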